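(* Consider a family of $k$-local Hamiltonians $H$ on $D$-dimensional cubic lattices $\Lambda$ with $N$ sites ($N\to\infty$). Let $\beta$ be an inverse temperature and $\rho$ a product state such that $|\mathrm{tr}(g_\beta(H)H)-\mathrm{tr}(\rho H)|\le\sigma$. Assume that the Gibbs state $g_\beta(H)$ has exponential decay of correlations, energy standard deviation $\sigma\ge\Omega(\sqrt N)$, and Berry--Esseen error $\zeta_N\le\tilde O(N^{-1/2-\kappa})$ for some $\kappa\ge0$. Let $\alpha\in[0,1)$ be a constant and let $\delta=\Theta\big(N^{\frac{1-\alpha}{D+1}-\kappa}\big)$. Then there are system-size independent (i.e. $N$-independent) positive constants $C_1,\gamma_1,\gamma_4,\gamma_5$, with $\gamma_1$ depending only on $D$, such that for every side length $l$ with $l^D\le C_1N^{\frac1{D+1}-\gamma_1\alpha}$ and for any $U$ drawn from $\mathcal E(\delta)$, $$D_l\big(g_\beta(H),g_\beta(UHU^\dagger)\big)\le O\big(N^{-\gamma_4\alpha-\gamma_5\kappa}\big).$$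
   Context: Setting: $\Lambda$ is a cubic $D$-dimensional lattice with $N$ sites; each site carries a Hilbert space of dimension $d$. $d,D,k,\beta$ are fixed, independent of $N$. $\mathrm d(\cdot,\cdot)$ is the Manhattan distance. A $k$-local Hamiltonian is $H=\sum_{i\in\Lambda}h_i$, where $h_i$ is Hermitian with operator norm $1$ and supported only on sites $j$ with $\mathrm d(i,j)\le k$. Spectral decomposition: $H=\sum_\nu E_\nu P_\nu$, assumed non-degenerate ($\mathrm{tr}(P_\nu)=1$ for all $\nu$). Asymptotics: $O,\Omega,\Theta$ are with respect to $N\to\infty$, with constants independent of $N$; $f=\tilde O(g)$ means $f(N)=O(\log^r(N)\,g(N))$ for some $r$. "System-size independent" constants may depend on the constants in the hypotheses but not on $N$. Gibbs state: $g_\beta(H)=e^{-\beta H}/\mathrm{tr}(e^{-\beta H})$. Energy standard deviation: $\sigma^2=\mathrm{tr}(g_\beta(H)H^2)-\mathrm{tr}(g_\beta(H)H)^2$. Exponential decay of correlations of a state $\tau$: for some $\xi>0$ (independent of $N$), for any regions $X,Y\subset\Lambda$ and operators $A,B$ supported on $X,Y$ respectively, $|\mathrm{tr}(\tau AB)-\mathrm{tr}(\tau A)\mathrm{tr}(\tau B)|\le\|A\|\|B\|e^{-\mathrm d(X,Y)/\xi}$. Berry--Esseen error: $\zeta_N=\sup_x|\mathrm{tr}(g_\beta(H)\Pi_x)-G(x)|$, where $\Pi_x$ is the projector onto all eigenstates of $H$ with energy smaller than $x$ and $G$ is the cumulative distribution function of the Gaussian with the same mean $\mathrm{tr}(g_\beta(H)H)$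 and variance $\sigma^2$. Ensemble $\mathcal E(\delta)$: divide the energy spectrum of $H$ into consecutive energy intervals $I_1,\dots,I_K$ of equal width $\delta$; let $\mathcal W_k$ be the span of the eigenstates of $H$ with energy in $I_k$. $\mathcal E(\delta)$ consists of the unitaries $U=\bigoplus_kU_k$ with $U_k$ in the unitary group of $\mathcal W_k$ (drawn from its Haar measure). The claim is for every such $U$. Local distance: $D_l(\rho,\tau)=\frac1{|\mathcal C_l|}\sum_{C\in\mathcal C_l}\|\rho_C-\tau_C\|_1$, where $\mathcal C_l$ is the set of all hypercubes of side length $l$ in $\Lambda$, $\rho_C$ is the reduced state on $C$, and $\|\cdot\|_1$ is the trace norm. *)

theory Defs
  imports
    "HOL-Probability.Distributions"
    "HOL-Probability.Distribution_Functions"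
    "HOL-Computational_Algebra.Fundamental_Theorem_Algebra"
    "Jordan_Normal_Form.Schur_Decomposition"
    "Jordan_Normal_Form.Spectral_Radius"
    "Jordan_Normal_Form.VS_Connect"
begin

section \<open>Matrix analysis\<close>

definition mat_tr :: "complex mat \<Rightarrow> complex" where
  "mat_tr A = (\<Sum>i<dim_row A. A $$ (i, i))"

definition vec_l2 :: "complex vec \<Rightarrow> real" where
  "vec_l2 v = sqrt (Re (v \<bullet>c v))"

definition op_norm :: "complex mat \<Rightarrow> real" where
  "op_norm A = (SUP v \<in> {v \<in> carrier_vec (dim_col A). vec_l2 v \<le> 1}. vec_l2 (A *\<^sub>v v))"

text \<open>The trace norm is the sum of the singular values, i.e. of the square roots of the
  eigenvalues (with multiplicity) of the positive semidefinite matrix \<open>A\<^sup>\<dagger> A\<close>.\<close>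
definition trace_norm :: "complex mat \<Rightarrow> real" where
  "trace_norm A = (\<Sum>x\<in>#proots (char_poly (mat_adjoint A * A)). sqrt (Re x))"

definition hermitian_mat :: "nat \<Rightarrow> complex mat \<Rightarrow> bool" where
  "hermitian_mat n A \<longleftrightarrow> A \<in> carrier_mat n n \<and> mat_adjoint A = A"

definition unitary_mat :: "nat \<Rightarrow> complex mat \<Rightarrow> bool" where
  "unitary_mat n U \<longleftrightarrow>
     U \<in> carrier_mat n n \<and> mat_adjoint U * U = 1\<^sub>m n \<and> U * mat_adjoint U = 1\<^sub>m n"

definition density_mat :: "nat \<Rightarrow> complex mat \<Rightarrow> bool" where
  "density_mat n \<rho> \<longleftrightarrow>
     hermitian_mat n \<rho> \<and> (\<forall>v\<in>carrier_vec n. 0 \<le> Re ((\<rho> *\<^sub>v v) \<bullet>c v)) \<and> mat_tr \<rho> = 1"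

definition mat_exp :: "complex mat \<Rightarrow> complex mat" where
  "mat_exp A = mat (dim_row A) (dim_row A) (\<lambda>ij. \<Sum>m. (A ^\<^sub>m m) $$ ij / fact m)"

definition orth_proj :: "nat \<Rightarrow> complex vec set \<Rightarrow> complex mat" where
  "orth_proj n W = (THE P. hermitian_mat n P \<and> P * P = P \<and> (\<lambda>v. P *\<^sub>v v) ` carrier_vec n = W)"

section \<open>Energy spectrum and Gibbs state\<close>

definition energies :: "complex mat \<Rightarrow> real set" where
  "energies H = {E. complex_of_real E \<in> spectrum H}"

definition energy_space :: "complex mat \<Rightarrow> real set \<Rightarrow> complex vec set" where
  "energy_space H S =
     LinearCombinations.module.span class_ring (module_vec TYPE(complex) (dim_row H))
       {v. \<exists>E\<in>S. eigenvector H v (complex_of_real E)}"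

definition energy_proj :: "complex mat \<Rightarrow> real set \<Rightarrow> complex mat" where
  "energy_proj H S = orth_proj (dim_row H) (energy_space H S)"

definition nondegenerate :: "complex mat \<Rightarrow> bool" where
  "nondegenerate H \<longleftrightarrow> (\<forall>E\<in>energies H. mat_tr (energy_proj H {E}) = 1)"

definition gibbs :: "real \<Rightarrow> complex mat \<Rightarrow> complex mat" where
  "gibbs \<beta> H =
     (let X = mat_exp (complex_of_real (- \<beta>) \<cdot>\<^sub>m H) in (1 / mat_tr X) \<cdot>\<^sub>m X)"

definition expect :: "complex mat \<Rightarrow> complex mat \<Rightarrow> real" where
  "expect \<tau> A = Re (mat_tr (\<tau> * A))"

definition gibbs_std :: "real \<Rightarrow> complex mat \<Rightarrow> real" where
  "gibbs_std \<beta> H = sqrt (expect (gibbs \<beta> H) (H * H) - (expect (gibbs \<beta> H) H)\<^sup>2)"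

definition berry_esseen_error :: "real \<Rightarrow> complex mat \<Rightarrow> real" where
  "berry_esseen_error \<beta> H =
     (SUP x. \<bar>expect (gibbs \<beta> H) (energy_proj H {..<x})
            - cdf (density lborel (normal_density (expect (gibbs \<beta> H) H) (gibbs_std \<beta> H))) x\<bar>)"

text \<open>The intervals \<open>{e + j \<delta> ..< e + (j + 1) \<delta>}\<close>, \<open>j < K\<close>, divide an energy range containing
  the whole spectrum. The starting point \<open>e\<close> of the division is arbitrary. A direct sum of unitaries
  on the energy spaces of the intervals is the same as a unitary that leaves each of these
  (mutually orthogonal, jointly spanning) subspaces invariant.\<close>
definition energy_ensemble :: "complex mat \<Rightarrow> real \<Rightarrow> complex mat set" where
  "energy_ensemble H \<delta> =
     {U. unitary_mat (dim_row H) U \<and>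
         (\<exists>e K. energies H \<subseteq> {e ..< e + real K * \<delta>} \<and>
           (\<forall>j<K. \<forall>v \<in> energy_space H {e + real j * \<delta> ..< e + real (Suc j) * \<delta>}.
              U *\<^sub>v v \<in> energy_space H {e + real j * \<delta> ..< e + real (Suc j) * \<delta>}))}"

section \<open>Quantum systems on a cubic lattice\<close>

text \<open>The sites of the \<open>D\<close>-dimensional cubic lattice of side \<open>L\<close> are numbered by
  \<open>s < L ^ D\<close>, the \<open>a\<close>-th coordinate of \<open>s\<close> being its \<open>a\<close>-th digit in base \<open>L\<close>.
  Likewise the product basis of the Hilbert space of \<open>N\<close> sites with local dimension \<open>d\<close> is numbered
  by \<open>i < d ^ N\<close>, the basis state of site \<open>s\<close> being the \<open>s\<close>-th digit of \<open>i\<close> in base \<open>d\<close>.\<close>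
definition digit :: "nat \<Rightarrow> nat \<Rightarrow> nat \<Rightarrow> nat" where
  "digit b x p = (x div b ^ p) mod b"

definition manhattan :: "nat \<Rightarrow> nat \<Rightarrow> nat \<Rightarrow> nat \<Rightarrow> nat" where
  "manhattan D L s t = (\<Sum>a<D. nat \<bar>int (digit L s a) - int (digit L t a)\<bar>)"

definition region_dist :: "nat \<Rightarrow> nat \<Rightarrow> nat set \<Rightarrow> nat set \<Rightarrow> nat" where
  "region_dist D L X Y = (INF (s, t) \<in> X \<times> Y. manhattan D L s t)"

definition agree_on :: "nat \<Rightarrow> nat set \<Rightarrow> nat \<Rightarrow> nat \<Rightarrow> bool" where
  "agree_on d X i j \<longleftrightarrow> (\<forall>s\<in>X. digit d i s = digit d j s)"

text \<open>\<open>A = A\<^sub>X \<otimes> 1\<close> on \<open>N\<close> sites: the matrix entries vanish unless the two basis states agree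
  outside \<open>X\<close>, and otherwise depend only on the restrictions of the basis states to \<open>X\<close>.\<close>
definition supported_on :: "nat \<Rightarrow> nat \<Rightarrow> nat set \<Rightarrow> complex mat \<Rightarrow> bool" where
  "supported_on d N X A \<longleftrightarrow> A \<in> carrier_mat (d ^ N) (d ^ N) \<and>
     (\<forall>i<d ^ N. \<forall>j<d ^ N. \<not> agree_on d ({..<N} - X) i j \<longrightarrow> A $$ (i, j) = 0) \<and>
     (\<forall>i<d ^ N. \<forall>j<d ^ N. \<forall>i'<d ^ N. \<forall>j'<d ^ N.
        agree_on d ({..<N} - X) i j \<and> agree_on d ({..<N} - X) i' j' \<and>
        agree_on d X i i' \<and> agree_on d X j j' \<longrightarrow> A $$ (i, j) = A $$ (i', j'))"

definition local_hamiltonian :: "nat \<Rightarrow> nat \<Rightarrow> nat \<Rightarrow> nat \<Rightarrow> complex mat \<Rightarrow> bool" where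
  "local_hamiltonian d D k L H \<longleftrightarrow>
     (\<exists>h :: nat \<Rightarrow> complex mat.
        (\<forall>s<L ^ D. hermitian_mat (d ^ (L ^ D)) (h s) \<and> op_norm (h s) = 1 \<and>
           supported_on d (L ^ D) {t. t < L ^ D \<and> manhattan D L s t \<le> k} (h s)) \<and>
        H = mat (d ^ (L ^ D)) (d ^ (L ^ D)) (\<lambda>ij. \<Sum>s<L ^ D. h s $$ ij))"

definition product_state :: "nat \<Rightarrow> nat \<Rightarrow> complex mat \<Rightarrow> bool" where
  "product_state d N \<rho> \<longleftrightarrow>
     (\<exists>\<phi> :: nat \<Rightarrow> complex mat. (\<forall>s<N. density_mat d (\<phi> s)) \<and>
        \<rho> = mat (d ^ N) (d ^ N) (\<lambda>(i, j). \<Prod>s<N. \<phi> s $$ (digit d i s, digit d j s)))"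

definition exp_decay_correlations ::
    "nat \<Rightarrow> nat \<Rightarrow> nat \<Rightarrow> real \<Rightarrow> complex mat \<Rightarrow> bool" where
  "exp_decay_correlations d D L \<xi> \<tau> \<longleftrightarrow>
     (\<forall>X Y A B. X \<subseteq> {..<L ^ D} \<and> X \<noteq> {} \<and> Y \<subseteq> {..<L ^ D} \<and> Y \<noteq> {} \<and>
        supported_on d (L ^ D) X A \<and> supported_on d (L ^ D) Y B \<longrightarrow>
        cmod (mat_tr (\<tau> * (A * B)) - mat_tr (\<tau> * A) * mat_tr (\<tau> * B))
          \<le> op_norm A * op_norm B * exp (- real (region_dist D L X Y) / \<xi>))"

text \<open>In the reduced state on \<open>C\<close>, digit \<open>m\<close> of a basis index is the state of the \<open>m\<close>-th smallest
  site of \<open>C\<close>.\<close>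
definition reduced_state :: "nat \<Rightarrow> nat \<Rightarrow> nat set \<Rightarrow> complex mat \<Rightarrow> complex mat" where
  "reduced_state d N C \<rho> = mat (d ^ card C) (d ^ card C) (\<lambda>(x, y).
     \<Sum>(i, j) \<in> {(i, j). i < d ^ N \<and> j < d ^ N \<and> agree_on d ({..<N} - C) i j \<and>
         (\<forall>m<card C. digit d i (sorted_list_of_set C ! m) = digit d x m \<and>
                     digit d j (sorted_list_of_set C ! m) = digit d y m)}. \<rho> $$ (i, j))"

definition hypercubes :: "nat \<Rightarrow> nat \<Rightarrow> nat \<Rightarrow> nat set set" where
  "hypercubes D L l =
     {{s. s < L ^ D \<and> (\<forall>a<D. c a \<le> digit L s a \<and> digit L s a < c a + l)} | c :: nat \<Rightarrow> nat.
        \<forall>a<D. c a + l \<le> L}"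

definition local_dist ::
    "nat \<Rightarrow> nat \<Rightarrow> nat \<Rightarrow> nat \<Rightarrow> complex mat \<Rightarrow> complex mat \<Rightarrow> real" where
  "local_dist d D L l \<rho> \<tau> =
     (\<Sum>C\<in>hypercubes D L l.
        trace_norm (reduced_state d (L ^ D) C \<rho> - reduced_state d (L ^ D) C \<tau>))
     / real (card (hypercubes D L l))"

end

theory Submission
  imports Defs "HOL-Real_Asymp.Real_Asymp"
begin

text \<open>Let \<open>g\<close> be the Gibbs state and \<open>\<tau> = U g U\<^sup>\<dagger>\<close> the Gibbs state of \<open>U H U\<^sup>\<dagger>\<close>. As \<open>U\<close> mixes only
  energies at distance at most \<open>\<delta>\<close>, \<open>\<tau> \<le> exp (\<bar>\<beta>\<bar> \<delta>) g\<close>. For cubes at pairwise distance \<open>r\<close>, take on each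
  cube \<open>C\<close> the projection \<open>P C\<close> that attains the trace distance of the two reduced states. By the decay
  of correlations, \<open>tr (g (\<Prod>C. 1 + s P C))\<close> nearly factorizes provided \<open>r\<close> exceeds a multiple of
  \<open>s\<close> times the number of cubes, so Chernoff's bound holds in \<open>g\<close>; it is transferred to \<open>\<tau>\<close> by the
  operator inequality and bounds the sum of the trace distances by
  \<open>(\<bar>\<beta>\<bar> \<delta> + ln 2) / ln (1 + s)\<close> plus \<open>s\<close> times the number of cubes. All cubes are split into
  \<open>(l + r)\<^sup>D\<close> separated families according to the residues of their corners modulo \<open>l + r\<close>.\<close>

section \<open>Matrices\<close>

text \<open>The obstacle is the size of the domination factor: \<delta> may grow like a power of N,
  so \<open>exp (\<bar>\<beta>\<bar> * \<delta>)\<close> says nothing about one observable. Only its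
  logarithm is harmless, and only when it is shared by many cubes, which is why an average over
  cubes is controlled. A second constraint comes from the decay of correlations: its error is
  relative to operator norms, here powers of 1 + s, and not to expectations. With m cubes of
  effective side w = l + r the separation r must therefore exceed a multiple of s m, so it is a
  power N^S. With m about N / w^D and s m about N^S, the average trace distance is of order
  \<Lambda> N^(-S) + s, where \<Lambda> is about \<bar>\<beta>\<bar> \<delta> and, for w about r, s
  is about N^(S (D + 1) - 1). Both terms decay if S lies below 1 / (D + 1) and above the exponent of
  \<delta>; the gap between the two is what \<alpha> and \<kappa> provide. A joint spectral
  decomposition of the commuting projections is avoided: all inequalities are stated for quadratic
  forms in an arbitrary matrix M, and conditioning on an outcome replaces M by M P.\<close>

lemma mat_adjoint_dim [simp]:
  "dim_row (mat_adjoint A) = dim_col A" "dim_col (mat_adjoint A) = dim_row A"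
  by (simp_all add: mat_adjoint_def)

lemma mat_adjoint_carrier [simp]: "A \<in> carrier_mat n m \<Longrightarrow> mat_adjoint A \<in> carrier_mat m n"
  by (metis carrier_matD carrier_matI mat_adjoint_dim)

lemma mat_adjoint_index [simp]:
  "i < dim_col A \<Longrightarrow> j < dim_row A \<Longrightarrow> mat_adjoint (A :: complex mat) $$ (i, j) = cnj (A $$ (j, i))"
  by (simp add: mat_adjoint_def mat_of_rows_index conjugate_vec_def)

lemma mult_mat_index:
  assumes "A \<in> carrier_mat n k" "B \<in> carrier_mat k m" "i < n" "j < m"
  shows "(A * B) $$ (i, j) = (\<Sum>l<k. A $$ (i, l) * B $$ (l, j))"
  using assms by (auto simp: scalar_prod_def lessThan_atLeast0)

lemma mult_mat_vec_index:
  assumes "A \<in> carrier_mat n k" "v \<in> carrier_vec k" "i < n"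
  shows "(A *\<^sub>v v) $ i = (\<Sum>l<k. A $$ (i, l) * v $ l)"
  using assms by (auto simp: scalar_prod_def lessThan_atLeast0)

lemma mat_adjoint_mult:
  assumes "(A :: complex mat) \<in> carrier_mat n k" "B \<in> carrier_mat k m"
  shows "mat_adjoint (A * B) = mat_adjoint B * mat_adjoint A"
proof (rule eq_matI)
  fix i j assume "i < dim_row (mat_adjoint B * mat_adjoint A)"
    "j < dim_col (mat_adjoint B * mat_adjoint A)"
  then have ij: "i < m" "j < n" using assms by auto
  have "mat_adjoint (A * B) $$ (i, j) = cnj (\<Sum>l<k. A $$ (j, l) * B $$ (l, i))"
    using ij assms by (subst mat_adjoint_index) (auto simp: mult_mat_index[OF assms] simp del: index_mult_mat(1))
  also have "\<dots> = (\<Sum>l<k. mat_adjoint B $$ (i, l) * mat_adjoint A $$ (l, j))"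
    using ij assms by (auto simp: mult.commute intro!: sum.cong)
  also have "\<dots> = (mat_adjoint B * mat_adjoint A) $$ (i, j)"
    using ij assms by (subst mult_mat_index[of _ m k _ n]) auto
  finally show "mat_adjoint (A * B) $$ (i, j) = (mat_adjoint B * mat_adjoint A) $$ (i, j)" .
qed (use assms in auto)

lemma mat_adjoint_adjoint [simp]: "mat_adjoint (mat_adjoint (A :: complex mat)) = A"
  by (rule eq_matI) auto

lemma mat_adjoint_one [simp]: "mat_adjoint (1\<^sub>m n :: complex mat) = 1\<^sub>m n"
  by (rule eq_matI) auto

lemma mat_tr_mult_comm:
  assumes "A \<in> carrier_mat n m" "B \<in> carrier_mat m n"
  shows "mat_tr (A * B) = mat_tr (B * A)"
proof -
  have "mat_tr (A * B) = (\<Sum>i<n. \<Sum>l<m. A $$ (i, l) * B $$ (l, i))"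
    using assms by (auto simp: mat_tr_def mult_mat_index[OF assms] simp del: index_mult_mat(1)
        intro!: sum.cong)
  also have "\<dots> = (\<Sum>l<m. \<Sum>i<n. B $$ (l, i) * A $$ (i, l))"
    by (subst sum.swap) (simp add: mult.commute)
  also have "\<dots> = mat_tr (B * A)"
    using assms by (auto simp: mat_tr_def mult_mat_index[of B m n A m] simp del: index_mult_mat(1)
        intro!: sum.cong)
  finally show ?thesis .
qed

lemma mat_tr_add:
  assumes "A \<in> carrier_mat n n" "B \<in> carrier_mat n n"
  shows "mat_tr (A + B) = mat_tr A + mat_tr B"
  using assms by (auto simp: mat_tr_def sum.distrib intro!: sum.cong)

lemma mat_tr_minus:
  assumes "A \<in> carrier_mat n n" "B \<in> carrier_mat n n"
  shows "mat_tr (A - B) = mat_tr A - mat_tr B"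
  using assms by (auto simp: mat_tr_def sum_subtractf intro!: sum.cong)

lemma mat_tr_smult:
  assumes "A \<in> carrier_mat n n"
  shows "mat_tr (c \<cdot>\<^sub>m A) = c * mat_tr A"
  using assms by (auto simp: mat_tr_def sum_distrib_left intro!: sum.cong)

lemma mat_tr_adjoint:
  assumes "A \<in> carrier_mat n n"
  shows "mat_tr (mat_adjoint A) = cnj (mat_tr A)"
  using assms by (auto simp: mat_tr_def intro!: sum.cong)

text \<open>Taking adjoints reverses the product and cyclicity of the trace restores it. Decay of
  correlations is a statement about complex numbers; one real factor lets the real part of a product
  of two expectations split.\<close>

lemma hermitian_mult_tr_real:
  assumes "hermitian_mat n A" "hermitian_mat n B"
  shows "Im (mat_tr (A * B)) = 0"
proof -
  have c: "A \<in> carrier_mat n n" "B \<in> carrier_mat n n" and h: "mat_adjoint A = A" "mat_adjoint B = B"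
    using assms by (auto simp: hermitian_mat_def)
  have "cnj (mat_tr (A * B)) = mat_tr (mat_adjoint (A * B))"
    using c by (subst mat_tr_adjoint[of _ n]) auto
  also have "\<dots> = mat_tr (A * B)"
    using c h by (simp add: mat_adjoint_mult[OF c] mat_tr_mult_comm[of B n n A])
  finally show ?thesis by (metis Reals_cnj_iff complex_is_Real_iff)
qed

section \<open>Spectral theorem\<close>

definition diag_of :: "nat \<Rightarrow> (nat \<Rightarrow> complex) \<Rightarrow> complex mat" where
  "diag_of n f = mat n n (\<lambda>(i, j). if i = j then f i else 0)"

lemma diag_of_carrier [simp]: "diag_of n f \<in> carrier_mat n n"
  by (simp add: diag_of_def)

lemma diag_of_dim [simp]: "dim_row (diag_of n f) = n" "dim_col (diag_of n f) = n"
  by (simp_all add: diag_of_def)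

lemma diag_of_mult_index [simp]:
  assumes "A \<in> carrier_mat n m" "i < n" "j < m"
  shows "(diag_of n f * A) $$ (i, j) = f i * A $$ (i, j)"
proof -
  have "(diag_of n f * A) $$ (i, j) = (\<Sum>l<n. if l = i then f i * A $$ (i, j) else 0)"
    using assms by (subst mult_mat_index[of _ n n _ m]) (auto simp: diag_of_def simp del: sum.delta sum.delta' intro!: sum.cong)
  also have "\<dots> = f i * A $$ (i, j)" using assms by simp
  finally show ?thesis .
qed

lemma mult_diag_of_index [simp]:
  assumes "A \<in> carrier_mat m n" "i < m" "j < n"
  shows "(A * diag_of n f) $$ (i, j) = A $$ (i, j) * f j"
proof -
  have "(A * diag_of n f) $$ (i, j) = (\<Sum>l<n. if l = j then A $$ (i, j) * f j else 0)"
    using assms by (subst mult_mat_index[of _ m n _ n]) (auto simp: diag_of_def simp del: sum.delta sum.delta' intro!: sum.cong)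
  also have "\<dots> = A $$ (i, j) * f j" using assms by simp
  finally show ?thesis .
qed

lemma diag_of_mult [simp]: "diag_of n f * diag_of n g = diag_of n (\<lambda>i. f i * g i)"
  by (rule eq_matI) (auto simp: diag_of_mult_index[of _ n n] simp del: index_mult_mat(1), auto simp: diag_of_def)

lemma diag_of_adjoint [simp]: "mat_adjoint (diag_of n f) = diag_of n (\<lambda>i. cnj (f i))"
  by (rule eq_matI) (auto simp: diag_of_def)

lemma diag_of_one: "diag_of n (\<lambda>_. 1) = 1\<^sub>m n"
  by (rule eq_matI) (auto simp: diag_of_def)

lemma unitary_matD:
  assumes "unitary_mat n U"
  shows "U \<in> carrier_mat n n" "mat_adjoint U * U = 1\<^sub>m n" "U * mat_adjoint U = 1\<^sub>m n"
  using assms by (auto simp: unitary_mat_def)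

lemma unitary_matI:
  assumes "U \<in> carrier_mat n n" "mat_adjoint U * U = 1\<^sub>m n"
  shows "unitary_mat n U"
  using assms mat_mult_left_right_inverse[of "mat_adjoint U" n U] by (auto simp: unitary_mat_def)

lemma unitary_mult:
  assumes "unitary_mat n U" "unitary_mat n V"
  shows "unitary_mat n (U * V)"
proof (rule unitary_matI)
  note U = unitary_matD[OF assms(1)] and V = unitary_matD[OF assms(2)]
  show "U * V \<in> carrier_mat n n" using U V by auto
  have "mat_adjoint (U * V) * (U * V) = mat_adjoint V * ((mat_adjoint U * U) * V)"
    using U(1) V(1) by (simp add: mat_adjoint_mult[of _ n n _ n] assoc_mult_mat[of _ n n _ n _ n]
        mult_carrier_mat[of _ n n _ n])
  then show "mat_adjoint (U * V) * (U * V) = 1\<^sub>m n"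
    using U V by simp
qed

lemma cscalar_self: "v \<bullet>c v = complex_of_real (\<Sum>i<dim_vec v. (cmod (v $ i))\<^sup>2)"
  by (auto simp: scalar_prod_def lessThan_atLeast0 complex_norm_square simp flip: of_real_power intro!: sum.cong)

lemma vec_l2_eq: "vec_l2 v = sqrt (\<Sum>i<dim_vec v. (cmod (v $ i))\<^sup>2)"
  by (simp add: vec_l2_def cscalar_self)

lemma vec_l2_square: "(vec_l2 v)\<^sup>2 = (\<Sum>i<dim_vec v. (cmod (v $ i))\<^sup>2)"
  by (simp add: vec_l2_eq sum_nonneg)

text \<open>Basis completion and Gram-Schmidt keep the eigenvector in first position, so normalizing
  the resulting orthogonal basis gives a unitary whose column 0 is a multiple of it.\<close>

lemma ex_unitary_with_eigencolumn:
  assumes A: "A \<in> carrier_mat n n" and e: "eigenvalue A (e :: complex)"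
  obtains W where "unitary_mat n W" "A *\<^sub>v col W 0 = e \<cdot>\<^sub>v col W 0"
proof -
  define v where "v = find_eigenvector A e"
  from find_eigenvector[OF A e] have ev: "eigenvector A v e" unfolding v_def .
  from this[unfolded eigenvector_def]
  have v[simp]: "v \<in> carrier_vec n" and v0: "v \<noteq> 0\<^sub>v n" and Av: "A *\<^sub>v v = e \<cdot>\<^sub>v v" using A by auto
  have n: "n \<noteq> 0" using v v0 by (intro notI) auto
  interpret cof_vec_space n "TYPE(complex)" .
  define b where "b = basis_completion v"
  define ws where "ws = gram_schmidt n b"
  from basis_completion[OF v v0, folded b_def]
  have span_b: "span (set b) = carrier_vec n" and dist_b: "distinct b" 
    and indep: "\<not> lin_dep (set b)" and b: "set b \<subseteq> carrier_vec n" and hdb: "hd b = v" 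
    and len_b: "length b = n" by auto
  from hdb len_b n obtain vs where bv: "b = v # vs" by (cases b, auto)
  from gram_schmidt_result[OF b dist_b indep refl, folded ws_def]
  have ws: "set ws \<subseteq> carrier_vec n" "corthogonal ws" "length ws = n" 
    by (auto simp: len_b)
  from gram_schmidt_hd[OF v, of vs, folded bv] have hdws: "hd ws = v" unfolding ws_def .
  have wsc: "ws ! i \<in> carrier_vec n" if "i < n" for i using ws that by auto
  have ws0: "ws ! 0 = v" using hdws ws(3) n by (metis hd_conv_nth length_0_conv)
  define c where "c i = vec_l2 (ws ! i)" for i
  have cc: "ws ! i \<bullet>c ws ! i = (complex_of_real (c i))\<^sup>2" if "i < n" for i
    by (simp only: cscalar_self c_def vec_l2_square flip: of_real_power)
  \<comment> \<open>\<open>corthogonal\<close> also says that the product of a basis vector with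
    itself does not vanish, so the normalization below never divides by zero.\<close>
  have c0: "c i \<noteq> 0" if "i < n" for i
    using cc[OF that] corthogonalD[OF ws(2), of i i] that ws(3) by auto
  define W where "W = mat n n (\<lambda>(i, j). (ws ! j) $ i / c j)"
  have W: "W \<in> carrier_mat n n" by (simp add: W_def)
  have "mat_adjoint W * W = 1\<^sub>m n"
  proof (rule eq_matI)
    fix i j assume "i < dim_row (1\<^sub>m n :: complex mat)" "j < dim_col (1\<^sub>m n :: complex mat)"
    then have ij: "i < n" "j < n" by auto
    have "(mat_adjoint W * W) $$ (i, j) = (\<Sum>l<n. cnj (W $$ (l, i)) * W $$ (l, j))"
      using ij W by (subst mult_mat_index[of _ n n _ n]) (auto intro!: sum.cong)
    also have "\<dots> = (\<Sum>l<n. (ws ! j) $ l * cnj ((ws ! i) $ l)) / (c i * c j)"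
      using ij by (auto simp: W_def sum_divide_distrib mult_ac intro!: sum.cong)
    also have "(\<Sum>l<n. (ws ! j) $ l * cnj ((ws ! i) $ l)) = ws ! j \<bullet>c ws ! i"
      using wsc[OF ij(1)] wsc[OF ij(2)] by (auto simp: scalar_prod_def lessThan_atLeast0)
    also have "\<dots> / (c i * c j) = 1\<^sub>m n $$ (i, j)"
    proof (cases "i = j")
      case True
      then show ?thesis using ij c0[OF ij(1)] cc[OF ij(1)] by (simp add: power2_eq_square)
    next
      case False
      then show ?thesis using ij corthogonalD[OF ws(2), of j i] ws(3) by auto
    qed
    finally show "(mat_adjoint W * W) $$ (i, j) = 1\<^sub>m n $$ (i, j)" .
  qed (use W in auto)
  then have "unitary_mat n W" using W by (intro unitary_matI)
  moreover have col: "col W 0 = (1 / c 0) \<cdot>\<^sub>v v"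
    using n by (intro eq_vecI) (auto simp: W_def ws0 carrier_vecD[OF v])
  have "A *\<^sub>v col W 0 = e \<cdot>\<^sub>v col W 0"
    unfolding col using Av A v by (simp add: mult_mat_vec[OF A v] smult_smult_assoc mult.commute)
  ultimately show thesis by (rule that)
qed

text \<open>The functional calculus: \<open>f\<close> applied to a matrix with eigenbasis
  \<open>V\<close>. For fixed \<open>V\<close>, products, powers and exponentials act pointwise on
  \<open>f\<close>, which reduces statements about a Hamiltonian and its Gibbs state to statements
  about weights.\<close>

definition spec_mat :: "nat \<Rightarrow> complex mat \<Rightarrow> (nat \<Rightarrow> complex) \<Rightarrow> complex mat" where
  "spec_mat n V f = V * diag_of n f * mat_adjoint V"

lemma spec_mat_carrier [simp]: "V \<in> carrier_mat n n \<Longrightarrow> spec_mat n V f \<in> carrier_mat n n"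
  by (auto simp: spec_mat_def)

lemma spec_mat_index:
  assumes "V \<in> carrier_mat n n" "i < n" "j < n"
  shows "spec_mat n V f $$ (i, j) = (\<Sum>l<n. V $$ (i, l) * f l * cnj (V $$ (j, l)))"
  unfolding spec_mat_def using assms
  by (subst mult_mat_index[of _ n n _ n]) (auto simp: mult_diag_of_index[of V n n] simp del: index_mult_mat(1) intro!: sum.cong)

lemma spec_mat_adjoint:
  assumes "V \<in> carrier_mat n n"
  shows "mat_adjoint (spec_mat n V f) = spec_mat n V (\<lambda>i. cnj (f i))"
  by (rule eq_matI) (use assms in \<open>auto simp: spec_mat_index[OF assms] carrier_matD[OF spec_mat_carrier[OF assms]] intro!: sum.cong\<close>)

lemma spec_mat_hermitian:
  assumes "V \<in> carrier_mat n n"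
  shows "hermitian_mat n (spec_mat n V (\<lambda>i. complex_of_real (f i)))"
  using assms by (auto simp: hermitian_mat_def spec_mat_adjoint)

lemma spec_mat_mult:
  assumes "unitary_mat n V"
  shows "spec_mat n V f * spec_mat n V g = spec_mat n V (\<lambda>i. f i * g i)"
proof -
  note V = unitary_matD[OF assms]
  have "spec_mat n V f * spec_mat n V g
      = V * (diag_of n f * ((mat_adjoint V * V) * (diag_of n g * mat_adjoint V)))"
    using V(1) by (simp add: spec_mat_def assoc_mult_mat[of _ n n _ n _ n] mult_carrier_mat[of _ n n _ n] del: diag_of_mult)
  also have "\<dots> = V * ((diag_of n f * diag_of n g) * mat_adjoint V)"
    unfolding V(2) using V(1) by (simp add: assoc_mult_mat[of _ n n _ n _ n] mult_carrier_mat[of _ n n _ n] del: diag_of_mult)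
  also have "\<dots> = spec_mat n V (\<lambda>i. f i * g i)"
    using V(1) by (simp add: spec_mat_def assoc_mult_mat[of _ n n _ n _ n])
  finally show ?thesis .
qed

lemma spec_mat_one:
  assumes "unitary_mat n V"
  shows "spec_mat n V (\<lambda>_. 1) = 1\<^sub>m n"
  using unitary_matD[OF assms] by (simp add: spec_mat_def diag_of_one)

lemma spec_mat_smult:
  assumes "V \<in> carrier_mat n n"
  shows "c \<cdot>\<^sub>m spec_mat n V f = spec_mat n V (\<lambda>i. c * f i)"
  by (rule eq_matI) (use assms in \<open>auto simp: spec_mat_index[OF assms] carrier_matD[OF spec_mat_carrier[OF assms]] sum_distrib_left mult_ac\<close>)

lemma spec_mat_minus:
  assumes "V \<in> carrier_mat n n"
  shows "spec_mat n V f - spec_mat n V g = spec_mat n V (\<lambda>i. f i - g i)"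
  by (rule eq_matI) (use assms in \<open>auto simp: spec_mat_index[OF assms] carrier_matD[OF spec_mat_carrier[OF assms]] sum_subtractf algebra_simps\<close>)

lemma spec_mat_tr:
  assumes "unitary_mat n V"
  shows "mat_tr (spec_mat n V f) = (\<Sum>i<n. f i)"
proof -
  note V = unitary_matD[OF assms]
  have "mat_tr (spec_mat n V f) = mat_tr (mat_adjoint V * (V * diag_of n f))"
    unfolding spec_mat_def using V(1) by (intro mat_tr_mult_comm[of _ n n]) auto
  also have "mat_adjoint V * (V * diag_of n f) = diag_of n f"
    using V(1) by (simp add: V(2) flip: assoc_mult_mat[of _ n n _ n _ n])
  finally show ?thesis by (simp add: mat_tr_def diag_of_def)
qed

lemma spec_mat_pow:
  assumes "unitary_mat n V"
  shows "spec_mat n V f ^\<^sub>m k = spec_mat n V (\<lambda>i. f i ^ k)"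
proof (induction k)
  case 0
  then show ?case using unitary_matD(1)[OF assms] by (simp add: spec_mat_one[OF assms] carrier_matD[OF spec_mat_carrier])
next
  case (Suc k)
  then show ?case by (simp add: spec_mat_mult[OF assms] mult.commute)
qed

text \<open>Conjugation moves the eigenbasis and keeps the weights, so the Gibbs states of
  \<open>H\<close> and of \<open>U * H * mat_adjoint U\<close> differ only in their
  eigenbases.\<close>

lemma spec_mat_conj:
  assumes "V \<in> carrier_mat n n" "U \<in> carrier_mat n n"
  shows "U * spec_mat n V f * mat_adjoint U = spec_mat n (U * V) f"
  using assms by (simp add: spec_mat_def mat_adjoint_mult[of _ n n _ n] assoc_mult_mat[of _ n n _ n _ n] mult_carrier_mat[of _ n n _ n])

text \<open>The exponential is an entrywise series; in the eigenbasis each entry is a finite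
  combination of scalar exponential series, from which convergence is inherited.\<close>

lemma mat_exp_spec:
  assumes "unitary_mat n V"
  shows "mat_exp (spec_mat n V f) = spec_mat n V (\<lambda>i. exp (f i))"
proof (rule eq_matI)
  note V = unitary_matD(1)[OF assms]
  have d: "dim_row (spec_mat n V g) = n" "dim_col (spec_mat n V g) = n" for g
    using carrier_matD[OF spec_mat_carrier[OF V]] by auto
  fix i j assume "i < dim_row (spec_mat n V (\<lambda>i. exp (f i)))" "j < dim_col (spec_mat n V (\<lambda>i. exp (f i)))"
  then have ij: "i < n" "j < n" by (auto simp: d)
  have "(\<lambda>m. \<Sum>l<n. V $$ (i, l) * (f l ^ m / fact m) * cnj (V $$ (j, l))) sums
      (\<Sum>l<n. V $$ (i, l) * exp (f l) * cnj (V $$ (j, l)))"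
  proof (intro sums_sum sums_mult sums_mult2)
    fix l show "(\<lambda>m. f l ^ m / fact m) sums exp (f l)"
      using exp_converges[of "f l"] by (simp add: scaleR_conv_of_real field_simps)
  qed
  moreover have "(spec_mat n V f ^\<^sub>m m) $$ (i, j) / fact m =
      (\<Sum>l<n. V $$ (i, l) * (f l ^ m / fact m) * cnj (V $$ (j, l)))" for m
    using ij by (simp add: spec_mat_pow[OF assms] spec_mat_index[OF V] sum_divide_distrib)
  ultimately show "mat_exp (spec_mat n V f) $$ (i, j) = spec_mat n V (\<lambda>i. exp (f i)) $$ (i, j)"
    using ij by (simp add: mat_exp_def d spec_mat_index[OF V] sums_iff)
qed (simp_all add: mat_exp_def carrier_matD[OF spec_mat_carrier[OF unitary_matD(1)[OF assms]]])

lemma gibbs_spec: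
  assumes "unitary_mat n V"
  shows "gibbs \<beta> (spec_mat n V (\<lambda>i. complex_of_real (E i))) =
    spec_mat n V (\<lambda>i. complex_of_real (exp (- \<beta> * E i) / (\<Sum>j<n. exp (- \<beta> * E j))))"
proof -
  note V = unitary_matD(1)[OF assms]
  have e: "exp (- (complex_of_real \<beta> * complex_of_real x)) = complex_of_real (exp (- (\<beta> * x)))" for x
    by (simp flip: exp_of_real)
  show ?thesis
    unfolding gibbs_def Let_def
    by (simp add: spec_mat_smult[OF V] mat_exp_spec[OF assms] spec_mat_tr[OF assms] e)
qed

section \<open>Diagonalization of Hermitian matrices\<close>

lemma hermitian_index:
  assumes "hermitian_mat n A" "i < n" "j < n"
  shows "A $$ (i, j) = cnj (A $$ (j, i))"
  using assms mat_adjoint_index[of i A j] by (auto simp: hermitian_mat_def)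

lemma hermitian_conj:
  assumes "hermitian_mat n A" "W \<in> carrier_mat n n"
  shows "hermitian_mat n (mat_adjoint W * A * W)"
  using assms by (auto simp: hermitian_mat_def mat_adjoint_mult[of _ n n _ n] assoc_mult_mat[of _ n n _ n _ n] mult_carrier_mat[of _ n n _ n])

text \<open>Deflation: conjugation by a unitary whose column 0 is an eigenvector clears column 0
  below the diagonal, and hermiticity then clears row 0. What remains is a smaller Hermitian block,
  to which the induction applies.\<close>

lemma hermitian_spectral:
  assumes "hermitian_mat n A"
  shows "\<exists>V E. unitary_mat n V \<and> A = spec_mat n V (\<lambda>i. complex_of_real (E i))"
  using assms
proof (induction n arbitrary: A)
  case 0
  then show ?case
    by (intro exI[of _ "1\<^sub>m 0"] exI[of _ "\<lambda>_. 0"])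
       (auto simp: unitary_mat_def hermitian_mat_def spec_mat_def intro!: eq_matI)
next
  case (Suc n)
  note h = Suc.prems
  have A: "A \<in> carrier_mat (Suc n) (Suc n)" using h by (simp add: hermitian_mat_def)
  obtain c where "eigenvalue A c"
    using spectrum_non_empty[OF A] by (auto simp: spectrum_def)
  then obtain W where W: "unitary_mat (Suc n) W" and ev: "A *\<^sub>v col W 0 = c \<cdot>\<^sub>v col W 0"
    by (rule ex_unitary_with_eigencolumn[OF A])
  note WD = unitary_matD[OF W]
  define A' where "A' = mat_adjoint W * A * W"
  have A'h: "hermitian_mat (Suc n) A'" unfolding A'_def by (rule hermitian_conj[OF h WD(1)])
  have A'c: "A' \<in> carrier_mat (Suc n) (Suc n)" using A'h by (simp add: hermitian_mat_def)
  have col0: "A' $$ (i, 0) = (if i = 0 then c else 0)" if i: "i < Suc n" for i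
  proof -
    have "(A * W) $$ (l, 0) = c * W $$ (l, 0)" if "l < Suc n" for l
    proof -
      have "(A * W) $$ (l, 0) = (A *\<^sub>v col W 0) $ l" using that A WD(1) by auto
      then show ?thesis unfolding ev using that WD(1) by auto
    qed
    then have "A' $$ (i, 0) = (\<Sum>l<Suc n. mat_adjoint W $$ (i, l) * (c * W $$ (l, 0)))"
      unfolding A'_def using i A WD(1)
      by (simp add: assoc_mult_mat[of _ "Suc n" "Suc n" _ "Suc n" _ "Suc n"] 
          mult_mat_index[of _ "Suc n" "Suc n" _ "Suc n"] mult_carrier_mat[of _ "Suc n" "Suc n" _ "Suc n"]
          del: index_mult_mat(1) sum.lessThan_Suc)
    also have "\<dots> = c * (\<Sum>l<Suc n. mat_adjoint W $$ (i, l) * W $$ (l, 0))"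
      by (simp only: sum_distrib_left mult_ac)
    also have "(\<Sum>l<Suc n. mat_adjoint W $$ (i, l) * W $$ (l, 0)) = (mat_adjoint W * W) $$ (i, 0)"
      using i WD(1) by (subst mult_mat_index[of _ "Suc n" "Suc n" _ "Suc n"]) auto
    finally show ?thesis using i by (simp add: WD(2))
  qed
  have row0: "A' $$ (0, j) = (if j = 0 then c else 0)" if "j < Suc n" for j
    using hermitian_index[OF A'h, of 0 j] hermitian_index[OF A'h, of 0 0] col0[OF that] col0[of 0] that
    by (auto split: if_splits)
  \<comment> \<open>The eigenvalue is a diagonal entry of a Hermitian matrix, hence real.\<close>
  have cr: "c = complex_of_real (Re c)"
    using hermitian_index[OF A'h, of 0 0] col0[of 0] by (simp add: complex_eq_iff)
  define A3 where "A3 = mat n n (\<lambda>(i, j). A' $$ (Suc i, Suc j))"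
  have "hermitian_mat n A3"
    unfolding hermitian_mat_def A3_def
    by (auto intro!: eq_matI simp: hermitian_index[OF A'h, symmetric])
  then obtain V3 E3 where V3: "unitary_mat n V3" and A3: "A3 = spec_mat n V3 (\<lambda>i. complex_of_real (E3 i))"
    using Suc.IH by blast
  note V3D = unitary_matD[OF V3]
  \<comment> \<open>The diagonalizer of the block, extended by a 1 in the upper left corner.\<close>
  define V' where "V' = mat (Suc n) (Suc n) (\<lambda>(i, j). case i of 0 \<Rightarrow> (case j of 0 \<Rightarrow> 1 | Suc j' \<Rightarrow> 0)
      | Suc i' \<Rightarrow> (case j of 0 \<Rightarrow> 0 | Suc j' \<Rightarrow> V3 $$ (i', j')))"
  define E' where "E' = case_nat (Re c) E3"
  have V'c: "V' \<in> carrier_mat (Suc n) (Suc n)" by (simp add: V'_def)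
  have "mat_adjoint V' * V' = 1\<^sub>m (Suc n)"
  proof (rule eq_matI)
    fix i j assume "i < dim_row (1\<^sub>m (Suc n) :: complex mat)" "j < dim_col (1\<^sub>m (Suc n) :: complex mat)"
    then have ij: "i < Suc n" "j < Suc n" by auto
    have "(mat_adjoint V' * V') $$ (i, j) = (\<Sum>l<Suc n. cnj (V' $$ (l, i)) * V' $$ (l, j))"
      using ij V'c by (subst mult_mat_index[of _ "Suc n" "Suc n" _ "Suc n"]) (auto intro!: sum.cong simp del: sum.lessThan_Suc)
    also have "\<dots> = 1\<^sub>m (Suc n) $$ (i, j)"
    proof (cases "i = 0 \<or> j = 0")
      case True
      then show ?thesis using ij
        by (auto simp: sum.lessThan_Suc_shift V'_def split: nat.splits simp del: sum.lessThan_Suc)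
    next
      case False
      then obtain i' j' where [simp]: "i = Suc i'" "j = Suc j'" by (auto simp: gr0_conv_Suc)
      have "(\<Sum>l<n. cnj (V3 $$ (l, i')) * V3 $$ (l, j')) = (mat_adjoint V3 * V3) $$ (i', j')"
        using ij V3D(1) by (subst mult_mat_index[of _ n n _ n]) auto
      then show ?thesis using ij
        by (auto simp: sum.lessThan_Suc_shift V'_def V3D(2) simp del: sum.lessThan_Suc)
    qed
    finally show "(mat_adjoint V' * V') $$ (i, j) = 1\<^sub>m (Suc n) $$ (i, j)" .
  qed (use V'c in auto)
  then have V': "unitary_mat (Suc n) V'" using V'c by (intro unitary_matI)
  have A': "A' = spec_mat (Suc n) V' (\<lambda>i. complex_of_real (E' i))"
  proof (rule eq_matI)
    fix i j assume "i < dim_row (spec_mat (Suc n) V' (\<lambda>i. complex_of_real (E' i)))"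
      "j < dim_col (spec_mat (Suc n) V' (\<lambda>i. complex_of_real (E' i)))"
    then have ij: "i < Suc n" "j < Suc n" using carrier_matD[OF spec_mat_carrier[OF V'c]] by auto
    show "A' $$ (i, j) = spec_mat (Suc n) V' (\<lambda>i. complex_of_real (E' i)) $$ (i, j)"
    proof (cases "i = 0 \<or> j = 0")
      case True
      then show ?thesis using ij col0[OF ij(1)] row0[OF ij(2)] cr
        unfolding spec_mat_index[OF V'c ij]
        by (auto simp: sum.lessThan_Suc_shift V'_def E'_def split: nat.splits simp del: sum.lessThan_Suc)
    next
      case False
      then obtain i' j' where [simp]: "i = Suc i'" "j = Suc j'" by (auto simp: gr0_conv_Suc)
      have "A' $$ (i, j) = A3 $$ (i', j')" using ij by (simp add: A3_def)
      then show ?thesis using ij unfolding A3 spec_mat_index[OF V'c ij]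
        by (auto simp: spec_mat_index[OF V3D(1)] sum.lessThan_Suc_shift V'_def E'_def simp del: sum.lessThan_Suc)
    qed
  qed (use A'c carrier_matD[OF spec_mat_carrier[OF V'c]] in auto)
  have "A = (W * mat_adjoint W) * A * (W * mat_adjoint W)" unfolding WD(3) using A by simp
  also have "\<dots> = W * A' * mat_adjoint W"
    unfolding A'_def using A WD(1)
    by (simp add: assoc_mult_mat[of _ "Suc n" "Suc n" _ "Suc n" _ "Suc n"] mult_carrier_mat[of _ "Suc n" "Suc n" _ "Suc n"])
  also have "\<dots> = spec_mat (Suc n) (W * V') (\<lambda>i. complex_of_real (E' i))"
    unfolding A' by (rule spec_mat_conj[OF V'c WD(1)])
  finally show ?case using unitary_mult[OF W V'] by blast
qed

text \<open>The trace norm counts roots of a characteristic polynomial with multiplicity. Similarity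
  to the diagonal matrix of the squares makes this polynomial an explicit product of linear factors,
  whose multiset of roots can be read off.\<close>

lemma trace_norm_spec:
  assumes "unitary_mat n V"
  shows "trace_norm (spec_mat n V (\<lambda>i. complex_of_real (x i))) = (\<Sum>i<n. \<bar>x i\<bar>)"
proof -
  note V = unitary_matD[OF assms]
  let ?f = "\<lambda>i. complex_of_real ((x i)\<^sup>2)"
  have "mat_adjoint (spec_mat n V (\<lambda>i. complex_of_real (x i))) * spec_mat n V (\<lambda>i. complex_of_real (x i))
      = spec_mat n V ?f"
    by (simp add: spec_mat_adjoint[OF V(1)] spec_mat_mult[OF assms] power2_eq_square)
  moreover have "similar_mat (spec_mat n V ?f) (diag_of n ?f)"
    using V by (intro similar_matI[of _ _ V "mat_adjoint V" n]) (auto simp: spec_mat_def)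
  then have "char_poly (spec_mat n V ?f) = char_poly (diag_of n ?f)" by (rule char_poly_similar)
  moreover have "char_poly (diag_of n ?f) = (\<Prod>a\<leftarrow>diag_mat (diag_of n ?f). [:- a, 1:])"
    by (rule char_poly_upper_triangular[of _ n]) (auto simp: diag_of_def)
  moreover have "diag_mat (diag_of n ?f) = map ?f [0..<n]"
    by (auto simp: diag_mat_def diag_of_def)
  moreover have "proots (\<Prod>a\<leftarrow>xs. [:- a, 1:]) = mset xs" for xs :: "complex list"
  proof -
    have "proots (\<Prod>a\<leftarrow>xs. [:- a, 1:]) = (\<Sum>p\<leftarrow>map (\<lambda>a. [:- a, 1:]) xs. proots p)"
      using proots_prod_list[of "map (\<lambda>a. [:- a, 1:]) xs"] by (simp add: image_iff)
    also have "\<dots> = mset xs" by (induction xs) auto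
    finally show ?thesis .
  qed
  ultimately have "trace_norm (spec_mat n V (\<lambda>i. complex_of_real (x i)))
      = (\<Sum>y\<in>#mset (map ?f [0..<n]). sqrt (Re y))"
    unfolding trace_norm_def by (simp only: )
  also have "\<dots> = sum_list (map (\<lambda>i. \<bar>x i\<bar>) [0..<n])"
    by (simp add: o_def flip: sum_mset_sum_list mset_map of_real_power)
  also have "\<dots> = (\<Sum>i<n. \<bar>x i\<bar>)"
    by (simp add: interv_sum_list_conv_sum_set_nat lessThan_atLeast0)
  finally show ?thesis .
qed

text \<open>\<open>P\<close> projects onto the positive eigenvalues. As the eigenvalues sum to zero,
  their positive and negative parts have equal weight, so the sum of absolute values is twice the
  positive part.\<close>

lemma trace_norm_dual:
  assumes "hermitian_mat n X" "mat_tr X = 0"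
  obtains P where "hermitian_mat n P" "P * P = P" "trace_norm X = 2 * Re (mat_tr (X * P))"
proof -
  obtain V x where V: "unitary_mat n V" and X: "X = spec_mat n V (\<lambda>i. complex_of_real (x i))"
    using hermitian_spectral[OF assms(1)] by blast
  define p :: "nat \<Rightarrow> real" where "p i = (if x i > 0 then 1 else 0)" for i
  define P where "P = spec_mat n V (\<lambda>i. complex_of_real (p i))"
  show thesis
  proof
    show "hermitian_mat n P" unfolding P_def by (rule spec_mat_hermitian[OF unitary_matD(1)[OF V]])
    have pp: "complex_of_real (p i) * complex_of_real (p i) = complex_of_real (p i)" for i by (simp add: p_def)
    show "P * P = P" by (simp add: P_def spec_mat_mult[OF V] pp)
    have "complex_of_real (\<Sum>i<n. x i) = 0" using assms(2) by (simp add: X spec_mat_tr[OF V])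
    then have s0: "(\<Sum>i<n. x i) = 0" using of_real_eq_0_iff by blast
    have "trace_norm X = (\<Sum>i<n. 2 * (x i * p i) - x i)"
      unfolding X trace_norm_spec[OF V] by (intro sum.cong) (auto simp: p_def)
    also have "\<dots> = 2 * Re (mat_tr (X * P))"
      by (simp add: s0 X P_def spec_mat_mult[OF V] spec_mat_tr[OF V] sum_subtractf flip: sum_distrib_left)
    finally show "trace_norm X = 2 * Re (mat_tr (X * P))" .
  qed
qed

section \<open>Gibbs states and the ensemble\<close>

text \<open>If \<open>mat_adjoint M * M\<close> is a state, this is the real part of the expectation
  of \<open>X\<close> in it. \<open>M\<close> need not be normalized, which allows conditioning on
  measurement outcomes, and nonnegativity for all \<open>M\<close> serves as positivity of
  \<open>X\<close>.\<close>

definition quad_form :: "complex mat \<Rightarrow> complex mat \<Rightarrow> real" where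
  "quad_form M X = Re (mat_tr (M * X * mat_adjoint M))"

text \<open>Splitting each weight into two square roots writes the matrix as
  \<open>mat_adjoint ?K * ?K\<close>; cyclicity of the trace does the rest.\<close>

lemma spec_mat_tr_quad_form:
  assumes V: "V \<in> carrier_mat n n" and X: "X \<in> carrier_mat n n" and p: "\<And>i. i < n \<Longrightarrow> 0 \<le> p i"
  shows "Re (mat_tr (spec_mat n V (\<lambda>i. complex_of_real (p i)) * X)) =
    quad_form (diag_of n (\<lambda>i. complex_of_real (sqrt (p i))) * mat_adjoint V) X"
proof -
  let ?K = "diag_of n (\<lambda>i. complex_of_real (sqrt (p i))) * mat_adjoint V"
  have K: "?K \<in> carrier_mat n n" using V by auto
  have d: "diag_of n (\<lambda>i. complex_of_real (p i)) =
      diag_of n (\<lambda>i. complex_of_real (sqrt (p i))) * diag_of n (\<lambda>i. complex_of_real (sqrt (p i)))"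
    unfolding diag_of_mult
    by (rule eq_matI) (auto simp: diag_of_def p simp flip: of_real_mult)
  have "spec_mat n V (\<lambda>i. complex_of_real (p i)) = mat_adjoint ?K * ?K"
    unfolding spec_mat_def d using V
    by (simp add: mat_adjoint_mult[of _ n n _ n] assoc_mult_mat[of _ n n _ n _ n] mult_carrier_mat[of _ n n _ n] del: diag_of_mult)
  then have "mat_tr (spec_mat n V (\<lambda>i. complex_of_real (p i)) * X) = mat_tr (mat_adjoint ?K * (?K * X))"
    using K X V by (simp add: assoc_mult_mat[of "mat_adjoint ?K" n n ?K n X n])
  also have "\<dots> = mat_tr (?K * X * mat_adjoint ?K)"
    using K X by (intro mat_tr_mult_comm[of _ n n]) auto
  finally show ?thesis by (simp add: quad_form_def)
qed

lemma spec_mat_tr_mono: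
  assumes V: "V \<in> carrier_mat n n" and X: "X \<in> carrier_mat n n"
    and pos: "\<And>M. M \<in> carrier_mat n n \<Longrightarrow> 0 \<le> quad_form M X" and le: "\<And>i. i < n \<Longrightarrow> p i \<le> p' i"
  shows "Re (mat_tr (spec_mat n V (\<lambda>i. complex_of_real (p i)) * X))
    \<le> Re (mat_tr (spec_mat n V (\<lambda>i. complex_of_real (p' i)) * X))"
proof -
  have "0 \<le> Re (mat_tr (spec_mat n V (\<lambda>i. complex_of_real (p' i - p i)) * X))"
    using V le by (subst spec_mat_tr_quad_form[OF V X]) (auto intro!: pos)
  also have "spec_mat n V (\<lambda>i. complex_of_real (p' i - p i)) * X =
      spec_mat n V (\<lambda>i. complex_of_real (p' i)) * X - spec_mat n V (\<lambda>i. complex_of_real (p i)) * X"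
    using V X by (simp add: spec_mat_minus[OF V, symmetric] minus_mult_distrib_mat[of _ n n])
  also have "mat_tr \<dots> = mat_tr (spec_mat n V (\<lambda>i. complex_of_real (p' i)) * X)
      - mat_tr (spec_mat n V (\<lambda>i. complex_of_real (p i)) * X)"
    using V X by (intro mat_tr_minus[of _ n]) (auto intro!: mult_carrier_mat[of _ n n])
  finally show ?thesis by simp
qed

text \<open>In the coordinates of \<open>V\<close>, an eigenvector y of energy e satisfies e y_k =
  E_k y_k, so y_k vanishes unless e = E_k, and this passes to linear combinations. The spanning
  eigenvectors may be unrelated to the columns of \<open>V\<close>.\<close>

lemma energy_space_component_zero:
  assumes V: "unitary_mat n V" and H: "H = spec_mat n V (\<lambda>i. complex_of_real (E i))"
    and x: "x \<in> energy_space H S" and k: "k < n" "E k \<notin> S"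
  shows "(mat_adjoint V *\<^sub>v x) $ k = 0"
proof -
  note VD = unitary_matD[OF V]
  have Hc: "H \<in> carrier_mat n n" using VD by (simp add: H)
  have VH: "mat_adjoint V * H = diag_of n (\<lambda>i. complex_of_real (E i)) * mat_adjoint V"
  proof -
    have "mat_adjoint V * H = (mat_adjoint V * V) * (diag_of n (\<lambda>i. complex_of_real (E i)) * mat_adjoint V)"
      unfolding H spec_mat_def using VD(1)
      by (simp add: assoc_mult_mat[of _ n n _ n _ n] mult_carrier_mat[of _ n n _ n])
    then show ?thesis using VD by simp
  qed
  have ev: "(mat_adjoint V *\<^sub>v y) $ k = 0" if y: "eigenvector H y (complex_of_real e)" "e \<in> S" for y e
  proof -
    have yc: "y \<in> carrier_vec n" and Hy: "H *\<^sub>v y = complex_of_real e \<cdot>\<^sub>v y"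
      using y Hc by (auto simp: eigenvector_def)
    have "complex_of_real e * (mat_adjoint V *\<^sub>v y) $ k = (mat_adjoint V *\<^sub>v (H *\<^sub>v y)) $ k"
      unfolding Hy using VD(1) yc k by (simp add: mult_mat_vec[of _ n n])
    also have "\<dots> = (diag_of n (\<lambda>i. complex_of_real (E i)) *\<^sub>v (mat_adjoint V *\<^sub>v y)) $ k"
      using VD(1) yc Hc VH by (simp flip: assoc_mult_mat_vec[of _ n n _ n])
    also have "\<dots> = (\<Sum>l<n. if l = k then complex_of_real (E k) * (mat_adjoint V *\<^sub>v y) $ k else 0)"
      using VD(1) yc k
      by (subst mult_mat_vec_index[of _ n n]) (auto simp: diag_of_def simp del: sum.delta sum.delta' index_mult_mat_vec intro!: sum.cong mult_mat_vec_carrier)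
    also have "\<dots> = complex_of_real (E k) * (mat_adjoint V *\<^sub>v y) $ k" using k by simp
    finally show ?thesis using y k by auto
  qed
  interpret vec_space "TYPE(complex)" n .
  have dimH: "dim_row H = n" using Hc by auto
  obtain a B where B: "finite B" "B \<subseteq> {v. \<exists>E\<in>S. eigenvector H v (complex_of_real E)}" and xl: "x = lincomb a B"
    using x unfolding energy_space_def span_def dimH by auto
  have Bc: "B \<subseteq> carrier_vec n" using B(2) Hc by (auto simp: eigenvector_def)
  have xc: "x \<in> carrier_vec n" unfolding xl using Bc by (intro lincomb_closed) auto
  have "(mat_adjoint V *\<^sub>v x) $ k = (\<Sum>l<n. mat_adjoint V $$ (k, l) * (\<Sum>v\<in>B. a v * v $ l))"
    using VD(1) xc k by (subst mult_mat_vec_index[of _ n n]) (auto simp: xl lincomb_index[OF _ Bc] intro!: sum.cong)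
  also have "\<dots> = (\<Sum>v\<in>B. a v * (\<Sum>l<n. mat_adjoint V $$ (k, l) * v $ l))"
    by (subst sum_distrib_left, subst sum.swap) (simp add: sum_distrib_left mult_ac)
  also have "\<dots> = (\<Sum>v\<in>B. a v * (mat_adjoint V *\<^sub>v v) $ k)"
    using VD(1) k Bc by (intro sum.cong refl, subst mult_mat_vec_index[of _ n n]) auto
  also have "\<dots> = 0" using ev B(2) by (intro sum.neutral) auto
  finally show ?thesis .
qed

lemma spec_mat_col_eigenvector:
  assumes V: "unitary_mat n V" and H: "H = spec_mat n V (\<lambda>i. complex_of_real (E i))" and i: "i < n"
  shows "eigenvector H (col V i) (complex_of_real (E i))"
proof -
  note VD = unitary_matD[OF V]
  have Hc: "H \<in> carrier_mat n n" using VD by (simp add: H)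
  have HV: "H * V = V * diag_of n (\<lambda>i. complex_of_real (E i))"
    unfolding H spec_mat_def using VD
    by (simp add: assoc_mult_mat[of _ n n _ n _ n] mult_carrier_mat[of _ n n _ n])
  have "H *\<^sub>v col V i = col (H * V) i" using i VD(1) Hc by (intro eq_vecI) auto
  also have "\<dots> = complex_of_real (E i) \<cdot>\<^sub>v col V i"
    unfolding HV using i VD(1) by (intro eq_vecI) (auto simp: mult_diag_of_index[of V n n] simp del: index_mult_mat(1))
  finally have "H *\<^sub>v col V i = complex_of_real (E i) \<cdot>\<^sub>v col V i" .
  moreover have "col V i \<noteq> 0\<^sub>v n"
  proof
    assume z: "col V i = 0\<^sub>v n"
    have "V $$ (l, i) = 0" if "l < n" for l
      using arg_cong[OF z, of "\<lambda>v. v $ l"] that i VD(1) by simp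
    then have "(mat_adjoint V * V) $$ (i, i) = 0"
      using i VD(1) by (subst mult_mat_index[of _ n n _ n]) auto
    then show False using i by (simp add: VD(2))
  qed
  ultimately show ?thesis using Hc VD(1) i by (simp add: eigenvector_def)
qed

lemma spec_mat_energies:
  assumes "unitary_mat n V" "H = spec_mat n V (\<lambda>i. complex_of_real (E i))" "i < n"
  shows "E i \<in> energies H"
  using spec_mat_col_eigenvector[OF assms] by (auto simp: energies_def spectrum_def eigenvalue_def)

lemma energy_space_col:
  assumes V: "unitary_mat n V" and H: "H = spec_mat n V (\<lambda>i. complex_of_real (E i))"
    and i: "i < n" "E i \<in> S"
  shows "col V i \<in> energy_space H S"
proof -
  interpret vec_space "TYPE(complex)" n .
  have Hc: "H \<in> carrier_mat n n" using unitary_matD[OF V] by (simp add: H)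
  then have dimH: "dim_row H = n" by auto
  show ?thesis unfolding energy_space_def dimH
    using spec_mat_col_eigenvector[OF V H i(1)] i Hc by (intro span_mem) (auto simp: eigenvector_def)
qed

text \<open>An ensemble unitary only mixes energies within one interval of width \<open>\<delta>\<close>. The weights
  \<open>pt\<close>, constant on the intervals and within a factor \<open>exp (\<bar>\<beta>\<bar> \<delta>)\<close> of the Gibbs weights, hence
  define an operator that commutes with \<open>U\<close>.\<close>
lemma gibbs_ensemble_dominated:
  assumes H: "hermitian_mat n H" and U: "U \<in> energy_ensemble H \<delta>" and \<delta>: "\<delta> > 0"
    and X: "X \<in> carrier_mat n n" and pos: "\<And>M. M \<in> carrier_mat n n \<Longrightarrow> 0 \<le> quad_form M X"
  shows "Re (mat_tr (gibbs \<beta> (U * H * mat_adjoint U) * X))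
    \<le> exp (\<bar>\<beta>\<bar> * \<delta>) * Re (mat_tr (gibbs \<beta> H * X))"
proof -
  obtain V E where V: "unitary_mat n V" and HV: "H = spec_mat n V (\<lambda>i. complex_of_real (E i))"
    using hermitian_spectral[OF H] by blast
  note VD = unitary_matD[OF V]
  have dimH: "dim_row H = n" using H by (auto simp: hermitian_mat_def)
  obtain e K where Uu: "unitary_mat n U" and en: "energies H \<subseteq> {e ..< e + real K * \<delta>}" and
    inv: "\<And>j v. j < K \<Longrightarrow> v \<in> energy_space H {e + real j * \<delta> ..< e + real (Suc j) * \<delta>} \<Longrightarrow>
       U *\<^sub>v v \<in> energy_space H {e + real j * \<delta> ..< e + real (Suc j) * \<delta>}"
    using U by (auto simp: energy_ensemble_def dimH)
  note UD = unitary_matD[OF Uu]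
  \<comment> \<open>The number of the interval that contains the energy \<open>E i\<close>.\<close>
  define J where "J i = nat \<lfloor>(E i - e) / \<delta>\<rfloor>" for i
  have J: "J i < K" "e + real (J i) * \<delta> \<le> E i" "E i < e + real (Suc (J i)) * \<delta>" if "i < n" for i
  proof -
    have *: "e \<le> E i" "E i < e + real K * \<delta>"
      using en spec_mat_energies[OF V HV that] by auto
    have nn: "0 \<le> (E i - e) / \<delta>" using * \<delta> by simp
    then have J1: "real (J i) = of_int \<lfloor>(E i - e) / \<delta>\<rfloor>" by (simp add: J_def)
    then have J2: "real (J i) \<le> (E i - e) / \<delta>" "(E i - e) / \<delta> < real (J i) + 1" by linarith+
    then show "e + real (J i) * \<delta> \<le> E i" "E i < e + real (Suc (J i)) * \<delta>"
      using \<delta> by (auto simp: field_simps)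
    have "(E i - e) / \<delta> < real K" using * \<delta> by (simp add: field_simps)
    then show "J i < K" using J2 by linarith
  qed
  \<comment> \<open>\<open>U\<close> in the eigenbasis of \<open>H\<close>; invariance of the
    interval spaces will make it block diagonal.\<close>
  define W where "W = mat_adjoint V * (U * V)"
  have W: "unitary_mat n W" unfolding W_def using V Uu
    by (intro unitary_mult) (auto simp: unitary_mat_def)
  note WD = unitary_matD[OF W]
  have Wz: "W $$ (k, i) = 0" if ki: "k < n" "i < n" "J k \<noteq> J i" for k i
  proof -
    let ?S = "{e + real (J i) * \<delta> ..< e + real (Suc (J i)) * \<delta>}"
    have "U *\<^sub>v col V i \<in> energy_space H ?S"
      using J[OF ki(2)] by (intro inv energy_space_col[OF V HV ki(2)]) auto
    moreover have "E k \<notin> ?S"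
    proof
      assume "E k \<in> ?S"
      then have "real (J i) * \<delta> < real (Suc (J k)) * \<delta>" "real (J k) * \<delta> < real (Suc (J i)) * \<delta>"
        using J[OF ki(1)] by auto
      then have "real (J i) < real (Suc (J k))" "real (J k) < real (Suc (J i))"
        using \<delta> by (auto simp only: mult_less_cancel_right)
      then show False using ki(3) by simp
    qed
    ultimately have "(mat_adjoint V *\<^sub>v (U *\<^sub>v col V i)) $ k = 0"
      by (rule energy_space_component_zero[OF V HV _ ki(1)])
    moreover have "U *\<^sub>v col V i = col (U * V) i" using ki UD(1) VD(1) by (intro eq_vecI) auto
    ultimately show ?thesis unfolding W_def using ki UD(1) VD(1) by auto
  qed
  define Z where "Z = (\<Sum>j<n. exp (- \<beta> * E j))"
  define p where "p i = exp (- \<beta> * E i) / Z" for i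
  \<comment> \<open>The larger of the weights at the two ends of the interval: \<beta> may have
    either sign, so either end can carry the maximum.\<close>
  define pt where "pt i = exp (max (- \<beta> * (e + real (J i) * \<delta>)) (- \<beta> * (e + real (Suc (J i)) * \<delta>))) / Z" for i
  have Z: "Z \<ge> 0" by (auto simp: Z_def intro!: sum_nonneg)
  have p1: "p i \<le> pt i" and p2: "pt i \<le> exp (\<bar>\<beta>\<bar> * \<delta>) * p i" if "i < n" for i
  proof -
    define a where "a = e + real (J i) * \<delta>"
    have b: "e + real (Suc (J i)) * \<delta> = a + \<delta>" by (simp add: a_def algebra_simps)
    have a: "a \<le> E i" "E i < a + \<delta>" using J[OF that] b by (auto simp: a_def)
    have m1: "- \<beta> * E i \<le> max (- \<beta> * a) (- \<beta> * (a + \<delta>))"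
    proof (cases "\<beta> \<ge> 0")
      case True
      then have "\<beta> * a \<le> \<beta> * E i" using a by (intro mult_left_mono) auto
      then show ?thesis by simp
    next
      case False
      then have "- \<beta> * E i \<le> - \<beta> * (a + \<delta>)" using a by (intro mult_left_mono) auto
      then show ?thesis by simp
    qed
    have "- \<beta> * x \<le> \<bar>\<beta>\<bar> * \<delta> + - \<beta> * E i" if "\<bar>E i - x\<bar> \<le> \<delta>" for x
    proof -
      have "\<beta> * (E i - x) \<le> \<bar>\<beta>\<bar> * \<bar>E i - x\<bar>" by (metis abs_ge_self abs_mult)
      also have "\<dots> \<le> \<bar>\<beta>\<bar> * \<delta>" using that by (intro mult_left_mono) auto
      finally show ?thesis by (simp add: algebra_simps)
    qed
    then have m2: "max (- \<beta> * a) (- \<beta> * (a + \<delta>)) \<le> \<bar>\<beta>\<bar> * \<delta> + - \<beta> * E i"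
      using a \<delta> by (auto simp: max_def)
    show "p i \<le> pt i" unfolding p_def pt_def b a_def[symmetric] using m1 Z by (intro divide_right_mono) auto
    have "pt i \<le> exp (\<bar>\<beta>\<bar> * \<delta> + - \<beta> * E i) / Z"
      unfolding pt_def b a_def[symmetric] using m2 Z by (intro divide_right_mono) auto
    then show "pt i \<le> exp (\<bar>\<beta>\<bar> * \<delta>) * p i" unfolding exp_add p_def by simp
  qed
  \<comment> \<open>On each block the diagonal matrix of \<open>pt\<close> is a multiple of the
    identity, so conjugation by the block diagonal unitary \<open>W\<close> fixes it.\<close>
  have "spec_mat n W (\<lambda>i. complex_of_real (pt i)) = diag_of n (\<lambda>i. complex_of_real (pt i))"
  proof (rule eq_matI)
    fix i j assume "i < dim_row (diag_of n (\<lambda>i. complex_of_real (pt i)))" "j < dim_col (diag_of n (\<lambda>i. complex_of_real (pt i)))"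
    then have ij: "i < n" "j < n" by auto
    have "spec_mat n W (\<lambda>i. complex_of_real (pt i)) $$ (i, j) = (\<Sum>l<n. complex_of_real (pt i) * (W $$ (i, l) * cnj (W $$ (j, l))))"
      unfolding spec_mat_index[OF WD(1) ij]
    proof (intro sum.cong refl)
      fix l assume l: "l \<in> {..<n}"
      show "W $$ (i, l) * complex_of_real (pt l) * cnj (W $$ (j, l)) = complex_of_real (pt i) * (W $$ (i, l) * cnj (W $$ (j, l)))"
      proof (cases "J i = J l")
        case True
        then have "pt i = pt l" by (simp add: pt_def)
        then show ?thesis by simp
      next
        case False
        then show ?thesis using Wz[of i l] ij l by simp
      qed
    qed
    also have "\<dots> = complex_of_real (pt i) * (W * mat_adjoint W) $$ (i, j)"
      using ij WD(1) by (subst mult_mat_index[of _ n n _ n]) (auto simp: sum_distrib_left)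
    finally show "spec_mat n W (\<lambda>i. complex_of_real (pt i)) $$ (i, j) = diag_of n (\<lambda>i. complex_of_real (pt i)) $$ (i, j)"
      using ij by (simp add: WD(3) diag_of_def)
  qed (use carrier_matD[OF spec_mat_carrier[OF WD(1)]] in auto)
  then have "V * spec_mat n W (\<lambda>i. complex_of_real (pt i)) * mat_adjoint V = spec_mat n V (\<lambda>i. complex_of_real (pt i))"
    by (simp add: spec_mat_def)
  moreover have "V * W = U * V"
  proof -
    have "V * W = (V * mat_adjoint V) * (U * V)"
      unfolding W_def using VD(1) UD(1)
      by (simp add: assoc_mult_mat[of _ n n _ n _ n] mult_carrier_mat[of _ n n _ n])
    then show ?thesis using VD UD by simp
  qed
  ultimately have pteq: "spec_mat n (U * V) (\<lambda>i. complex_of_real (pt i)) = spec_mat n V (\<lambda>i. complex_of_real (pt i))"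
    by (simp add: spec_mat_conj[OF WD(1) VD(1)])
  have g: "gibbs \<beta> H = spec_mat n V (\<lambda>i. complex_of_real (p i))"
    unfolding HV gibbs_spec[OF V] p_def Z_def ..
  have g': "gibbs \<beta> (U * H * mat_adjoint U) = spec_mat n (U * V) (\<lambda>i. complex_of_real (p i))"
    unfolding HV spec_mat_conj[OF VD(1) UD(1)] gibbs_spec[OF unitary_mult[OF Uu V]] p_def Z_def ..
  have UV: "U * V \<in> carrier_mat n n" using UD VD by auto
  \<comment> \<open>Raise the weights from \<open>p\<close> to \<open>pt\<close> in the rotated
    eigenbasis, drop the rotation, and compare \<open>pt\<close> with a multiple of \<open>p\<close>
    in the original eigenbasis.\<close>
  have "Re (mat_tr (gibbs \<beta> (U * H * mat_adjoint U) * X))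
      \<le> Re (mat_tr (spec_mat n (U * V) (\<lambda>i. complex_of_real (pt i)) * X))"
    unfolding g' by (rule spec_mat_tr_mono[OF UV X pos p1])
  also have "\<dots> \<le> Re (mat_tr (spec_mat n V (\<lambda>i. complex_of_real (exp (\<bar>\<beta>\<bar> * \<delta>) * p i)) * X))"
    unfolding pteq by (rule spec_mat_tr_mono[OF VD(1) X pos p2])
  also have "spec_mat n V (\<lambda>i. complex_of_real (exp (\<bar>\<beta>\<bar> * \<delta>) * p i)) = complex_of_real (exp (\<bar>\<beta>\<bar> * \<delta>)) \<cdot>\<^sub>m gibbs \<beta> H"
    by (simp add: g spec_mat_smult[OF VD(1)])
  also have "mat_tr (complex_of_real (exp (\<bar>\<beta>\<bar> * \<delta>)) \<cdot>\<^sub>m gibbs \<beta> H * X) = complex_of_real (exp (\<bar>\<beta>\<bar> * \<delta>)) * mat_tr (gibbs \<beta> H * X)"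
    using X VD(1) by (simp add: g mult_smult_assoc_mat[of _ n n _ n] mat_tr_smult[of _ n] mult_carrier_mat[of _ n n _ n] del: of_real_exp)
  finally show ?thesis by (simp del: of_real_exp)
qed

text \<open>A square root of the Gibbs state represents all its expectations by one quadratic form.
  Positive dimension makes the partition function positive and so the weights normalized.\<close>

lemma gibbs_quad_form:
  assumes H: "hermitian_mat n H" and n: "n > 0"
  obtains K where "K \<in> carrier_mat n n" "\<And>X. X \<in> carrier_mat n n \<Longrightarrow> Re (mat_tr (gibbs \<beta> H * X)) = quad_form K X"
    "hermitian_mat n (gibbs \<beta> H)" "mat_tr (gibbs \<beta> H) = 1"
proof -
  obtain V E where V: "unitary_mat n V" and HV: "H = spec_mat n V (\<lambda>i. complex_of_real (E i))"
    using hermitian_spectral[OF H] by blast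
  note VD = unitary_matD[OF V]
  define Z where "Z = (\<Sum>j<n. exp (- \<beta> * E j))"
  define p where "p i = exp (- \<beta> * E i) / Z" for i
  have Z: "Z > 0" unfolding Z_def using n by (intro sum_pos) auto
  have g: "gibbs \<beta> H = spec_mat n V (\<lambda>i. complex_of_real (p i))"
    unfolding HV gibbs_spec[OF V] p_def Z_def ..
  have "(\<Sum>i<n. p i) = 1" using Z by (simp add: p_def Z_def flip: sum_divide_distrib)
  then have "mat_tr (gibbs \<beta> H) = 1" unfolding g spec_mat_tr[OF V] by (simp flip: of_real_sum)
  moreover have "hermitian_mat n (gibbs \<beta> H)" unfolding g by (rule spec_mat_hermitian[OF VD(1)])
  moreover have "diag_of n (\<lambda>i. complex_of_real (sqrt (p i))) * mat_adjoint V \<in> carrier_mat n n"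
    using VD(1) by auto
  moreover have "Re (mat_tr (gibbs \<beta> H * X)) = quad_form (diag_of n (\<lambda>i. complex_of_real (sqrt (p i))) * mat_adjoint V) X"
    if "X \<in> carrier_mat n n" for X
    unfolding g using Z by (intro spec_mat_tr_quad_form[OF VD(1) that]) (simp add: p_def)
  ultimately show thesis using that by blast
qed

section \<open>Commuting projections\<close>

definition projection_mat :: "nat \<Rightarrow> complex mat \<Rightarrow> bool" where
  "projection_mat n P \<longleftrightarrow> hermitian_mat n P \<and> P * P = P"

lemma projection_matD:
  assumes "projection_mat n P"
  shows "P \<in> carrier_mat n n" "mat_adjoint P = P" "P * P = P" "hermitian_mat n P"
  using assms by (auto simp: projection_mat_def hermitian_mat_def)

lemma mat_adjoint_minus:
  assumes "(A :: complex mat) \<in> carrier_mat n m" "B \<in> carrier_mat n m"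
  shows "mat_adjoint (A - B) = mat_adjoint A - mat_adjoint B"
  by (rule eq_matI) (use assms in auto)

lemma one_minus_carrier [simp]: "P \<in> carrier_mat n n \<Longrightarrow> 1\<^sub>m n - P \<in> carrier_mat n n"
  by (rule minus_carrier_mat)

lemma projection_mat_compl:
  assumes "projection_mat n P"
  shows "projection_mat n (1\<^sub>m n - P)"
proof -
  note P = projection_matD[OF assms]
  have "(1\<^sub>m n - P) * (1\<^sub>m n - P) = (1\<^sub>m n - P) - (P - P)"
    using P by (simp add: minus_mult_distrib_mat[of _ n n _ _ n] mult_minus_distrib_mat[of _ n n _ n])
  also have "\<dots> = 1\<^sub>m n - P" using P(1) by (intro eq_matI) auto
  finally show ?thesis
    using P by (simp add: projection_mat_def hermitian_mat_def mat_adjoint_minus[of _ n n])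
qed

section \<open>Quadratic forms conditioned on a projection\<close>

lemma quad_form_add:
  assumes "M \<in> carrier_mat n n" "X \<in> carrier_mat n n" "Y \<in> carrier_mat n n"
  shows "quad_form M (X + Y) = quad_form M X + quad_form M Y"
  using assms by (simp add: quad_form_def mult_add_distrib_mat[of _ n n _ n] add_mult_distrib_mat[of _ n n _ _ n]
      mat_tr_add[of _ n] mult_carrier_mat[of _ n n _ n])

lemma quad_form_minus:
  assumes "M \<in> carrier_mat n n" "X \<in> carrier_mat n n" "Y \<in> carrier_mat n n"
  shows "quad_form M (X - Y) = quad_form M X - quad_form M Y"
  using assms by (simp add: quad_form_def mult_minus_distrib_mat[of _ n n _ n] minus_mult_distrib_mat[of _ n n _ _ n]
      mat_tr_minus[of _ n] mult_carrier_mat[of _ n n _ n])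

lemma quad_form_smult:
  assumes "M \<in> carrier_mat n n" "X \<in> carrier_mat n n"
  shows "quad_form M (complex_of_real c \<cdot>\<^sub>m X) = c * quad_form M X"
  using assms by (simp add: quad_form_def mult_smult_distrib[of _ n n _ n] mult_smult_assoc_mat[of _ n n _ n]
      mat_tr_smult[of _ n] mult_carrier_mat[of _ n n _ n])

lemma quad_form_one_nonneg:
  assumes "M \<in> carrier_mat n n"
  shows "0 \<le> quad_form M (1\<^sub>m n)"
proof -
  have "mat_tr (M * mat_adjoint M) = (\<Sum>i<n. \<Sum>l<n. M $$ (i, l) * cnj (M $$ (i, l)))"
    using assms by (auto simp: mat_tr_def mult_mat_index[of M n n _ n] simp del: index_mult_mat(1) intro!: sum.cong)
  also have "\<dots> = complex_of_real (\<Sum>i<n. \<Sum>l<n. (cmod (M $$ (i, l)))\<^sup>2)"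
    by (simp only: complex_norm_square of_real_sum)
  finally show ?thesis using assms by (simp add: quad_form_def sum_nonneg)
qed

text \<open>A projection commuting with \<open>X\<close> can be absorbed on one side: P X P = X
  P.\<close>

lemma quad_form_mult_projection:
  assumes M: "M \<in> carrier_mat n n" and X: "X \<in> carrier_mat n n" and P: "projection_mat n P" and comm: "P * X = X * P"
  shows "quad_form (M * P) X = quad_form M (X * P)"
proof -
  note PD = projection_matD[OF P]
  have "M * P * X * mat_adjoint (M * P) = M * ((P * X) * P) * mat_adjoint M"
    using M X PD(1,2) by (simp add: mat_adjoint_mult[of _ n n _ n] assoc_mult_mat[of _ n n _ n _ n] mult_carrier_mat[of _ n n _ n])
  also have "(P * X) * P = X * P"
    unfolding comm using X PD(1,3) by (simp add: assoc_mult_mat[of _ n n _ n _ n])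
  finally show ?thesis by (simp add: quad_form_def)
qed

text \<open>The law of total probability: measuring \<open>P\<close> does not disturb an observable
  that commutes with it, so conditioning on the two outcomes and adding up recovers the
  unconditioned value.\<close>

lemma quad_form_split:
  assumes M: "M \<in> carrier_mat n n" and X: "X \<in> carrier_mat n n" and P: "projection_mat n P" and comm: "P * X = X * P"
  shows "quad_form M X = quad_form (M * (1\<^sub>m n - P)) X + quad_form (M * P) X"
proof -
  note PD = projection_matD[OF P]
  have c: "(1\<^sub>m n - P) * X = X * (1\<^sub>m n - P)"
    using X PD comm by (simp add: minus_mult_distrib_mat[of _ n n _ _ n] mult_minus_distrib_mat[of _ n n _ n])
  have "X * (1\<^sub>m n - P) = X - X * P" using X PD by (simp add: mult_minus_distrib_mat[of _ n n _ n])
  then show ?thesis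
    using M X PD
    by (simp add: quad_form_mult_projection[OF M X projection_mat_compl[OF P] c]
        quad_form_mult_projection[OF M X P comm] quad_form_minus[OF M] mult_carrier_mat[of _ n n _ n])
qed

lemma projection_quad_form_bounds:
  assumes M: "M \<in> carrier_mat n n" and P: "projection_mat n P"
  shows "0 \<le> quad_form M P" "quad_form M P \<le> quad_form M (1\<^sub>m n)"
proof -
  note PD = projection_matD[OF P]
  have e: "quad_form (M * P) (1\<^sub>m n) = quad_form M P"
    using quad_form_mult_projection[OF M one_carrier_mat P] PD by simp
  show "0 \<le> quad_form M P"
    unfolding e[symmetric] using M PD by (intro quad_form_one_nonneg) auto
  have "0 \<le> quad_form (M * (1\<^sub>m n - P)) (1\<^sub>m n)"
    using M PD by (intro quad_form_one_nonneg) auto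
  then show "quad_form M P \<le> quad_form M (1\<^sub>m n)"
    using quad_form_split[OF M one_carrier_mat P] PD e by simp
qed

text \<open>For a projection this equals the exponential of ln (1 + s) P, the moment generating
  factor of one binary outcome, written as a polynomial.\<close>

definition tilt :: "nat \<Rightarrow> real \<Rightarrow> complex mat \<Rightarrow> complex mat" where
  "tilt n s P = 1\<^sub>m n + complex_of_real s \<cdot>\<^sub>m P"

primrec tilt_prod :: "nat \<Rightarrow> real \<Rightarrow> (nat \<Rightarrow> complex mat) \<Rightarrow> nat \<Rightarrow> complex mat" where
  "tilt_prod n s P 0 = 1\<^sub>m n"
| "tilt_prod n s P (Suc k) = tilt_prod n s P k * tilt n s (P k)"

section \<open>Tilted products of commuting projections and Chernoff's bound\<close>

locale commuting_projections =
  fixes n :: nat and P :: "nat \<Rightarrow> complex mat" and m :: nat and s :: real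
  assumes proj: "i < m \<Longrightarrow> projection_mat n (P i)"
    and comm: "i < m \<Longrightarrow> j < m \<Longrightarrow> i \<noteq> j \<Longrightarrow> P i * P j = P j * P i"
    and s_pos: "s > 0"
begin

abbreviation "B \<equiv> tilt_prod n s P"

lemma P_carrier [simp]: "i < m \<Longrightarrow> P i \<in> carrier_mat n n"
  using projection_matD proj by blast

lemma tilt_carrier [simp]: "i < m \<Longrightarrow> tilt n s (P i) \<in> carrier_mat n n"
  by (simp add: tilt_def)

lemma B_carrier [simp]: "k \<le> m \<Longrightarrow> B k \<in> carrier_mat n n"
  by (induction k) (auto intro!: mult_carrier_mat[of _ n n _ n])

lemmas mult_one [simp] = left_mult_one_mat[of _ n n] right_mult_one_mat[of _ n n]

lemma commutes_B: "k \<le> j \<Longrightarrow> j < m \<Longrightarrow> P j * B k = B k * P j"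
proof (induction k)
  case 0
  then show ?case by simp
next
  case (Suc k)
  then have k: "k < m" "k \<noteq> j" and IH: "P j * B k = B k * P j" by auto
  have t: "P j * tilt n s (P k) = tilt n s (P k) * P j"
    using k Suc.prems comm[of j k]
    by (simp add: tilt_def mult_add_distrib_mat[of _ n n _ n] add_mult_distrib_mat[of _ n n _ _ n]
        mult_smult_distrib[of _ n n _ n] mult_smult_assoc_mat[of _ n n _ n])
  have "P j * (B k * tilt n s (P k)) = (P j * B k) * tilt n s (P k)"
    using k Suc.prems by (simp add: assoc_mult_mat[of _ n n _ n _ n])
  also have "\<dots> = B k * (P j * tilt n s (P k))"
    unfolding IH using k Suc.prems by (simp add: assoc_mult_mat[of _ n n _ n _ n])
  also have "\<dots> = (B k * tilt n s (P k)) * P j"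
    unfolding t using k Suc.prems by (simp add: assoc_mult_mat[of _ n n _ n _ n])
  finally show ?case by simp
qed

lemma B_Suc: "k < m \<Longrightarrow> B (Suc k) = B k + complex_of_real s \<cdot>\<^sub>m (B k * P k)"
  by (simp add: tilt_def mult_add_distrib_mat[of _ n n _ n] mult_smult_distrib[of _ n n _ n])

text \<open>Conditioning on the last outcome: outcome 0 has weight 1 and outcome 1 has weight 1 + s.
  This recursion takes the place of a joint diagonalization in the inductions below.\<close>

lemma quad_form_B_Suc:
  assumes M: "M \<in> carrier_mat n n" and k: "k < m"
  shows "quad_form M (B (Suc k)) = quad_form (M * (1\<^sub>m n - P k)) (B k) + (1 + s) * quad_form (M * P k) (B k)"
proof -
  have c: "P k * B k = B k * P k" using k by (intro commutes_B) auto
  have Bk: "B k \<in> carrier_mat n n" using k by simp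
  show ?thesis
    using M k Bk
    by (simp add: B_Suc quad_form_add[of _ n] quad_form_smult[of _ n] mult_carrier_mat[of _ n n _ n] 
       quad_form_split[OF M Bk proj[OF k] c] quad_form_mult_projection[OF M Bk proj[OF k] c] algebra_simps del: tilt_prod.simps)
qed

text \<open>The induction needs all \<open>M\<close> at once, as the recursion changes
  \<open>M\<close> into its two conditioned versions.\<close>

lemma quad_form_B_nonneg:
  "M \<in> carrier_mat n n \<Longrightarrow> k \<le> m \<Longrightarrow> 0 \<le> quad_form M (B k)"
proof (induction k arbitrary: M)
  case 0
  then show ?case by (simp add: quad_form_one_nonneg)
next
  case (Suc k)
  then have k: "k < m" by simp
  show ?case unfolding quad_form_B_Suc[OF Suc.prems(1) k]
    using Suc.prems s_pos k by (intro add_nonneg_nonneg mult_nonneg_nonneg Suc.IH) (auto intro!: mult_carrier_mat[of _ n n _ n])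
qed

text \<open>The operator inequality \<open>exp X \<ge> exp a (1 + X - a)\<close> for \<open>X = ln (1 + s) (\<Sum>i<k. P i)\<close>,
  for which \<open>exp X\<close> is the product of the tilts; it plays the role of Jensen's inequality.\<close>
lemma quad_form_B_ge:
  "M \<in> carrier_mat n n \<Longrightarrow> k \<le> m \<Longrightarrow>
     exp a * ((1 - a) * quad_form M (1\<^sub>m n) + ln (1 + s) * (\<Sum>i<k. quad_form M (P i))) \<le> quad_form M (B k)"
proof (induction k arbitrary: M a)
  case 0
  have "exp a * (1 - a) \<le> exp a * exp (- a)" using exp_ge_add_one_self[of "- a"] by (intro mult_left_mono) auto
  then have "exp a * (1 - a) \<le> 1" by (simp add: exp_minus)
  then have "(exp a * (1 - a)) * quad_form M (1\<^sub>m n) \<le> 1 * quad_form M (1\<^sub>m n)"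
    using quad_form_one_nonneg[OF 0(1)] by (intro mult_right_mono)
  then show ?case by (simp add: mult.assoc)
next
  case (Suc k)
  then have k: "k < m" and M: "M \<in> carrier_mat n n" by auto
  define t where "t = ln (1 + s)"
  have et: "exp t = 1 + s" using s_pos by (simp add: t_def)
  let ?M1 = "M * (1\<^sub>m n - P k)" and ?M2 = "M * P k"
  have c: "?M1 \<in> carrier_mat n n" "?M2 \<in> carrier_mat n n"
    using M k by (auto intro!: mult_carrier_mat[of _ n n _ n])
  define S1 S2 where "S1 = (\<Sum>i<k. quad_form ?M1 (P i))" and "S2 = (\<Sum>i<k. quad_form ?M2 (P i))"
  have "quad_form M (P i) = quad_form ?M1 (P i) + quad_form ?M2 (P i)" if "i < k" for i
    using that k comm[of k i] by (intro quad_form_split[OF M _ proj[OF k]]) auto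
  then have S: "(\<Sum>i<k. quad_form M (P i)) = S1 + S2"
    by (simp add: S1_def S2_def sum.distrib)
  have one: "quad_form M (1\<^sub>m n) = quad_form ?M1 (1\<^sub>m n) + quad_form ?M2 (1\<^sub>m n)"
    using k by (intro quad_form_split[OF M _ proj[OF k]]) auto
  have Pk: "quad_form M (P k) = quad_form ?M2 (1\<^sub>m n)"
    using quad_form_mult_projection[OF M one_carrier_mat proj[OF k]] k by simp
  have h1: "exp a * ((1 - a) * quad_form ?M1 (1\<^sub>m n) + t * S1) \<le> quad_form ?M1 (B k)"
    using Suc.IH[OF c(1), of a] k unfolding t_def S1_def by simp
  \<comment> \<open>On outcome 1 the exponent X gains t, so the tangent point is moved to
    \<open>a - t\<close>; the factor 1 + s = \<open>exp t\<close> then restores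
    \<open>exp a\<close>. This is why the induction is over arbitrary \<open>a\<close>.\<close>
  have "exp (a - t) * ((1 - (a - t)) * quad_form ?M2 (1\<^sub>m n) + t * S2) \<le> quad_form ?M2 (B k)"
    using Suc.IH[OF c(2), of "a - t"] k unfolding t_def S2_def by simp
  then have "exp t * (exp (a - t) * ((1 - (a - t)) * quad_form ?M2 (1\<^sub>m n) + t * S2)) \<le> exp t * quad_form ?M2 (B k)"
    by (intro mult_left_mono) auto
  moreover have "exp t * exp (a - t) = exp a" by (simp flip: exp_add)
  ultimately have h2: "exp a * ((1 - (a - t)) * quad_form ?M2 (1\<^sub>m n) + t * S2) \<le> (1 + s) * quad_form ?M2 (B k)"
    by (simp add: et flip: mult.assoc)
  have "exp a * ((1 - a) * quad_form M (1\<^sub>m n) + t * (\<Sum>i<Suc k. quad_form M (P i)))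
     = exp a * ((1 - a) * quad_form ?M1 (1\<^sub>m n) + t * S1) + exp a * ((1 - (a - t)) * quad_form ?M2 (1\<^sub>m n) + t * S2)"
    by (simp add: S one Pk algebra_simps)
  then show ?case using h1 h2 unfolding quad_form_B_Suc[OF M k] t_def by linarith
qed

text \<open>Chernoff's argument for the joint statistics of the projections: \<open>K\<^sup>\<dagger> K\<close> is the
  weakly correlated state and \<open>K'\<^sup>\<dagger> K'\<close> the dominated one.\<close>
lemma dominated_expectation_bound:
  assumes K: "K \<in> carrier_mat n n" "quad_form K (1\<^sub>m n) = 1"
    and K': "K' \<in> carrier_mat n n" "quad_form K' (1\<^sub>m n) = 1"
    and dom: "quad_form K' (B m) \<le> exp \<Lambda> * quad_form K (B m)"
    and corr: "\<And>k. 1 \<le> k \<Longrightarrow> k < m \<Longrightarrow>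
      quad_form K (B k * tilt n s (P k)) \<le> quad_form K (B k) * quad_form K (tilt n s (P k)) + (1 + s) ^ Suc k * \<epsilon>"
    and \<epsilon>: "\<epsilon> \<ge> 0" "real m * (1 + s) ^ m * \<epsilon> \<le> 1"
  shows "ln (1 + s) * (\<Sum>i<m. quad_form K' (P i)) \<le> \<Lambda> + ln 2 + s * (\<Sum>i<m. quad_form K (P i))"
proof -
  define p where "p i = quad_form K (P i)" for i
  have p: "0 \<le> p i" "p i \<le> 1" if "i < m" for i
    using projection_quad_form_bounds[OF K(1) proj[OF that]] K by (auto simp: p_def)
  have tl: "quad_form K (tilt n s (P i)) = 1 + s * p i" if "i < m" for i
    using that K by (simp add: tilt_def quad_form_add[of _ n] quad_form_smult[of _ n] p_def)
  \<comment> \<open>Each new factor multiplies the accumulated error by at most 1 + s and adds at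
    most \<open>(1 + s) ^ Suc k * \<epsilon>\<close>, which after k factors amounts to k equal
    terms.\<close>
  have "quad_form K (B k) \<le> (\<Prod>i<k. 1 + s * p i) + real k * (1 + s) ^ k * \<epsilon>" if "k \<le> m" for k
    using that
  proof (induction k)
    case 0
    then show ?case using K by simp
  next
    case (Suc k)
    then have k: "k < m" by simp
    have f: "1 + s * p k \<le> 1 + s" "0 \<le> 1 + s * p k" using p[OF k] s_pos by (auto simp: mult_left_le)
    have "quad_form K (B (Suc k)) \<le> quad_form K (B k) * (1 + s * p k) + (1 + s) ^ Suc k * \<epsilon>"
    proof (cases "k = 0")
      \<comment> \<open>\<open>B 0\<close> is the identity, so the first factor is exact; the
        correlation bound is assumed only from k = 1 on, since it will come from regions that have
        to be nonempty.\<close>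
      case True
      have "0 \<le> (1 + s) * \<epsilon>" using s_pos \<epsilon> by simp
      moreover have "quad_form K (B (Suc k)) = 1 + s * p k"
        using k tl[of 0] True by simp
      ultimately show ?thesis using True K by simp
    next
      case False
      then show ?thesis using corr[of k] k tl[OF k] by simp
    qed
    also have "quad_form K (B k) * (1 + s * p k) \<le> ((\<Prod>i<k. 1 + s * p i) + real k * (1 + s) ^ k * \<epsilon>) * (1 + s * p k)"
      using Suc f by (intro mult_right_mono) auto
    also have "\<dots> \<le> (\<Prod>i<Suc k. 1 + s * p i) + real k * (1 + s) ^ k * \<epsilon> * (1 + s)"
      using f s_pos \<epsilon> by (simp add: distrib_right mult_left_mono)
    finally show ?case by (simp add: algebra_simps)
  qed
  from this[of m] have "quad_form K (B m) \<le> (\<Prod>i<m. 1 + s * p i) + 1" using \<epsilon> by linarith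
  also have "(\<Prod>i<m. 1 + s * p i) \<le> (\<Prod>i<m. exp (s * p i))"
    using p s_pos by (intro prod_mono) (auto intro: exp_ge_add_one_self)
  also have "\<dots> = exp (s * (\<Sum>i<m. p i))" by (simp add: exp_sum sum_distrib_left)
  \<comment> \<open>The total error 1 is below the main exponential, as its exponent is nonnegative;
    the resulting factor 2 becomes ln 2 in the exponent.\<close>
  also have "exp (s * (\<Sum>i<m. p i)) + 1 \<le> 2 * exp (s * (\<Sum>i<m. p i))"
  proof -
    have "0 \<le> (\<Sum>i<m. p i)" using p by (intro sum_nonneg) auto
    then have "0 \<le> s * (\<Sum>i<m. p i)" using s_pos by simp
    then show ?thesis by simp
  qed
  finally have gB: "quad_form K (B m) \<le> 2 * exp (s * (\<Sum>i<m. p i))" by simp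
  \<comment> \<open>The logarithm of the upper bound for the tilted expectation in the dominated
    state, so that \<open>exp a\<close> cancels from the comparison with the lower bound.\<close>
  define a where "a = \<Lambda> + ln 2 + s * (\<Sum>i<m. p i)"
  have "exp a * ((1 - a) * quad_form K' (1\<^sub>m n) + ln (1 + s) * (\<Sum>i<m. quad_form K' (P i))) \<le> exp \<Lambda> * quad_form K (B m)"
    using quad_form_B_ge[OF K'(1), of m a] dom by linarith
  also have "\<dots> \<le> exp \<Lambda> * (2 * exp (s * (\<Sum>i<m. p i)))" using gB by (intro mult_left_mono) auto
  also have "\<dots> = exp a * 1" by (simp add: a_def exp_add)
  finally have "(1 - a) * quad_form K' (1\<^sub>m n) + ln (1 + s) * (\<Sum>i<m. quad_form K' (P i)) \<le> 1"
    by (rule mult_left_le_imp_le) simp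
  then show ?thesis using K' by (simp add: a_def p_def)
qed

end

section \<open>Operator norm\<close>

lemma vec_l2_nonneg [simp]: "0 \<le> vec_l2 v"
  by (simp add: vec_l2_eq sum_nonneg)

lemma op_norm_le:
  assumes "A \<in> carrier_mat n n" "c \<ge> 0" "\<And>v. v \<in> carrier_vec n \<Longrightarrow> vec_l2 (A *\<^sub>v v) \<le> c * vec_l2 v"
  shows "op_norm A \<le> c"
  unfolding op_norm_def
proof (rule cSUP_least)
  have "vec_l2 (0\<^sub>v n) = 0" by (simp add: vec_l2_eq)
  then have "0\<^sub>v n \<in> {v \<in> carrier_vec (dim_col A). vec_l2 v \<le> 1}" using assms(1) by auto
  then show "{v \<in> carrier_vec (dim_col A). vec_l2 v \<le> 1} \<noteq> {}" by blast
next
  fix v assume "v \<in> {v \<in> carrier_vec (dim_col A). vec_l2 v \<le> 1}"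
  then have v: "v \<in> carrier_vec n" "vec_l2 v \<le> 1" using assms(1) by auto
  have "vec_l2 (A *\<^sub>v v) \<le> c * vec_l2 v" by (rule assms(3)[OF v(1)])
  also have "\<dots> \<le> c * 1" using v assms(2) by (intro mult_left_mono) auto
  finally show "vec_l2 (A *\<^sub>v v) \<le> c" by simp
qed

text \<open>A supremum over an unbounded set of reals would be unspecified; the assumed bound makes
  the set bounded above, and then its member at the zero vector decides the sign.\<close>

lemma op_norm_nonneg:
  assumes "A \<in> carrier_mat n n" "c \<ge> 0" "\<And>v. v \<in> carrier_vec n \<Longrightarrow> vec_l2 (A *\<^sub>v v) \<le> c * vec_l2 v"
  shows "0 \<le> op_norm A"
proof -
  have "vec_l2 (A *\<^sub>v 0\<^sub>v n) \<le> op_norm A"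
    unfolding op_norm_def
  proof (rule cSUP_upper)
    have "vec_l2 (0\<^sub>v n) = 0" by (simp add: vec_l2_eq)
    then show "0\<^sub>v n \<in> {v \<in> carrier_vec (dim_col A). vec_l2 v \<le> 1}" using assms(1) by auto
    show "bdd_above ((\<lambda>v. vec_l2 (A *\<^sub>v v)) ` {v \<in> carrier_vec (dim_col A). vec_l2 v \<le> 1})"
    proof (rule bdd_aboveI2)
      fix v assume "v \<in> {v \<in> carrier_vec (dim_col A). vec_l2 v \<le> 1}"
      then have v: "v \<in> carrier_vec n" "vec_l2 v \<le> 1" using assms(1) by auto
      have "vec_l2 (A *\<^sub>v v) \<le> c * vec_l2 v" by (rule assms(3)[OF v(1)])
      also have "\<dots> \<le> c * 1" using v assms(2) by (intro mult_left_mono) auto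
      finally show "vec_l2 (A *\<^sub>v v) \<le> c" by simp
    qed
  qed
  then show ?thesis using vec_l2_nonneg order_trans by blast
qed

lemma cscalar_mult_mat_vec:
  assumes A: "A \<in> carrier_mat n n" and v: "v \<in> carrier_vec n" and w: "w \<in> carrier_vec n"
  shows "(\<Sum>i<n. (A *\<^sub>v v) $ i * cnj (w $ i)) = (\<Sum>i<n. v $ i * cnj ((mat_adjoint A *\<^sub>v w) $ i))"
proof -
  have "(\<Sum>i<n. (A *\<^sub>v v) $ i * cnj (w $ i)) = (\<Sum>i<n. \<Sum>l<n. A $$ (i, l) * v $ l * cnj (w $ i))"
    using A v by (intro sum.cong refl) (simp add: mult_mat_vec_index[of A n n] sum_distrib_right del: index_mult_mat_vec)
  also have "\<dots> = (\<Sum>l<n. \<Sum>i<n. v $ l * cnj (mat_adjoint A $$ (l, i) * w $ i))"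
    using A by (subst sum.swap) (auto intro!: sum.cong)
  also have "\<dots> = (\<Sum>l<n. v $ l * cnj ((mat_adjoint A *\<^sub>v w) $ l))"
    using A w by (intro sum.cong refl) (simp add: mult_mat_vec_index[of "mat_adjoint A" n n] sum_distrib_left del: index_mult_mat_vec)
  finally show ?thesis .
qed

lemma cmod_sq: "(cmod (complex_of_real x * u + w))\<^sup>2 = x\<^sup>2 * (cmod u)\<^sup>2 + (cmod w)\<^sup>2 + 2 * x * Re (u * cnj w)"
  unfolding cmod_power2 by (simp add: power2_eq_square algebra_simps)

lemma sum_cmod_sq:
  "(\<Sum>i<n. (cmod (complex_of_real x * a i + b i))\<^sup>2)
      = x\<^sup>2 * (\<Sum>i<n. (cmod (a i))\<^sup>2) + (\<Sum>i<n. (cmod (b i))\<^sup>2) + 2 * x * Re (\<Sum>i<n::nat. a i * cnj (b i))"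
proof (induction n)
  case 0
  show ?case by simp
next
  case (Suc n)
  show ?case
    unfolding sum.lessThan_Suc Suc.IH
    unfolding cmod_sq plus_complex.sel distrib_left by linarith
qed

text \<open>Orthogonal decomposition of \<open>v\<close> into \<open>P v\<close> and \<open>v - P v\<close>.\<close>
lemma tilt_vec_l2_le:
  assumes P: "projection_mat n P" and v: "v \<in> carrier_vec n" and s: "s \<ge> 0"
  shows "vec_l2 (tilt n s P *\<^sub>v v) \<le> (1 + s) * vec_l2 v"
proof -
  note PD = projection_matD[OF P]
  define a where "a = P *\<^sub>v v"
  define b where "b = v - a"
  have ac: "a \<in> carrier_vec n" using PD v by (simp add: a_def)
  have bc: "b \<in> carrier_vec n" using ac v by (simp add: b_def)
  have Pa: "P *\<^sub>v a = a" unfolding a_def using PD v by (simp flip: assoc_mult_mat_vec[of _ n n _ n])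
  have Pb: "P *\<^sub>v b = 0\<^sub>v n"
    unfolding b_def using PD v ac Pa by (simp add: mult_minus_distrib_mat_vec[of _ n n] a_def)
  have orth: "(\<Sum>i<n. a $ i * cnj (b $ i)) = 0"
    using cscalar_mult_mat_vec[OF PD(1) ac bc] by (simp add: PD(2) Pa Pb)
  have py: "(\<Sum>i<n. (cmod (complex_of_real x * a $ i + b $ i))\<^sup>2) = x\<^sup>2 * (\<Sum>i<n. (cmod (a $ i))\<^sup>2) + (\<Sum>i<n. (cmod (b $ i))\<^sup>2)" for x
    unfolding sum_cmod_sq orth by simp
  have v': "v $ i = complex_of_real 1 * a $ i + b $ i" if "i < n" for i
    using that v ac by (simp add: b_def)
  have Fv: "(tilt n s P *\<^sub>v v) $ i = complex_of_real (1 + s) * a $ i + b $ i" if "i < n" for i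
  proof -
    have "tilt n s P *\<^sub>v v = v + complex_of_real s \<cdot>\<^sub>v a"
    proof (rule eq_vecI)
      fix j assume "j < dim_vec (v + complex_of_real s \<cdot>\<^sub>v a)"
      then have j: "j < n" using ac by simp
      have "(tilt n s P *\<^sub>v v) $ j = (\<Sum>l<n. 1\<^sub>m n $$ (j, l) * v $ l + complex_of_real s * (P $$ (j, l) * v $ l))"
        unfolding tilt_def using PD(1) v j
        by (subst mult_mat_vec_index[of _ n n]) (auto simp: distrib_right mult.assoc simp del: index_mult_mat_vec intro!: sum.cong)
      also have "\<dots> = (1\<^sub>m n *\<^sub>v v) $ j + complex_of_real s * (P *\<^sub>v v) $ j"
        unfolding sum.distrib sum_distrib_left[symmetric]
        using PD(1) v j by (simp only: mult_mat_vec_index[of _ n n] one_carrier_mat)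
      finally show "(tilt n s P *\<^sub>v v) $ j = (v + complex_of_real s \<cdot>\<^sub>v a) $ j"
        unfolding a_def[symmetric] using carrier_vecD[OF v] carrier_vecD[OF ac] j by (simp add: one_mult_mat_vec[OF v] del: index_mult_mat_vec)
    qed (use ac PD(1) in \<open>simp add: tilt_def\<close>)
    then have "(tilt n s P *\<^sub>v v) $ i = v $ i + complex_of_real s * a $ i"
      using that v ac by (simp del: index_mult_mat_vec)
    also have "\<dots> = complex_of_real (1 + s) * a $ i + b $ i"
      unfolding v'[OF that] by (simp add: distrib_right)
    finally show ?thesis .
  qed
  have d: "dim_vec (tilt n s P *\<^sub>v v) = n" "dim_vec v = n" using v PD by (auto simp: tilt_def)
  have "(vec_l2 (tilt n s P *\<^sub>v v))\<^sup>2 = (1 + s)\<^sup>2 * (\<Sum>i<n. (cmod (a $ i))\<^sup>2) + (\<Sum>i<n. (cmod (b $ i))\<^sup>2)"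
    unfolding vec_l2_square d py[symmetric] by (intro sum.cong refl) (simp only: Fv lessThan_iff)
  \<comment> \<open>Only the component in the range of \<open>P\<close> is stretched; the other one
    is bounded as if it were stretched too, which makes the whole a multiple of the squared
    norm.\<close>
  also have "\<dots> \<le> (1 + s)\<^sup>2 * (\<Sum>i<n. (cmod (a $ i))\<^sup>2) + (1 + s)\<^sup>2 * (\<Sum>i<n. (cmod (b $ i))\<^sup>2)"
  proof -
    have "1 \<le> (1 + s)\<^sup>2" using s by (simp add: one_le_power)
    moreover have "0 \<le> (\<Sum>i<n. (cmod (b $ i))\<^sup>2)" by (simp add: sum_nonneg)
    ultimately have "1 * (\<Sum>i<n. (cmod (b $ i))\<^sup>2) \<le> (1 + s)\<^sup>2 * (\<Sum>i<n. (cmod (b $ i))\<^sup>2)"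
      by (rule mult_right_mono)
    then show ?thesis by simp
  qed
  also have "\<dots> = (1 + s)\<^sup>2 * ((\<Sum>i<n. (cmod (a $ i))\<^sup>2) + (\<Sum>i<n. (cmod (b $ i))\<^sup>2))"
    by (simp only: distrib_left)
  also have "(\<Sum>i<n. (cmod (a $ i))\<^sup>2) + (\<Sum>i<n. (cmod (b $ i))\<^sup>2) = (vec_l2 v)\<^sup>2"
  proof -
    have "(vec_l2 v)\<^sup>2 = (\<Sum>i<n. (cmod (complex_of_real 1 * a $ i + b $ i))\<^sup>2)"
      unfolding vec_l2_square d by (intro sum.cong refl) (simp only: v' lessThan_iff)
    then show ?thesis unfolding py by simp
  qed
  also have "(1 + s)\<^sup>2 * (vec_l2 v)\<^sup>2 = ((1 + s) * vec_l2 v)\<^sup>2" by (simp add: power_mult_distrib)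
  finally show ?thesis by (rule power2_le_imp_le) (use s in simp)
qed

lemma (in commuting_projections) tilt_prod_vec_l2_le:
  "k \<le> m \<Longrightarrow> v \<in> carrier_vec n \<Longrightarrow> vec_l2 (B k *\<^sub>v v) \<le> (1 + s) ^ k * vec_l2 v"
proof (induction k arbitrary: v)
  case 0
  then show ?case by simp
next
  case (Suc k)
  then have k: "k < m" by simp
  have w: "tilt n s (P k) *\<^sub>v v \<in> carrier_vec n" using k Suc by (auto intro!: mult_mat_vec_carrier)
  have "vec_l2 (B (Suc k) *\<^sub>v v) = vec_l2 (B k *\<^sub>v (tilt n s (P k) *\<^sub>v v))"
    using k Suc by (simp add: assoc_mult_mat_vec[of _ n n _ n])
  also have "\<dots> \<le> (1 + s) ^ k * vec_l2 (tilt n s (P k) *\<^sub>v v)"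
    using k w by (intro Suc.IH) auto
  also have "\<dots> \<le> (1 + s) ^ k * ((1 + s) * vec_l2 v)"
    using s_pos k Suc.prems by (intro mult_left_mono tilt_vec_l2_le proj) auto
  finally show ?case by (simp add: mult_ac)
qed

section \<open>Digit expansions\<close>

lemma digit_0 [simp]: "digit b x 0 = x mod b"
  by (simp add: digit_def)

lemma digit_Suc [simp]: "digit b x (Suc p) = digit b (x div b) p"
  by (simp add: digit_def div_mult2_eq)

lemma digit_less [simp]: "b > 0 \<Longrightarrow> digit b x p < b"
  by (simp add: digit_def)

primrec from_digits :: "nat \<Rightarrow> nat \<Rightarrow> (nat \<Rightarrow> nat) \<Rightarrow> nat" where
  "from_digits b 0 f = 0"
| "from_digits b (Suc n) f = f 0 + b * from_digits b n (\<lambda>p. f (Suc p))"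

lemma from_digits_less:
  "(\<And>p. p < n \<Longrightarrow> f p < b) \<Longrightarrow> from_digits b n f < b ^ n"
proof (induction n arbitrary: f)
  case (Suc n)
  have "f 0 < b" using Suc.prems by simp
  moreover have "from_digits b n (\<lambda>p. f (Suc p)) + 1 \<le> b ^ n" using Suc.IH[of "\<lambda>p. f (Suc p)"] Suc.prems by simp
  then have "b * (from_digits b n (\<lambda>p. f (Suc p)) + 1) \<le> b * b ^ n" by (rule mult_le_mono2)
  ultimately show ?case by simp
qed simp

lemma digit_from_digits:
  "(\<And>p. p < n \<Longrightarrow> f p < b) \<Longrightarrow> p < n \<Longrightarrow> digit b (from_digits b n f) p = f p"
proof (induction n arbitrary: f p)
  case (Suc n)
  have f0: "f 0 < b" using Suc.prems by simp
  then have b0: "b \<noteq> 0" by simp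
  show ?case
  proof (cases p)
    case 0
    then show ?thesis using f0 by simp
  next
    case (Suc p')
    then show ?thesis using f0 b0 Suc.prems Suc.IH[of "\<lambda>p. f (Suc p)" p'] by simp
  qed
qed simp

text \<open>Extensionality for indices: a basis state is determined by its values at the sites.
  Index identities about tensor products are reduced to this.\<close>

lemma digits_unique:
  "x < b ^ n \<Longrightarrow> y < b ^ n \<Longrightarrow> (\<And>p. p < n \<Longrightarrow> digit b x p = digit b y p) \<Longrightarrow> x = y"
proof (induction n arbitrary: x y)
  case (Suc n)
  have "x div b < b ^ n" "y div b < b ^ n" using Suc.prems(1,2) by (auto simp: less_mult_imp_div_less mult.commute)
  moreover have "digit b (x div b) p = digit b (y div b) p" if "p < n" for p
    using Suc.prems(3)[of "Suc p"] that by simp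
  ultimately have "x div b = y div b" by (rule Suc.IH)
  moreover have "x mod b = y mod b" using Suc.prems(3)[of 0] by simp
  ultimately show ?case by (metis mult_div_mod_eq)
qed simp

text \<open>The basis state that equals \<open>k\<close> on \<open>X\<close> and \<open>i\<close>
  elsewhere; it supplies the intermediate indices in products of local operators.\<close>

definition glue :: "nat \<Rightarrow> nat \<Rightarrow> nat set \<Rightarrow> nat \<Rightarrow> nat \<Rightarrow> nat" where
  "glue d N X k i = from_digits d N (\<lambda>s. if s \<in> X then digit d k s else digit d i s)"

lemma glue_less: "d > 0 \<Longrightarrow> glue d N X k i < d ^ N"
  unfolding glue_def by (intro from_digits_less) auto

lemma digit_glue: "d > 0 \<Longrightarrow> s < N \<Longrightarrow> digit d (glue d N X k i) s = (if s \<in> X then digit d k s else digit d i s)"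
  unfolding glue_def by (subst digit_from_digits) auto

section \<open>Local operators\<close>

lemma supported_onD:
  assumes "supported_on d N X A"
  shows "A \<in> carrier_mat (d ^ N) (d ^ N)"
    "\<And>i j. i < d ^ N \<Longrightarrow> j < d ^ N \<Longrightarrow> \<not> agree_on d ({..<N} - X) i j \<Longrightarrow> A $$ (i, j) = 0"
    "\<And>i j i' j'. i < d ^ N \<Longrightarrow> j < d ^ N \<Longrightarrow> i' < d ^ N \<Longrightarrow> j' < d ^ N \<Longrightarrow>
        agree_on d ({..<N} - X) i j \<Longrightarrow> agree_on d ({..<N} - X) i' j' \<Longrightarrow>
        agree_on d X i i' \<Longrightarrow> agree_on d X j j' \<Longrightarrow> A $$ (i, j) = A $$ (i', j')"
  using assms unfolding supported_on_def by blast+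

text \<open>For two index pairs that match on \<open>Y\<close> and are each constant outside
  \<open>Y\<close>, agreement outside \<open>X\<close> holds for both or for neither. In the first
  case the smaller support applies, in the second both entries vanish.\<close>

lemma supported_on_mono:
  assumes A: "supported_on d N X A" and XY: "X \<subseteq> Y" "Y \<subseteq> {..<N}"
  shows "supported_on d N Y A"
  unfolding supported_on_def
proof (intro conjI allI impI)
  show "A \<in> carrier_mat (d ^ N) (d ^ N)" by (rule supported_onD(1)[OF A])
  fix i j assume ij: "i < d ^ N" "j < d ^ N"
  { assume "\<not> agree_on d ({..<N} - Y) i j"
    then have "\<not> agree_on d ({..<N} - X) i j" using XY by (auto simp: agree_on_def)
    then show "A $$ (i, j) = 0" using supported_onD(2)[OF A] ij by blast }
  fix i' j' assume ij': "i' < d ^ N" "j' < d ^ N"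
  assume *: "agree_on d ({..<N} - Y) i j \<and> agree_on d ({..<N} - Y) i' j' \<and> agree_on d Y i i' \<and> agree_on d Y j j'"
  have iff: "agree_on d ({..<N} - X) i j \<longleftrightarrow> agree_on d ({..<N} - X) i' j'"
    using * XY unfolding agree_on_def by (metis DiffD1 DiffD2 DiffI)
  show "A $$ (i, j) = A $$ (i', j')"
  proof (cases "agree_on d ({..<N} - X) i j")
    case True
    then show ?thesis using iff * XY by (intro supported_onD(3)[OF A] ij ij') (auto simp: agree_on_def)
  next
    case False
    then show ?thesis using iff supported_onD(2)[OF A] ij ij' by metis
  qed
qed

lemma supported_on_one: 
  assumes "d > 0" "X \<subseteq> {..<N}"
  shows "supported_on d N X (1\<^sub>m (d ^ N))"
  unfolding supported_on_def
proof (intro conjI allI impI)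
  fix i j assume ij: "i < d ^ N" "j < d ^ N"
  { assume "\<not> agree_on d ({..<N} - X) i j"
    then show "(1\<^sub>m (d ^ N) :: complex mat) $$ (i, j) = 0" using ij by (auto simp: agree_on_def) }
  fix i' j' assume ij': "i' < d ^ N" "j' < d ^ N"
  assume *: "agree_on d ({..<N} - X) i j \<and> agree_on d ({..<N} - X) i' j' \<and> agree_on d X i i' \<and> agree_on d X j j'"
  have "i = j \<longleftrightarrow> i' = j'"
  proof
    assume "i = j"
    then show "i' = j'" using * by - (rule digits_unique[OF ij']; metis agree_on_def DiffI lessThan_iff)
  next
    assume "i' = j'"
    then show "i = j" using * by - (rule digits_unique[OF ij]; metis agree_on_def DiffI lessThan_iff)
  qed
  then show "(1\<^sub>m (d ^ N) :: complex mat) $$ (i, j) = 1\<^sub>m (d ^ N) $$ (i', j')" using ij ij' by simp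
qed simp

lemma supported_on_tilt:
  assumes d: "d > 0" and X: "X \<subseteq> {..<N}" and A: "supported_on d N X A"
  shows "supported_on d N X (tilt (d ^ N) s A)"
proof -
  note Ac = supported_onD(1)[OF A] and o = supported_on_one[OF d X]
  have e: "tilt (d ^ N) s A $$ (i, j) = 1\<^sub>m (d ^ N) $$ (i, j) + complex_of_real s * A $$ (i, j)"
    if "i < d ^ N" "j < d ^ N" for i j
    using Ac that by (simp add: tilt_def)
  show ?thesis
    unfolding supported_on_def
  proof (intro conjI allI impI)
    show "tilt (d ^ N) s A \<in> carrier_mat (d ^ N) (d ^ N)" using Ac by (simp add: tilt_def)
    fix i j assume ij: "i < d ^ N" "j < d ^ N"
    { assume "\<not> agree_on d ({..<N} - X) i j"
      then show "tilt (d ^ N) s A $$ (i, j) = 0"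
        unfolding e[OF ij] using supported_onD(2)[OF A ij] supported_onD(2)[OF o ij] by simp }
    fix i' j' assume ij': "i' < d ^ N" "j' < d ^ N"
    assume *: "agree_on d ({..<N} - X) i j \<and> agree_on d ({..<N} - X) i' j' \<and> agree_on d X i i' \<and> agree_on d X j j'"
    show "tilt (d ^ N) s A $$ (i, j) = tilt (d ^ N) s A $$ (i', j')"
      unfolding e[OF ij] e[OF ij'] using supported_onD(3)[OF A ij ij'] supported_onD(3)[OF o ij ij'] * by simp
  qed
qed

text \<open>Only intermediate states equal to \<open>i\<close> outside \<open>X\<close> contribute.
  Replacing their values outside \<open>X\<close> by those of \<open>i'\<close> is a bijection of
  the summation ranges under which both factors keep their entries.\<close>

lemma supported_on_mult:
  assumes d: "d > 0" and X: "X \<subseteq> {..<N}" and A: "supported_on d N X A" and B: "supported_on d N X B"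
  shows "supported_on d N X (A * B)"
proof -
  note Ac = supported_onD(1)[OF A] and Bc = supported_onD(1)[OF B]
  let ?K = "\<lambda>i. {k. k < d ^ N \<and> agree_on d ({..<N} - X) i k}"
  have e: "(A * B) $$ (i, j) = (\<Sum>k\<in>?K i. A $$ (i, k) * B $$ (k, j))" if "i < d ^ N" "j < d ^ N" for i j
    unfolding mult_mat_index[OF Ac Bc that]
    using supported_onD(2)[OF A that(1)] by (intro sum.mono_neutral_right) auto
  show ?thesis
    unfolding supported_on_def
  proof (intro conjI allI impI)
    show "A * B \<in> carrier_mat (d ^ N) (d ^ N)" using Ac Bc by simp
    fix i j assume ij: "i < d ^ N" "j < d ^ N"
    { assume na: "\<not> agree_on d ({..<N} - X) i j"
      show "(A * B) $$ (i, j) = 0"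
        unfolding e[OF ij]
      proof (intro sum.neutral ballI)
        fix k assume k: "k \<in> ?K i"
        then have "\<not> agree_on d ({..<N} - X) k j" using na by (auto simp: agree_on_def)
        then show "A $$ (i, k) * B $$ (k, j) = 0" using supported_onD(2)[OF B] k ij by simp
      qed }
    fix i' j' assume ij': "i' < d ^ N" "j' < d ^ N"
    assume *: "agree_on d ({..<N} - X) i j \<and> agree_on d ({..<N} - X) i' j' \<and> agree_on d X i i' \<and> agree_on d X j j'"
    show "(A * B) $$ (i, j) = (A * B) $$ (i', j')"
      unfolding e[OF ij] e[OF ij']
    proof (rule sum.reindex_bij_witness[where j = "\<lambda>k. glue d N X k i'" and i = "\<lambda>k. glue d N X k i"])
      fix k assume k: "k \<in> ?K i"
      show "glue d N X k i' \<in> ?K i'" using d by (auto simp: glue_less agree_on_def digit_glue)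
      show "glue d N X (glue d N X k i') i = k"
        using k d by - (rule digits_unique[of _ d N]; auto simp: glue_less digit_glue agree_on_def)
      have "A $$ (i', glue d N X k i') = A $$ (i, k)"
        using k d X * by (intro supported_onD(3)[OF A]) (auto simp: ij ij' glue_less digit_glue agree_on_def)
      moreover have "B $$ (glue d N X k i', j') = B $$ (k, j)"
        using k d X * by (intro supported_onD(3)[OF B]) (auto simp: ij ij' glue_less digit_glue agree_on_def)
      ultimately show "A $$ (i', glue d N X k i') * B $$ (glue d N X k i', j') = A $$ (i, k) * B $$ (k, j)" by simp
    next
      fix k assume k: "k \<in> ?K i'"
      show "glue d N X k i \<in> ?K i" using d by (auto simp: glue_less agree_on_def digit_glue)
      show "glue d N X (glue d N X k i) i' = k"
        using k d by - (rule digits_unique[of _ d N]; auto simp: glue_less digit_glue agree_on_def)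
    qed
  qed
qed

text \<open>A contributing intermediate state equals \<open>i\<close> outside \<open>X\<close> and
  \<open>j\<close> outside \<open>Y\<close>, hence on \<open>X\<close> by disjointness. Just one
  state does so and the sum collapses.\<close>

lemma disjoint_supported_mult_index:
  assumes d: "d > 0" and XY: "X \<inter> Y = {}"
    and A: "supported_on d N X A" and B: "supported_on d N Y B" and ij: "i < d ^ N" "j < d ^ N"
  shows "(A * B) $$ (i, j) = A $$ (i, glue d N X j i) * B $$ (glue d N X j i, j)"
proof -
  note Ac = supported_onD(1)[OF A] and Bc = supported_onD(1)[OF B]
  let ?k = "glue d N X j i"
  have "(A * B) $$ (i, j) = (\<Sum>k<d ^ N. if k = ?k then A $$ (i, ?k) * B $$ (?k, j) else 0)"
    unfolding mult_mat_index[OF Ac Bc ij]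
  proof (intro sum.cong refl)
    fix k assume k: "k \<in> {..<d ^ N}"
    have "A $$ (i, k) * B $$ (k, j) = 0" if "k \<noteq> ?k"
    proof (rule ccontr)
      assume "A $$ (i, k) * B $$ (k, j) \<noteq> 0"
      then have "A $$ (i, k) \<noteq> 0" "B $$ (k, j) \<noteq> 0" by auto
      then have "agree_on d ({..<N} - X) i k" "agree_on d ({..<N} - Y) k j"
        using supported_onD(2)[OF A] supported_onD(2)[OF B] k ij by (metis lessThan_iff)+
      then have "k = ?k"
        using k d XY by - (rule digits_unique[of _ d N]; auto simp: glue_less digit_glue agree_on_def)
      then show False using that by simp
    qed
    then show "A $$ (i, k) * B $$ (k, j) = (if k = ?k then A $$ (i, ?k) * B $$ (?k, j) else 0)" by simp
  qed
  also have "\<dots> = A $$ (i, ?k) * B $$ (?k, j)" using glue_less[OF d] by simp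
  finally show ?thesis .
qed

text \<open>In each order a single intermediate state survives, and the factors only see their own
  region, so the entries coincide. If \<open>i\<close> and \<open>j\<close> differ outside both
  regions, the disagreement persists in either intermediate state and both products vanish.\<close>

lemma disjoint_supported_commute:
  assumes d: "d > 0" and XY: "X \<inter> Y = {}" "X \<subseteq> {..<N}" "Y \<subseteq> {..<N}"
    and A: "supported_on d N X A" and B: "supported_on d N Y B"
  shows "A * B = B * A"
proof (rule eq_matI)
  note Ac = supported_onD(1)[OF A] and Bc = supported_onD(1)[OF B]
  fix i j assume "i < dim_row (B * A)" "j < dim_col (B * A)"
  then have ij: "i < d ^ N" "j < d ^ N" using Ac Bc by auto
  have YX: "Y \<inter> X = {}" using XY by auto
  have mem: "s \<in> X \<Longrightarrow> s < N \<and> s \<notin> Y" "s \<in> Y \<Longrightarrow> s < N \<and> s \<notin> X" for s using XY by auto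
  let ?k = "glue d N X j i" and ?l = "glue d N Y j i"
  have kl: "?k < d ^ N" "?l < d ^ N" using glue_less[OF d] by auto
  show "(A * B) $$ (i, j) = (B * A) $$ (i, j)"
    unfolding disjoint_supported_mult_index[OF d XY(1) A B ij] disjoint_supported_mult_index[OF d YX B A ij]
  proof (cases "agree_on d ({..<N} - (X \<union> Y)) i j")
    case True
    have "A $$ (i, ?k) = A $$ (?l, j)"
      using True d by (intro supported_onD(3)[OF A] ij kl) (auto simp: agree_on_def digit_glue mem)
    moreover have "B $$ (?k, j) = B $$ (i, ?l)"
      using True d by (intro supported_onD(3)[OF B] ij kl) (auto simp: agree_on_def digit_glue mem)
    ultimately show "A $$ (i, ?k) * B $$ (?k, j) = B $$ (i, ?l) * A $$ (?l, j)" by simp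
  next
    case False
    then have "\<not> agree_on d ({..<N} - Y) ?k j" "\<not> agree_on d ({..<N} - X) ?l j"
      using d by (auto simp: agree_on_def digit_glue)
    then show "A $$ (i, ?k) * B $$ (?k, j) = B $$ (i, ?l) * A $$ (?l, j)"
      using supported_onD(2)[OF A kl(2) ij(2)] supported_onD(2)[OF B kl(1) ij(2)] by simp
  qed
qed (use supported_onD(1)[OF A] supported_onD(1)[OF B] in auto)

section \<open>Reduced states\<close>

text \<open>The index of the restriction of the basis state \<open>i\<close> to \<open>C\<close>, in
  the same numbering as in \<open>reduced_state\<close>.\<close>

definition local_index :: "nat \<Rightarrow> nat set \<Rightarrow> nat \<Rightarrow> nat" where
  "local_index d C i = from_digits d (card C) (\<lambda>m. digit d i (sorted_list_of_set C ! m))"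

text \<open>The matrix \<open>p\<close> on \<open>C\<close> tensored with the identity on the other
  sites.\<close>

definition embed_mat :: "nat \<Rightarrow> nat \<Rightarrow> nat set \<Rightarrow> complex mat \<Rightarrow> complex mat" where
  "embed_mat d N C p = mat (d ^ N) (d ^ N) (\<lambda>(i, j).
     if agree_on d ({..<N} - C) i j then p $$ (local_index d C i, local_index d C j) else 0)"

lemma local_index_less: "d > 0 \<Longrightarrow> local_index d C i < d ^ card C"
  unfolding local_index_def by (intro from_digits_less) auto

lemma local_index_eq_iff:
  assumes "d > 0" "x < d ^ card C"
  shows "local_index d C i = x \<longleftrightarrow> (\<forall>m<card C. digit d i (sorted_list_of_set C ! m) = digit d x m)"
proof
  assume "local_index d C i = x"
  then show "\<forall>m<card C. digit d i (sorted_list_of_set C ! m) = digit d x m"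
    using assms by (auto simp: local_index_def digit_from_digits)
next
  assume *: "\<forall>m<card C. digit d i (sorted_list_of_set C ! m) = digit d x m"
  show "local_index d C i = x"
  proof (rule digits_unique[OF local_index_less assms(2)])
    fix p assume "p < card C"
    then show "digit d (local_index d C i) p = digit d x p"
      using assms * unfolding local_index_def by (subst digit_from_digits) auto
  qed (use assms in auto)
qed

lemma local_index_cong:
  assumes "finite C" "agree_on d C i j"
  shows "local_index d C i = local_index d C j"
proof -
  have cong: "from_digits b n f = from_digits b n g" if "\<And>p. p < n \<Longrightarrow> f p = g p" for b n f g
    using that
  proof (induction n arbitrary: f g)
    case (Suc n)
    have "from_digits b n (\<lambda>p. f (Suc p)) = from_digits b n (\<lambda>p. g (Suc p))"
      using Suc.prems by (intro Suc.IH) auto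
    then show ?case using Suc.prems by simp
  qed simp
  have "digit d i (sorted_list_of_set C ! m) = digit d j (sorted_list_of_set C ! m)" if "m < card C" for m
    using assms that by (metis agree_on_def length_sorted_list_of_set nth_mem set_sorted_list_of_set)
  then show ?thesis unfolding local_index_def by (rule cong)
qed

lemma agree_on_local_index:
  assumes "d > 0" "finite C" "local_index d C i = local_index d C j"
  shows "agree_on d C i j"
  unfolding agree_on_def
proof
  fix s assume "s \<in> C"
  then obtain m where "m < card C" "s = sorted_list_of_set C ! m"
    using assms(2) by (metis in_set_conv_nth length_sorted_list_of_set set_sorted_list_of_set)
  moreover have "digit d (local_index d C i) m = digit d (local_index d C j) m" using assms by simp
  ultimately show "digit d i s = digit d j s"
    using assms(1) by (simp add: local_index_def digit_from_digits)
qed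

text \<open>With the configuration outside \<open>C\<close> frozen, global states correspond to
  states of \<open>C\<close>; this converts a sum over intermediate global states into a matrix
  product on \<open>C\<close>.\<close>

lemma local_index_bij:
  assumes d: "d > 0" and C: "C \<subseteq> {..<N}" and i: "i < d ^ N"
  shows "bij_betw (local_index d C) {k. k < d ^ N \<and> agree_on d ({..<N} - C) i k} {..<d ^ card C}"
  unfolding bij_betw_def
proof
  have fin: "finite C" using C finite_subset by blast
  show "inj_on (local_index d C) {k. k < d ^ N \<and> agree_on d ({..<N} - C) i k}"
  proof (rule inj_onI)
    fix k l assume k: "k \<in> {k. k < d ^ N \<and> agree_on d ({..<N} - C) i k}" and l: "l \<in> {k. k < d ^ N \<and> agree_on d ({..<N} - C) i k}"
      and "local_index d C k = local_index d C l"
    then have "agree_on d C k l" using agree_on_local_index[OF d fin] by blast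
    then have "digit d k s = digit d l s" if "s < N" for s
      using k l that by (cases "s \<in> C") (auto simp: agree_on_def)
    then show "k = l" using k l by - (rule digits_unique[of k d N l]; auto)
  qed
  show "local_index d C ` {k. k < d ^ N \<and> agree_on d ({..<N} - C) i k} = {..<d ^ card C}"
  proof (intro equalityI subsetI)
    fix x assume "x \<in> {..<d ^ card C}"
    then have x: "x < d ^ card C" by simp
    let ?cs = "sorted_list_of_set C"
    have b: "bij_betw ((!) ?cs) {..<card C} C"
      using fin bij_betw_nth[of ?cs "{..<card C}" C] by simp
    \<comment> \<open>The position of a site in the increasing enumeration of \<open>C\<close>, used
      to write a prescribed local state back into the global index.\<close>
    define pos where "pos = inv_into {..<card C} ((!) ?cs)"
    have pos: "pos (?cs ! m) = m" if "m < card C" for m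
      unfolding pos_def using b that by (intro inv_into_f_f) (auto simp: bij_betw_def)
    define k where "k = from_digits d N (\<lambda>s. if s \<in> C then digit d x (pos s) else digit d i s)"
    have kd: "digit d k s = (if s \<in> C then digit d x (pos s) else digit d i s)" if "s < N" for s
      unfolding k_def using d that by (subst digit_from_digits) auto
    have kN: "k < d ^ N" unfolding k_def using d by (intro from_digits_less) auto
    have csC: "?cs ! m \<in> C" if "m < card C" for m using b that by (auto simp: bij_betw_def)
    have "digit d k (?cs ! m) = digit d x m" if "m < card C" for m
      using kd[of "?cs ! m"] csC[OF that] C pos[OF that] by auto
    then have "local_index d C k = x" using local_index_eq_iff[OF d x] by blast
    moreover have "agree_on d ({..<N} - C) i k" using kd by (auto simp: agree_on_def)
    ultimately show "x \<in> local_index d C ` {k. k < d ^ N \<and> agree_on d ({..<N} - C) i k}" using kN by blast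
  qed (auto simp: local_index_less[OF d])
qed

section \<open>Embedded local matrices and the partial trace\<close>

lemma embed_mat_carrier [simp]: "embed_mat d N C p \<in> carrier_mat (d ^ N) (d ^ N)"
  by (simp add: embed_mat_def)

lemma embed_mat_supported:
  assumes "C \<subseteq> {..<N}"
  shows "supported_on d N C (embed_mat d N C p)"
proof -
  have fin: "finite C" using assms finite_subset by blast
  show ?thesis
    unfolding supported_on_def
  proof (intro conjI allI impI)
    fix i j assume ij: "i < d ^ N" "j < d ^ N"
    { assume "\<not> agree_on d ({..<N} - C) i j"
      then show "embed_mat d N C p $$ (i, j) = 0" using ij by (simp add: embed_mat_def) }
    fix i' j' assume ij': "i' < d ^ N" "j' < d ^ N"
    assume "agree_on d ({..<N} - C) i j \<and> agree_on d ({..<N} - C) i' j' \<and> agree_on d C i i' \<and> agree_on d C j j'"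
    then show "embed_mat d N C p $$ (i, j) = embed_mat d N C p $$ (i', j')"
      using ij ij' local_index_cong[OF fin] by (simp add: embed_mat_def) metis
  qed simp
qed

lemma embed_mat_mult:
  assumes d: "d > 0" and C: "C \<subseteq> {..<N}" and p: "p \<in> carrier_mat (d ^ card C) (d ^ card C)"
    and q: "q \<in> carrier_mat (d ^ card C) (d ^ card C)"
  shows "embed_mat d N C p * embed_mat d N C q = embed_mat d N C (p * q)"
proof (rule eq_matI)
  fix i j assume "i < dim_row (embed_mat d N C (p * q))" "j < dim_col (embed_mat d N C (p * q))"
  then have ij: "i < d ^ N" "j < d ^ N" by (auto simp: embed_mat_def)
  let ?K = "{k. k < d ^ N \<and> agree_on d ({..<N} - C) i k}" and ?l = "local_index d C"
  have "(embed_mat d N C p * embed_mat d N C q) $$ (i, j) = (\<Sum>k<d ^ N. embed_mat d N C p $$ (i, k) * embed_mat d N C q $$ (k, j))"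
    using ij by (intro mult_mat_index[of _ "d ^ N" "d ^ N" _ "d ^ N"]) auto
  also have "\<dots> = (\<Sum>k\<in>?K. embed_mat d N C p $$ (i, k) * embed_mat d N C q $$ (k, j))"
    using ij by (intro sum.mono_neutral_right) (auto simp: embed_mat_def)
  also have "\<dots> = (\<Sum>k\<in>?K. if agree_on d ({..<N} - C) i j then p $$ (?l i, ?l k) * q $$ (?l k, ?l j) else 0)"
    using ij by (intro sum.cong refl) (auto simp: embed_mat_def agree_on_def)
  also have "\<dots> = (if agree_on d ({..<N} - C) i j then (\<Sum>k\<in>?K. p $$ (?l i, ?l k) * q $$ (?l k, ?l j)) else 0)"
    by simp
  also have "(\<Sum>k\<in>?K. p $$ (?l i, ?l k) * q $$ (?l k, ?l j)) = (\<Sum>x<d ^ card C. p $$ (?l i, x) * q $$ (x, ?l j))"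
    by (rule sum.reindex_bij_betw[OF local_index_bij[OF d C ij(1)]])
  also have "\<dots> = (p * q) $$ (?l i, ?l j)"
    using local_index_less[OF d] by (intro mult_mat_index[OF p q, symmetric])
  finally show "(embed_mat d N C p * embed_mat d N C q) $$ (i, j) = embed_mat d N C (p * q) $$ (i, j)"
    using ij by (simp add: embed_mat_def)
qed (simp_all add: embed_mat_def)

lemma embed_mat_projection:
  assumes d: "d > 0" and C: "C \<subseteq> {..<N}" and p: "projection_mat (d ^ card C) p"
  shows "projection_mat (d ^ N) (embed_mat d N C p)"
proof -
  note pD = projection_matD[OF p]
  have "mat_adjoint (embed_mat d N C p) = embed_mat d N C p"
  proof (rule eq_matI)
    fix i j assume "i < dim_row (embed_mat d N C p)" "j < dim_col (embed_mat d N C p)"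
    then have ij: "i < d ^ N" "j < d ^ N" by (auto simp: embed_mat_def)
    have "agree_on d ({..<N} - C) j i = agree_on d ({..<N} - C) i j" by (auto simp: agree_on_def)
    then show "mat_adjoint (embed_mat d N C p) $$ (i, j) = embed_mat d N C p $$ (i, j)"
      using ij hermitian_index[OF pD(4), of "local_index d C i" "local_index d C j"] local_index_less[OF d]
      by (simp add: embed_mat_def)
  qed (simp_all add: embed_mat_def)
  then show ?thesis
    using embed_mat_mult[OF d C pD(1) pD(1)] pD(3) by (simp add: projection_mat_def hermitian_mat_def)
qed

lemma embed_mat_one:
  assumes d: "d > 0" and C: "C \<subseteq> {..<N}"
  shows "embed_mat d N C (1\<^sub>m (d ^ card C)) = 1\<^sub>m (d ^ N)"
proof (rule eq_matI)
  have fin: "finite C" using C finite_subset by blast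
  fix i j assume "i < dim_row (1\<^sub>m (d ^ N) :: complex mat)" "j < dim_col (1\<^sub>m (d ^ N) :: complex mat)"
  then have ij: "i < d ^ N" "j < d ^ N" by auto
  have "i = j" if "agree_on d ({..<N} - C) i j" "local_index d C i = local_index d C j"
    using that agree_on_local_index[OF d fin that(2)] by - (rule digits_unique[OF ij]; metis agree_on_def DiffI lessThan_iff)
  then show "embed_mat d N C (1\<^sub>m (d ^ card C)) $$ (i, j) = 1\<^sub>m (d ^ N) $$ (i, j)"
    using ij local_index_less[OF d] by (auto simp: embed_mat_def agree_on_def)
qed (simp_all add: embed_mat_def)

lemma reduced_state_index:
  assumes d: "d > 0" and xy: "x < d ^ card C" "y < d ^ card C"
  shows "reduced_state d N C \<rho> $$ (x, y) =
    (\<Sum>(i, j) \<in> {(i, j). i < d ^ N \<and> j < d ^ N \<and> agree_on d ({..<N} - C) i j \<and>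
        local_index d C i = x \<and> local_index d C j = y}. \<rho> $$ (i, j))"
  unfolding reduced_state_def using xy local_index_eq_iff[OF d xy(1)] local_index_eq_iff[OF d xy(2)]
  by (auto intro!: sum.cong)

lemma reduced_state_carrier [simp]: "reduced_state d N C \<rho> \<in> carrier_mat (d ^ card C) (d ^ card C)"
  by (simp add: reduced_state_def)

text \<open>The partial trace is dual to the embedding: both sides sum over pairs of global states
  that agree outside \<open>C\<close>, on the left grouped by their restrictions to
  \<open>C\<close>.\<close>

lemma reduced_state_tr:
  assumes d: "d > 0" and C: "C \<subseteq> {..<N}" and p: "p \<in> carrier_mat (d ^ card C) (d ^ card C)"
    and \<rho>: "\<rho> \<in> carrier_mat (d ^ N) (d ^ N)"
  shows "mat_tr (reduced_state d N C \<rho> * p) = mat_tr (\<rho> * embed_mat d N C p)"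
proof -
  let ?c = "d ^ card C" and ?l = "local_index d C"
  let ?S = "{(i, j). i < d ^ N \<and> j < d ^ N \<and> agree_on d ({..<N} - C) i j}"
  let ?h = "\<lambda>(i, j). (?l i, ?l j)"
  have finS: "finite ?S" by (rule finite_subset[of _ "{..<d ^ N} \<times> {..<d ^ N}"]) auto
  have "mat_tr (reduced_state d N C \<rho> * p) = (\<Sum>x<?c. \<Sum>y<?c. reduced_state d N C \<rho> $$ (x, y) * p $$ (y, x))"
    using p by (auto simp: mat_tr_def mult_mat_index[of "reduced_state d N C \<rho>" ?c ?c p ?c] carrier_matD[OF reduced_state_carrier] simp del: index_mult_mat(1) intro!: sum.cong)
  also have "\<dots> = (\<Sum>z\<in>{..<?c} \<times> {..<?c}. reduced_state d N C \<rho> $$ z * p $$ (snd z, fst z))"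
    by (simp add: sum.cartesian_product case_prod_unfold)
  also have "\<dots> = (\<Sum>z\<in>{..<?c} \<times> {..<?c}. \<Sum>ij\<in>{ij \<in> ?S. ?h ij = z}. \<rho> $$ ij * p $$ (?l (snd ij), ?l (fst ij)))"
  proof (intro sum.cong refl)
    fix z assume "z \<in> {..<?c} \<times> {..<?c}"
    then obtain x y where z: "z = (x, y)" and xy: "x < ?c" "y < ?c" by auto
    have "{(i, j). i < d ^ N \<and> j < d ^ N \<and> agree_on d ({..<N} - C) i j \<and> ?l i = x \<and> ?l j = y} = {ij \<in> ?S. ?h ij = (x, y)}" by auto
    then have "reduced_state d N C \<rho> $$ (x, y) * p $$ (y, x) = (\<Sum>ij\<in>{ij \<in> ?S. ?h ij = (x, y)}. \<rho> $$ ij * p $$ (y, x))"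
      by (simp add: reduced_state_index[OF d xy] sum_distrib_right case_prod_unfold)
    also have "\<dots> = (\<Sum>ij\<in>{ij \<in> ?S. ?h ij = (x, y)}. \<rho> $$ ij * p $$ (?l (snd ij), ?l (fst ij)))"
      by (intro sum.cong) auto
    finally show "reduced_state d N C \<rho> $$ z * p $$ (snd z, fst z) = (\<Sum>ij\<in>{ij \<in> ?S. ?h ij = z}. \<rho> $$ ij * p $$ (?l (snd ij), ?l (fst ij)))"
      by (simp add: z)
  qed
  also have "\<dots> = (\<Sum>ij\<in>?S. \<rho> $$ ij * p $$ (?l (snd ij), ?l (fst ij)))"
    using finS local_index_less[OF d] by (intro sum.group) auto
  also have "\<dots> = (\<Sum>ij\<in>{..<d ^ N} \<times> {..<d ^ N}. \<rho> $$ ij * embed_mat d N C p $$ (snd ij, fst ij))"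
  proof (rule sum.mono_neutral_cong_left)
    have *: "agree_on d ({..<N} - C) j i = agree_on d ({..<N} - C) i j" for i j by (auto simp: agree_on_def)
    show "\<forall>i\<in>{..<d ^ N} \<times> {..<d ^ N} - ?S. \<rho> $$ i * embed_mat d N C p $$ (snd i, fst i) = 0"
      by (auto simp: embed_mat_def * split: if_splits)
    show "\<rho> $$ x * p $$ (?l (snd x), ?l (fst x)) = \<rho> $$ x * embed_mat d N C p $$ (snd x, fst x)" if "x \<in> ?S" for x
      using that by (auto simp: embed_mat_def *)
  qed auto
  also have "\<dots> = (\<Sum>i<d ^ N. \<Sum>j<d ^ N. \<rho> $$ (i, j) * embed_mat d N C p $$ (j, i))"
    by (simp add: sum.cartesian_product case_prod_unfold)
  also have "\<dots> = mat_tr (\<rho> * embed_mat d N C p)"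
    using \<rho> by (auto simp: mat_tr_def mult_mat_index[of \<rho> "d ^ N" "d ^ N" _ "d ^ N"] simp del: index_mult_mat(1) intro!: sum.cong)
  finally show ?thesis .
qed

lemma reduced_state_hermitian:
  assumes d: "d > 0" and \<rho>: "hermitian_mat (d ^ N) \<rho>"
  shows "hermitian_mat (d ^ card C) (reduced_state d N C \<rho>)"
proof -
  have "mat_adjoint (reduced_state d N C \<rho>) = reduced_state d N C \<rho>"
  proof (rule eq_matI)
    fix x y assume "x < dim_row (reduced_state d N C \<rho>)" "y < dim_col (reduced_state d N C \<rho>)"
    then have xy: "x < d ^ card C" "y < d ^ card C" by (auto simp: reduced_state_def)
    let ?S = "\<lambda>x y. {(i, j). i < d ^ N \<and> j < d ^ N \<and> agree_on d ({..<N} - C) i j \<and> local_index d C i = x \<and> local_index d C j = y}"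
    have "mat_adjoint (reduced_state d N C \<rho>) $$ (x, y) = cnj (reduced_state d N C \<rho> $$ (y, x))"
      using xy carrier_matD[OF reduced_state_carrier] by (intro mat_adjoint_index) auto
    also have "\<dots> = (\<Sum>(i, j)\<in>?S y x. cnj (\<rho> $$ (i, j)))"
      unfolding reduced_state_index[OF d xy(2) xy(1)] by (simp add: case_prod_unfold)
    also have "\<dots> = (\<Sum>(i, j)\<in>?S x y. \<rho> $$ (i, j))"
      by (rule sum.reindex_bij_witness[of _ "\<lambda>(i, j). (j, i)" "\<lambda>(i, j). (j, i)"])
         (auto simp: agree_on_def hermitian_index[OF \<rho>, symmetric])
    finally show "mat_adjoint (reduced_state d N C \<rho>) $$ (x, y) = reduced_state d N C \<rho> $$ (x, y)"
      unfolding reduced_state_index[OF d xy] .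
  qed (simp_all add: reduced_state_def)
  then show ?thesis by (simp add: hermitian_mat_def)
qed

text \<open>The sign is chosen on purpose: \<open>Q\<close> embeds the complement of the positive
  projection, hence detects where \<tau> exceeds \<rho>. The operator domination bounds the second
  state from above only, so its expectations must enter with a plus sign.\<close>

lemma reduced_trace_norm_dual:
  assumes d: "d > 0" and C: "C \<subseteq> {..<N}" and \<rho>: "hermitian_mat (d ^ N) \<rho>" and \<tau>: "hermitian_mat (d ^ N) \<tau>"
    and tr: "mat_tr \<rho> = mat_tr \<tau>"
  obtains Q where "projection_mat (d ^ N) Q" "supported_on d N C Q"
    "trace_norm (reduced_state d N C \<rho> - reduced_state d N C \<tau>) = 2 * (Re (mat_tr (\<tau> * Q)) - Re (mat_tr (\<rho> * Q)))"
proof -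
  let ?c = "d ^ card C"
  have c: "\<rho> \<in> carrier_mat (d ^ N) (d ^ N)" "\<tau> \<in> carrier_mat (d ^ N) (d ^ N)"
    using \<rho> \<tau> by (auto simp: hermitian_mat_def)
  define X where "X = reduced_state d N C \<rho> - reduced_state d N C \<tau>"
  have XQ: "mat_tr (X * p) = mat_tr (\<rho> * embed_mat d N C p) - mat_tr (\<tau> * embed_mat d N C p)"
    if p: "p \<in> carrier_mat ?c ?c" for p
    unfolding X_def using p
    by (simp add: minus_mult_distrib_mat[of _ ?c ?c] mat_tr_minus[of _ ?c] mult_carrier_mat[of _ ?c ?c _ ?c]
        reduced_state_tr[OF d C p] c)
  have Xc: "X \<in> carrier_mat ?c ?c" by (simp add: X_def minus_carrier_mat)
  have Xh: "hermitian_mat ?c X"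
    using reduced_state_hermitian[OF d \<rho>, of C] reduced_state_hermitian[OF d \<tau>, of C] Xc
    by (simp add: hermitian_mat_def X_def mat_adjoint_minus[of _ ?c ?c])
  have X0: "mat_tr X = 0"
    using XQ[of "1\<^sub>m ?c"] c tr Xc by (simp add: embed_mat_one[OF d C])
  obtain P where P: "hermitian_mat ?c P" "P * P = P" "trace_norm X = 2 * Re (mat_tr (X * P))"
    using trace_norm_dual[OF Xh X0] by blast
  have Pp: "projection_mat ?c P" using P by (simp add: projection_mat_def)
  note PD = projection_matD[OF Pp]
  have "mat_tr (X * (1\<^sub>m ?c - P)) = mat_tr X - mat_tr (X * P)"
    using Xc PD(1) by (simp add: mult_minus_distrib_mat[of _ ?c ?c _ ?c] mat_tr_minus[of _ ?c] mult_carrier_mat[of _ ?c ?c _ ?c])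
  then have tn: "trace_norm X = - 2 * Re (mat_tr (X * (1\<^sub>m ?c - P)))" using X0 P(3) by simp
  show thesis
  proof
    show "projection_mat (d ^ N) (embed_mat d N C (1\<^sub>m ?c - P))"
      by (rule embed_mat_projection[OF d C projection_mat_compl[OF Pp]])
    show "supported_on d N C (embed_mat d N C (1\<^sub>m ?c - P))" by (rule embed_mat_supported[OF C])
    show "trace_norm (reduced_state d N C \<rho> - reduced_state d N C \<tau>) =
      2 * (Re (mat_tr (\<tau> * embed_mat d N C (1\<^sub>m ?c - P))) - Re (mat_tr (\<rho> * embed_mat d N C (1\<^sub>m ?c - P))))"
      using tn XQ[of "1\<^sub>m ?c - P"] PD(1) by (simp add: X_def)
  qed
qed

section \<open>Trace distances summed over one separated family of regions\<close>

lemma (in commuting_projections) tilt_prod_supported: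
  assumes d: "d > 0" and n: "n = d ^ N"
    and X: "\<And>i. i < m \<Longrightarrow> X i \<subseteq> {..<N}" "\<And>i. i < m \<Longrightarrow> supported_on d N (X i) (P i)"
  shows "k \<le> m \<Longrightarrow> supported_on d N (\<Union>i<k. X i) (B k)"
proof (induction k)
  case 0
  then show ?case using d by (simp add: n supported_on_one)
next
  case (Suc k)
  then have k: "k < m" by simp
  have "X i \<subseteq> {..<N}" if "i < Suc k" for i using X(1)[of i] that Suc.prems by simp
  then have sub: "(\<Union>i<Suc k. X i) \<subseteq> {..<N}" by blast
  have 1: "supported_on d N (\<Union>i<Suc k. X i) (B k)"
    using Suc k by (intro supported_on_mono[OF _ _ sub]) (auto simp: lessThan_Suc)
  have 2: "supported_on d N (\<Union>i<Suc k. X i) (tilt n s (P k))"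
    unfolding n using k
    by (intro supported_on_mono[OF supported_on_tilt[OF d X(1)[OF k] X(2)[OF k]] _ sub]) (auto simp: lessThan_Suc)
  show ?case using supported_on_mult[OF d sub 1 2] by simp
qed

text \<open>Chernoff's bound applied to the optimal test projections of the regions, with the
  logarithm \<bar>\<beta>\<bar> \<delta> of the domination factor as \<Lambda> and
  \<open>exp (- real r / \<xi>)\<close> as \<epsilon>.\<close>

lemma separated_regions_bound:
  assumes d: "d > 0" and N: "N = L ^ D" and H: "hermitian_mat (d ^ N) H"
    and decay: "exp_decay_correlations d D L \<xi> (gibbs \<beta> H)" and \<xi>: "\<xi> > 0"
    and U: "U \<in> energy_ensemble H \<delta>" and \<delta>: "\<delta> > 0" and s: "s > 0"
    and F: "finite F" "\<And>X. X \<in> F \<Longrightarrow> X \<subseteq> {..<N} \<and> X \<noteq> {}"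
    and far: "\<And>X Y x y. X \<in> F \<Longrightarrow> Y \<in> F \<Longrightarrow> X \<noteq> Y \<Longrightarrow> x \<in> X \<Longrightarrow> y \<in> Y \<Longrightarrow> r \<le> manhattan D L x y"
    and r: "r > 0"
    and small: "real (card F) * (1 + s) ^ card F * exp (- real r / \<xi>) \<le> 1"
  shows "ln (1 + s) * (\<Sum>C\<in>F. trace_norm (reduced_state d N C (gibbs \<beta> H) -
      reduced_state d N C (gibbs \<beta> (U * H * mat_adjoint U))))
    \<le> 2 * (\<bar>\<beta>\<bar> * \<delta> + ln 2 + (s - ln (1 + s)) * real (card F))"
proof -
  define n where "n = d ^ N"
  have n0: "n > 0" using d by (simp add: n_def)
  define g where "g = gibbs \<beta> H"
  define \<tau> where "\<tau> = gibbs \<beta> (U * H * mat_adjoint U)"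
  note H = H[folded n_def]
  have dimH: "dim_row H = n" using H by (auto simp: hermitian_mat_def)
  have Uc: "U \<in> carrier_mat n n" using U by (auto simp: energy_ensemble_def dimH unitary_mat_def)
  have UH: "hermitian_mat n (U * H * mat_adjoint U)"
    using hermitian_conj[OF H, of "mat_adjoint U"] Uc by simp
  obtain K where K: "K \<in> carrier_mat n n" "\<And>X. X \<in> carrier_mat n n \<Longrightarrow> Re (mat_tr (g * X)) = quad_form K X"
    and g: "hermitian_mat n g" "mat_tr g = 1"
    using gibbs_quad_form[OF H n0, of \<beta>] unfolding g_def by blast
  obtain K' where K': "K' \<in> carrier_mat n n" "\<And>X. X \<in> carrier_mat n n \<Longrightarrow> Re (mat_tr (\<tau> * X)) = quad_form K' X"
    and \<tau>: "hermitian_mat n \<tau>" "mat_tr \<tau> = 1"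
    using gibbs_quad_form[OF UH n0, of \<beta>] unfolding \<tau>_def by blast
  have gc: "g \<in> carrier_mat n n" "\<tau> \<in> carrier_mat n n" using g \<tau> by (auto simp: hermitian_mat_def)
  have K1: "quad_form K (1\<^sub>m n) = 1" using K(2)[of "1\<^sub>m n"] g gc by simp
  have K'1: "quad_form K' (1\<^sub>m n) = 1" using K'(2)[of "1\<^sub>m n"] \<tau> gc by simp
  let ?T = "\<lambda>C. trace_norm (reduced_state d N C g - reduced_state d N C \<tau>)"
  have "\<exists>Q. projection_mat n Q \<and> supported_on d N C Q \<and> ?T C = 2 * (Re (mat_tr (\<tau> * Q)) - Re (mat_tr (g * Q)))"
    if "C \<in> F" for C
    using reduced_trace_norm_dual[of d C N g \<tau>] d F(2)[OF that] g \<tau> unfolding n_def by metis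
  then obtain Q where Q: "\<And>C. C \<in> F \<Longrightarrow> projection_mat n (Q C) \<and> supported_on d N C (Q C) \<and>
      ?T C = 2 * (Re (mat_tr (\<tau> * Q C)) - Re (mat_tr (g * Q C)))" by metis
  define m where "m = card F"
  obtain h where h: "bij_betw h {..<m} F"
    using ex_bij_betw_nat_finite[OF F(1)] unfolding m_def atLeast0LessThan by blast
  have hF: "h i \<in> F" if "i < m" for i using h that by (auto simp: bij_betw_def)
  have hne: "h i \<noteq> h j" if "i < m" "j < m" "i \<noteq> j" for i j
    using h that by (auto simp: bij_betw_def inj_on_def)
  define P where "P i = Q (h i)" for i
  \<comment> \<open>A common site would have distance 0 < r to itself; disjointness is what makes
    the projections commute.\<close>
  have disj: "h i \<inter> h j = {}" if "i < m" "j < m" "i \<noteq> j" for i j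
  proof (rule ccontr)
    assume "h i \<inter> h j \<noteq> {}"
    then obtain x where "x \<in> h i" "x \<in> h j" by blast
    then have "r \<le> manhattan D L x x" using far[OF hF hF hne] that by blast
    then show False using r by (simp add: manhattan_def)
  qed
  interpret commuting_projections n P m s
  proof
    show "projection_mat n (P i)" if "i < m" for i using Q[OF hF[OF that]] by (simp add: P_def)
    show "P i * P j = P j * P i" if "i < m" "j < m" "i \<noteq> j" for i j
      unfolding P_def using F(2)[OF hF] Q[OF hF] that disj
      by (intro disjoint_supported_commute[OF d, of "h i" "h j" N]) auto
  qed (rule s)
  \<comment> \<open>The new factor is decorrelated from the product of all earlier ones, an operator
    on the union of their regions; the two operator norms contribute the powers of 1 + s.\<close>
  have corr: "quad_form K (B k * tilt n s (P k)) \<le> quad_form K (B k) * quad_form K (tilt n s (P k))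
      + (1 + s) ^ Suc k * exp (- real r / \<xi>)" if k: "1 \<le> k" "k < m" for k
  proof -
    let ?X = "\<Union>i<k. h i" and ?F = "tilt n s (P k)"
    have hN: "h i \<subseteq> {..<N}" "h i \<noteq> {}" if "i < m" for i using F(2)[OF hF[OF that]] by auto
    have BX: "supported_on d N ?X (B k)"
      using F(2)[OF hF] Q[OF hF] k by (intro tilt_prod_supported[OF d n_def]) (auto simp: P_def)
    have FX: "supported_on d N (h k) ?F"
      unfolding n_def P_def using F(2)[OF hF] Q[OF hF] k by (intro supported_on_tilt[OF d]) auto
    have "h 0 \<subseteq> ?X" using k by (intro UN_upper) simp
    moreover have "h i \<subseteq> {..<N}" if "i < k" for i using hN(1)[of i] that k by simp
    ultimately have Xs: "?X \<subseteq> {..<N}" "?X \<noteq> {}" using hN(2)[of 0] k by blast+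
    have c: "B k \<in> carrier_mat n n" "?F \<in> carrier_mat n n" using k by auto
    define A where "A = mat_tr (g * (B k * ?F)) - mat_tr (g * B k) * mat_tr (g * ?F)"
    have dist: "real r \<le> real (region_dist D L ?X (h k))"
      unfolding region_dist_def of_nat_le_iff
    proof (rule cINF_greatest)
      show "?X \<times> h k \<noteq> {}" using Xs hN[OF k(2)] by blast
      fix z assume "z \<in> ?X \<times> h k"
      then obtain i x y where z: "z = (x, y)" "i < k" "x \<in> h i" "y \<in> h k" by blast
      then have "r \<le> manhattan D L x y" using k by (intro far[OF hF hF hne]) auto
      then show "r \<le> (case z of (s, t) \<Rightarrow> manhattan D L s t)" by (simp add: z)
    qed
    have Bn: "0 \<le> op_norm (B k)" "op_norm (B k) \<le> (1 + s) ^ k"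
      using k s c by (auto intro!: op_norm_le[of _ n] op_norm_nonneg[of _ n "(1 + s) ^ k"] tilt_prod_vec_l2_le)
    have Fn: "0 \<le> op_norm ?F" "op_norm ?F \<le> 1 + s"
      using k s c by (auto intro!: op_norm_le[of _ n] op_norm_nonneg[of _ n "1 + s"] tilt_vec_l2_le proj)
    have "cmod A \<le> op_norm (B k) * op_norm ?F * exp (- real (region_dist D L ?X (h k)) / \<xi>)"
      using decay Xs hN[OF k(2)] BX FX unfolding exp_decay_correlations_def N[symmetric] g_def[symmetric] A_def by blast
    also have "\<dots> \<le> ((1 + s) ^ k * (1 + s)) * exp (- real r / \<xi>)"
      using Bn Fn s dist \<xi> by (intro mult_mono) (auto simp: divide_right_mono)
    finally have A: "cmod A \<le> (1 + s) ^ Suc k * exp (- real r / \<xi>)" by (simp add: mult.commute)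
    have "hermitian_mat n ?F"
    proof -
      have "mat_adjoint ?F = ?F"
      proof (rule eq_matI)
        fix i j assume "i < dim_row ?F" "j < dim_col ?F"
        then have ij: "i < n" "j < n" using c by auto
        then show "mat_adjoint ?F $$ (i, j) = ?F $$ (i, j)"
          using hermitian_index[OF projection_matD(4)[OF proj[OF k(2)]] ij, symmetric] carrier_matD[OF P_carrier[OF k(2)]]
          by (simp add: tilt_def)
      qed (use c in auto)
      then show ?thesis using c by (simp add: hermitian_mat_def)
    qed
    \<comment> \<open>A real second expectation lets the real part of the product of expectations be
      the product of the real parts.\<close>
    then have im: "Im (mat_tr (g * ?F)) = 0" by (rule hermitian_mult_tr_real[OF g(1)])
    have "quad_form K (B k * ?F) = Re (mat_tr (g * (B k * ?F)))"
      using c by (intro K(2)[symmetric]) auto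
    also have "mat_tr (g * (B k * ?F)) = A + mat_tr (g * B k) * mat_tr (g * ?F)" by (simp add: A_def)
    also have "Re \<dots> = Re A + quad_form K (B k) * quad_form K ?F"
      using K(2)[OF c(1)] K(2)[OF c(2)] im by simp
    also have "Re A \<le> cmod A" by (rule complex_Re_le_cmod)
    finally show ?thesis using A by linarith
  qed
  have dom: "quad_form K' (B m) \<le> exp (\<bar>\<beta>\<bar> * \<delta>) * quad_form K (B m)"
    using gibbs_ensemble_dominated[OF H U \<delta>, of "B m" \<beta>] quad_form_B_nonneg[of _ m] K(2)[of "B m"] K'(2)[of "B m"]
    by (simp add: g_def \<tau>_def)
  have main: "ln (1 + s) * (\<Sum>i<m. quad_form K' (P i)) \<le> \<bar>\<beta>\<bar> * \<delta> + ln 2 + s * (\<Sum>i<m. quad_form K (P i))"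
    using small by (intro dominated_expectation_bound[OF K(1) K1 K'(1) K'1 dom corr]) (auto simp: m_def)
  \<comment> \<open>The Gibbs means enter Chernoff's bound with factor s instead of ln (1 + s); as
    each mean is at most 1, the mismatch costs at most s - ln (1 + s) per region.\<close>
  have "(\<Sum>i<m. quad_form K (P i)) \<le> (\<Sum>i<m. 1)"
    using projection_quad_form_bounds[OF K(1) proj] K1 by (intro sum_mono) auto
  then have le: "(s - ln (1 + s)) * (\<Sum>i<m. quad_form K (P i)) \<le> (s - ln (1 + s)) * real m"
    using ln_add_one_self_le_self[of s] s by (intro mult_left_mono) auto
  have "(\<Sum>C\<in>F. ?T C) = (\<Sum>i<m. ?T (h i))"
    by (rule sum.reindex_bij_betw[OF h, symmetric])
  also have "\<dots> = (\<Sum>i<m. 2 * (quad_form K' (P i) - quad_form K (P i)))"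
    using Q[OF hF] K(2)[OF P_carrier] K'(2)[OF P_carrier] by (intro sum.cong refl) (auto simp: P_def)
  also have "\<dots> = 2 * ((\<Sum>i<m. quad_form K' (P i)) - (\<Sum>i<m. quad_form K (P i)))"
    by (simp add: sum_subtractf flip: sum_distrib_left)
  finally have "ln (1 + s) * (\<Sum>C\<in>F. ?T C) = 2 * (ln (1 + s) * (\<Sum>i<m. quad_form K' (P i)) - ln (1 + s) * (\<Sum>i<m. quad_form K (P i)))"
    by (simp only: right_diff_distrib mult.left_commute)
  also have "\<dots> \<le> 2 * (\<bar>\<beta>\<bar> * \<delta> + ln 2 + (s - ln (1 + s)) * real m)"
    using main le by (simp add: left_diff_distrib)
  finally show ?thesis unfolding g_def \<tau>_def m_def .
qed

section \<open>Hypercubes\<close>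

definition cube :: "nat \<Rightarrow> nat \<Rightarrow> nat \<Rightarrow> (nat \<Rightarrow> nat) \<Rightarrow> nat set" where
  "cube D L l c = {s. s < L ^ D \<and> (\<forall>a<D. c a \<le> digit L s a \<and> digit L s a < c a + l)}"

text \<open>Extensional functions on the coordinates make the corner of a cube unique, so that cubes
  can be counted and classified by their corners.\<close>

lemma hypercubes_eq:
  assumes "l \<le> L"
  shows "hypercubes D L l = cube D L l ` (PiE {..<D} (\<lambda>_. {..L - l}))"
proof (intro equalityI subsetI)
  fix C assume "C \<in> hypercubes D L l"
  then obtain c where c: "C = cube D L l c" "\<forall>a<D. c a + l \<le> L" by (auto simp: hypercubes_def cube_def)
  have "C = cube D L l (restrict c {..<D})" unfolding c(1) by (simp add: cube_def)
  moreover have "c a \<le> L - l" if "a < D" for a using c(2)[rule_format, OF that] by simp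
  then have "restrict c {..<D} \<in> PiE {..<D} (\<lambda>_. {..L - l})" by (simp add: restrict_PiE_iff)
  ultimately show "C \<in> cube D L l ` (PiE {..<D} (\<lambda>_. {..L - l}))" by blast
next
  fix C assume "C \<in> cube D L l ` (PiE {..<D} (\<lambda>_. {..L - l}))"
  then obtain c where c: "C = cube D L l c" "c \<in> PiE {..<D} (\<lambda>_. {..L - l})" by blast
  have "\<forall>a<D. c a + l \<le> L"
  proof (intro allI impI)
    fix a assume "a < D"
    then have "c a \<le> L - l" using c(2) by (auto simp: PiE_def Pi_def)
    then show "c a + l \<le> L" using assms by simp
  qed
  then show "C \<in> hypercubes D L l" unfolding hypercubes_def c(1) cube_def by blast
qed

lemma corner_in_cube:
  assumes l: "1 \<le> l" "l \<le> L" and c: "c \<in> PiE {..<D} (\<lambda>_. {..L - l})"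
  shows "from_digits L D c \<in> cube D L l c" "\<And>a. a < D \<Longrightarrow> digit L (from_digits L D c) a = c a"
proof -
  have cL: "c a < L" if "a < D" for a
  proof -
    have "c a \<le> L - l" using c that by (auto simp: PiE_def Pi_def)
    then show ?thesis using l by simp
  qed
  show dg: "digit L (from_digits L D c) a = c a" if "a < D" for a
    using cL that by (intro digit_from_digits) auto
  show "from_digits L D c \<in> cube D L l c"
    using cL l dg by (auto simp: cube_def intro!: from_digits_less)
qed

text \<open>Each cube contains its own corner, so equal cubes have corners that bound each other
  coordinatewise.\<close>

lemma cube_inj:
  assumes l: "1 \<le> l" "l \<le> L"
  shows "inj_on (cube D L l) (PiE {..<D} (\<lambda>_. {..L - l}))"
proof (rule inj_onI)
  fix c c' assume c: "c \<in> PiE {..<D} (\<lambda>_. {..L - l})" and c': "c' \<in> PiE {..<D} (\<lambda>_. {..L - l})"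
    and eq: "cube D L l c = cube D L l c'"
  have "c a = c' a" if "a < D" for a
    using corner_in_cube[OF l c] corner_in_cube[OF l c'] eq that unfolding cube_def
    by (metis (no_types, lifting) mem_Collect_eq le_antisym)
  then show "c = c'" using c c' by (intro PiE_ext[OF c c']) auto
qed

text \<open>In a coordinate where the corners differ, congruence separates them by at least l + r;
  the width of the cube uses up l of this, and one coordinate is a lower bound for the Manhattan
  distance.\<close>

lemma cube_distance:
  assumes ne: "c \<noteq> c'" and c: "c \<in> PiE {..<D} A" "c' \<in> PiE {..<D} A"
    and cls: "\<And>a. a < D \<Longrightarrow> c a mod (l + r) = c' a mod (l + r)"
    and xy: "x \<in> cube D L l c" "y \<in> cube D L l c'"
  shows "r \<le> manhattan D L x y"
proof -
  obtain a where a: "a < D" "c a \<noteq> c' a" using ne PiE_ext[OF c] by auto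
  have gap: "u + w \<le> v" if "u < v" "u mod w = v mod w" for u v w :: nat
  proof -
    have "w dvd v - u" using that mod_eq_dvd_iff_nat[of u v w] by auto
    then show ?thesis using that by (auto dest: dvd_imp_le)
  qed
  have "c a + (l + r) \<le> c' a \<or> c' a + (l + r) \<le> c a"
    using a gap[of "c a" "c' a" "l + r"] gap[of "c' a" "c a" "l + r"] cls[OF a(1)] by linarith
  moreover have "c a \<le> digit L x a" "digit L x a < c a + l" "c' a \<le> digit L y a" "digit L y a < c' a + l"
    using xy a by (auto simp: cube_def)
  ultimately have "r \<le> nat \<bar>int (digit L x a) - int (digit L y a)\<bar>" by linarith
  also have "\<dots> \<le> manhattan D L x y"
    unfolding manhattan_def using a by (intro member_le_sum) auto
  finally show ?thesis .
qed

text \<open>Cubes whose corners agree modulo \<open>l + r\<close> in every coordinate are pairwise \<open>r\<close>-separated.\<close>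
lemma local_dist_bound:
  assumes d: "d > 0" and H: "hermitian_mat (d ^ (L ^ D)) H"
    and decay: "exp_decay_correlations d D L \<xi> (gibbs \<beta> H)" and \<xi>: "\<xi> > 0"
    and U: "U \<in> energy_ensemble H \<delta>" and \<delta>: "\<delta> > 0" and s: "s > 0"
    and l: "1 \<le> l" "2 * l \<le> L" and r: "r > 0"
    and mm: "mm = (L div (l + r) + 1) ^ D"
    and small: "real mm * (1 + s) ^ mm * exp (- real r / \<xi>) \<le> 1"
  shows "local_dist d D L l (gibbs \<beta> H) (gibbs \<beta> (U * H * mat_adjoint U))
    \<le> 2 * ((\<bar>\<beta>\<bar> * \<delta> + ln 2) / ln (1 + s) * (2 * real (l + r) / real L) ^ D + s)"
proof -
  define w where "w = l + r"
  define t where "t = ln (1 + s)"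
  define \<Lambda> where "\<Lambda> = \<bar>\<beta>\<bar> * \<delta> + ln 2"
  have \<Lambda>: "\<Lambda> \<ge> 0" using \<delta> by (simp add: \<Lambda>_def)
  have w: "w > 0" using l by (simp add: w_def)
  have lL: "l \<le> L" using l by simp
  have t: "t > 0" using s by (simp add: t_def)
  \<comment> \<open>From t \<ge> s / (1 + s): the mismatch s - t is of second order, at most s t, so
    dividing by t later leaves an error of only s per cube.\<close>
  have "- t \<le> 1 / (1 + s) - 1"
    using ln_le_minus_one[of "1 / (1 + s)"] s by (simp add: t_def ln_div)
  then have "- t * (1 + s) \<le> (1 / (1 + s) - 1) * (1 + s)" using s by (intro mult_right_mono) auto
  also have "\<dots> = - s" using s by (simp add: field_simps)
  finally have st: "s - t \<le> s * t" by (simp add: algebra_simps)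
  let ?K = "PiE {..<D} (\<lambda>_. {..L - l})" and ?R = "PiE {..<D} (\<lambda>_. {..<w})"
  define T where "T C = trace_norm (reduced_state d (L ^ D) C (gibbs \<beta> H) -
    reduced_state d (L ^ D) C (gibbs \<beta> (U * H * mat_adjoint U)))" for C
  define \<phi> where "\<phi> c = (\<lambda>a\<in>{..<D}. c a mod w)" for c :: "nat \<Rightarrow> nat"
  have finK: "finite ?K" and finR: "finite ?R" by (auto intro: finite_PiE)
  have cardK: "card ?K = (L - l + 1) ^ D" and cardR: "card ?R = w ^ D" by (auto simp: card_PiE)
  let ?G = "\<lambda>\<rho>. {c \<in> ?K. \<phi> c = \<rho>}"
  have cls: "t * (\<Sum>c\<in>?G \<rho>. T (cube D L l c)) \<le> 2 * (\<Lambda> + (s - t) * real (card (?G \<rho>)))" for \<rho>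
  proof -
    have finG: "finite (?G \<rho>)" using finK by simp
    have injG: "inj_on (cube D L l) (?G \<rho>)" using cube_inj[OF l(1) lL] by (rule inj_on_subset) auto
    have cardG: "card (cube D L l ` ?G \<rho>) = card (?G \<rho>)" by (rule card_image[OF injG])
    have modeq: "c a mod w = c' a mod w" if "c \<in> ?G \<rho>" "c' \<in> ?G \<rho>" "a < D" for c c' a
    proof -
      have "\<phi> c a = \<phi> c' a" using that by simp
      then show ?thesis using that by (simp add: \<phi>_def)
    qed
    \<comment> \<open>Inside a class the residues are fixed, so a corner is determined by its
      quotients modulo w, each with at most L div w + 1 values.\<close>
    have "card (?G \<rho>) \<le> card (PiE {..<D} (\<lambda>_. {..L div w}))"
    proof (rule card_inj_on_le[where f = "\<lambda>c. \<lambda>a\<in>{..<D}. c a div w"])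
      show "inj_on (\<lambda>c. \<lambda>a\<in>{..<D}. c a div w) (?G \<rho>)"
      proof (rule inj_onI)
        fix c c' assume c: "c \<in> ?G \<rho>" "c' \<in> ?G \<rho>" and eq: "(\<lambda>a\<in>{..<D}. c a div w) = (\<lambda>a\<in>{..<D}. c' a div w)"
        have "c a = c' a" if "a < D" for a
          using modeq[OF c that] fun_cong[OF eq, of a] that by (simp, metis div_mult_mod_eq)
        then show "c = c'" using c by (intro PiE_ext[of c "{..<D}" "\<lambda>_. {..L - l}" c']) auto
      qed
      show "(\<lambda>c. \<lambda>a\<in>{..<D}. c a div w) ` ?G \<rho> \<subseteq> PiE {..<D} (\<lambda>_. {..L div w})"
      proof (intro image_subsetI restrict_PiE_iff[THEN iffD2] ballI)
        fix c a assume "c \<in> ?G \<rho>" "a \<in> {..<D}"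
        then have "c a \<le> L - l" by (auto simp: PiE_def Pi_def)
        then have "c a div w \<le> L div w" by (intro div_le_mono) auto
        then show "c a div w \<in> {..L div w}" by simp
      qed
    qed (auto intro: finite_PiE)
    also have "\<dots> = mm" by (simp add: card_PiE mm w_def)
    finally have Gm: "card (?G \<rho>) \<le> mm" .
    have "real (card (?G \<rho>)) * (1 + s) ^ card (?G \<rho>) * exp (- real r / \<xi>) \<le> real mm * (1 + s) ^ mm * exp (- real r / \<xi>)"
      using Gm s by (intro mult_right_mono mult_mono power_increasing) auto
    then have sm: "real (card (cube D L l ` ?G \<rho>)) * (1 + s) ^ card (cube D L l ` ?G \<rho>) * exp (- real r / \<xi>) \<le> 1"
      using small unfolding cardG by linarith
    have "ln (1 + s) * (\<Sum>C\<in>cube D L l ` ?G \<rho>. T C) \<le> 2 * (\<bar>\<beta>\<bar> * \<delta> + ln 2 + (s - ln (1 + s)) * real (card (cube D L l ` ?G \<rho>)))"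
      unfolding T_def
    proof (rule separated_regions_bound[OF d refl H decay \<xi> U \<delta> s _ _ _ r sm])
      show "finite (cube D L l ` ?G \<rho>)" using finG by simp
      show "X \<subseteq> {..<L ^ D} \<and> X \<noteq> {}" if X: "X \<in> cube D L l ` ?G \<rho>" for X
      proof -
        obtain c where c: "X = cube D L l c" "c \<in> ?K" using X by blast
        then have "from_digits L D c \<in> X" using corner_in_cube(1)[OF l(1) lL] by blast
        then show ?thesis using c(1) by (auto simp: cube_def)
      qed
      fix X Y x y assume X: "X \<in> cube D L l ` ?G \<rho>" and Y: "Y \<in> cube D L l ` ?G \<rho>" and "X \<noteq> Y" and xy: "x \<in> X" "y \<in> Y"
      then obtain c c' where c: "X = cube D L l c" "c \<in> ?G \<rho>" "Y = cube D L l c'" "c' \<in> ?G \<rho>" "c \<noteq> c'" by blast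
      show "r \<le> manhattan D L x y"
        using c xy modeq[OF c(2) c(4)] unfolding w_def by (intro cube_distance[of c c' D "\<lambda>_. {..L - l}" l r x L y]) auto
    qed
    then show ?thesis unfolding sum.reindex[OF injG] cardG t_def \<Lambda>_def by (simp add: o_def)
  qed
  have img: "\<phi> ` ?K \<subseteq> ?R"
    by (intro image_subsetI) (simp only: \<phi>_def restrict_PiE_iff, simp add: w)
  have grp: "(\<Sum>\<rho>\<in>?R. \<Sum>c\<in>?G \<rho>. f c) = (\<Sum>c\<in>?K. f c)" for f :: "(nat \<Rightarrow> nat) \<Rightarrow> real"
    by (rule sum.group[OF finK finR img])
  \<comment> \<open>\<Lambda> is paid once for each of the w^D residue classes, whereas the
    second-order terms add up to one per cube.\<close>
  have "t * (\<Sum>c\<in>?K. T (cube D L l c)) = (\<Sum>\<rho>\<in>?R. t * (\<Sum>c\<in>?G \<rho>. T (cube D L l c)))"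
    by (simp only: grp flip: sum_distrib_left)
  also have "\<dots> \<le> (\<Sum>\<rho>\<in>?R. 2 * (\<Lambda> + (s - t) * real (card (?G \<rho>))))" by (intro sum_mono cls)
  also have "\<dots> = 2 * (real (card ?R) * \<Lambda> + (s - t) * (\<Sum>\<rho>\<in>?R. real (card (?G \<rho>))))"
    by (simp only: sum_distrib_left[symmetric] sum.distrib sum_constant)
  also have "(\<Sum>\<rho>\<in>?R. real (card (?G \<rho>))) = real (card ?K)"
    using grp[of "\<lambda>_. 1"] by simp
  also have "2 * (real (card ?R) * \<Lambda> + (s - t) * real (card ?K)) \<le> 2 * (real (card ?R) * \<Lambda> + s * t * real (card ?K))"
    using st by (intro mult_left_mono add_left_mono mult_right_mono) auto
  finally have tot: "t * (\<Sum>c\<in>?K. T (cube D L l c)) \<le> 2 * (real (w ^ D) * \<Lambda> + s * t * real (card ?K))"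
    unfolding cardR .
  have Kpos: "0 < real (card ?K)" unfolding cardK by simp
  \<comment> \<open>At least half of the positions in each coordinate are corners since 2 l \<le> L;
    this is the source of the 2 in the bound.\<close>
  have "(real L / 2) ^ D \<le> real (L - l + 1) ^ D" using l by (intro power_mono) (auto simp: of_nat_diff)
  then have Kge: "(real L / 2) ^ D \<le> real (card ?K)" unfolding cardK by simp
  have L0: "real L > 0" using l by simp
  have "(\<Sum>c\<in>?K. T (cube D L l c)) / real (card ?K) \<le> 2 * (real (w ^ D) * \<Lambda> / (t * real (card ?K)) + s)"
    using tot t Kpos by (simp add: field_simps)
  also have "real (w ^ D) * \<Lambda> / (t * real (card ?K)) \<le> real (w ^ D) * \<Lambda> / (t * (real L / 2) ^ D)"
    using Kge Kpos t \<Lambda> L0 by (intro divide_left_mono mult_left_mono mult_pos_pos zero_less_power) auto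
  also have "\<dots> = \<Lambda> / t * (2 * real w / real L) ^ D"
    using L0 by (simp add: power_divide power_mult_distrib)
  finally have "(\<Sum>c\<in>?K. T (cube D L l c)) / real (card ?K) \<le> 2 * (\<Lambda> / t * (2 * real w / real L) ^ D + s)" by simp
  moreover have "local_dist d D L l (gibbs \<beta> H) (gibbs \<beta> (U * H * mat_adjoint U)) = (\<Sum>c\<in>?K. T (cube D L l c)) / real (card ?K)"
    unfolding local_dist_def hypercubes_eq[OF lL] T_def[symmetric] 
    using sum.reindex[OF cube_inj[OF l(1) lL], of T] card_image[OF cube_inj[OF l(1) lL]] by simp
  ultimately show ?thesis by (simp add: \<Lambda>_def t_def w_def)
qed

section \<open>Scaling\<close>

lemma local_hamiltonian_hermitian:
  assumes "local_hamiltonian d D k L H"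
  shows "hermitian_mat (d ^ (L ^ D)) H"
proof -
  let ?n = "d ^ (L ^ D)"
  obtain h where h: "\<And>s. s < L ^ D \<Longrightarrow> hermitian_mat ?n (h s)"
    and H: "H = mat ?n ?n (\<lambda>ij. \<Sum>s<L ^ D. h s $$ ij)"
    using assms unfolding local_hamiltonian_def by blast
  have "mat_adjoint H = H"
  proof (rule eq_matI)
    fix i j assume "i < dim_row H" "j < dim_col H"
    then have ij: "i < ?n" "j < ?n" by (auto simp: H)
    have "cnj (h s $$ (j, i)) = h s $$ (i, j)" if "s < L ^ D" for s
      using hermitian_index[OF h[OF that] ij] by simp
    then show "mat_adjoint H $$ (i, j) = H $$ (i, j)"
      using ij by (simp add: H)
  qed (simp_all add: H)
  then show ?thesis by (simp add: hermitian_mat_def H)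
qed

text \<open>The choices \<open>r \<approx> A N\<^sup>S\<close> for the separation and \<open>s = N\<^sup>S\<^sup>-\<^sup>1 (l + r)\<^sup>D\<close> for the tilt
  balance all error terms.\<close>
lemma local_dist_scaling:
  fixes D :: nat and \<eta> S A b x :: real
  assumes D: "D \<ge> 1" and d: "d > 0" and H: "hermitian_mat (d ^ (L ^ D)) H"
    and decay: "exp_decay_correlations d D L \<xi> (gibbs \<beta> H)" and \<xi>: "\<xi> > 0"
    and U: "U \<in> energy_ensemble H \<delta>" and \<delta>: "\<delta> > 0" "\<delta> \<le> b * x powr ((1 - \<alpha>) / real (D + 1) - \<kappa>)" and b: "b > 0"
    and x: "x = real (L ^ D)" "x \<ge> 1"
    and \<kappa>: "\<kappa> \<ge> 0" and \<eta>: "0 \<le> \<eta>" "\<eta> \<le> 1 / 2" "\<eta> \<le> (\<alpha> + \<kappa>) / 2"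
    and S: "S = (1 - \<eta>) / real (D + 1)" and A: "A = \<xi> * (2 ^ D + 1)"
    and l: "l \<ge> 1" "real (l ^ D) \<le> x powr (1 / real (D + 1))"
    and c1: "2 ^ D * x powr (1 / real (D + 1)) < x"
    and c2: "2 * (A + 1) * x powr S \<le> real L"
    and c3: "real D * ln 2 + ln x \<le> x powr S"
    and Cs: "Cs = 2 ^ D * (1 + (A + 1) ^ D)"
  shows "local_dist d D L l (gibbs \<beta> H) (gibbs \<beta> (U * H * mat_adjoint U))
    \<le> 2 * ((\<bar>\<beta>\<bar> * b + 1) * (1 + Cs) * 2 ^ D + Cs) * x powr (- \<eta> / real (D + 1))"
proof -
  define \<theta> where "\<theta> = \<eta> / real (D + 1)"
  have A0: "A > 0" using \<xi> by (simp add: A add_pos_pos)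
  have S0: "S > 0" using \<eta> by (simp add: S)
  have xS: "x powr S \<ge> 1" using x(2) S0 by (simp add: ge_one_powr_ge_zero)
  have Cs0: "Cs \<ge> 0" using A0 by (simp add: Cs)
  have mono: "x powr u \<le> x powr v" if "u \<le> v" for u v using x(2) that by (intro powr_mono) auto
  have lL: "2 * l \<le> L"
  proof (rule ccontr)
    assume "\<not> 2 * l \<le> L"
    then have "real L ^ D \<le> (2 * real l) ^ D" by (intro power_mono) auto
    then have "x \<le> 2 ^ D * real (l ^ D)" by (simp add: x power_mult_distrib)
    also have "\<dots> \<le> 2 ^ D * x powr (1 / real (D + 1))" using l by (intro mult_left_mono) auto
    finally show False using c1 by simp
  qed
  define r where "r = nat \<lceil>A * x powr S\<rceil>"
  have Ax: "A * x powr S > 0" using A0 x(2) by simp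
  have r1: "A * x powr S \<le> real r" unfolding r_def using Ax by (simp add: real_nat_ceiling_ge)
  have r0: "r > 0" using r1 Ax by (metis less_le_trans of_nat_0_less_iff)
  \<comment> \<open>Rounding up costs at most 1, which is at most \<open>x powr S\<close>; hence
    \<open>A + 1\<close>.\<close>
  have "real r \<le> A * x powr S + 1" unfolding r_def using Ax by linarith
  also have "\<dots> \<le> (A + 1) * x powr S" using xS by (simp add: distrib_right)
  finally have r2: "real r \<le> (A + 1) * x powr S" .
  have rL: "2 * r \<le> L" using r2 c2 by linarith
  define w where "w = l + r"
  have w: "1 \<le> w" "w \<le> L" using l lL rL by (auto simp: w_def)
  have wD0: "real w ^ D > 0" using w by simp
  have wD1: "real w ^ D \<ge> 1" using w by simp
  define s where "s = x powr (S - 1) * real w ^ D"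
  have s0: "s > 0" using x(2) wD0 by (simp add: s_def)
  have L0: "real L > 0" using w by simp
  have xL: "x = real L ^ D" by (simp add: x)
  have "real (w ^ D) \<le> 2 ^ D * (real (l ^ D) + real (r ^ D))"
  proof -
    have "real w ^ D \<le> (2 * real (max l r)) ^ D" by (intro power_mono) (auto simp: w_def)
    also have "\<dots> = 2 ^ D * real (max l r) ^ D" by (simp add: power_mult_distrib)
    also have "real (max l r) ^ D \<le> real l ^ D + real r ^ D" by (cases "l \<le> r") auto
    finally show ?thesis by simp
  qed
  also have "\<dots> \<le> 2 ^ D * (x powr (1 / real (D + 1)) + (A + 1) ^ D * x powr (S * real D))"
  proof -
    have "real r ^ D \<le> ((A + 1) * x powr S) ^ D" using r2 by (intro power_mono) auto
    also have "\<dots> = (A + 1) ^ D * x powr (S * real D)"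
      using x(2) by (simp add: power_mult_distrib powr_power mult.commute)
    finally show ?thesis using l by (intro mult_left_mono add_mono) auto
  qed
  finally have wD: "real w ^ D \<le> 2 ^ D * (x powr (1 / real (D + 1)) + (A + 1) ^ D * x powr (S * real D))" by simp
  \<comment> \<open>The contribution of the cube volume to s; it uses 2 \<le> D + 1 and is an
    equality for D = 1.\<close>
  have e1: "(S - 1) + 1 / real (D + 1) \<le> - \<theta>"
    using D mult_mono[of 1 "real D" 1 "real D"] by (simp add: S \<theta>_def field_simps)
  \<comment> \<open>The contribution of the separation, whose volume is of order N^(S D); here S (D
    + 1) = 1 - \<eta> produces the decay.\<close>
  have e2: "(S - 1) + S * real D \<le> - \<theta>"
  proof -
    have "(S - 1) + S * real D = S * real (D + 1) - 1" by (simp add: algebra_simps)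
    also have "\<dots> = - \<eta>" by (simp add: S)
    also have "\<dots> \<le> - \<theta>" using \<eta> by (simp add: \<theta>_def divide_le_eq mult_le_cancel_left1)
    finally show ?thesis .
  qed
  have "s \<le> x powr (S - 1) * (2 ^ D * (x powr (1 / real (D + 1)) + (A + 1) ^ D * x powr (S * real D)))"
    unfolding s_def using wD by (intro mult_left_mono) auto
  also have "\<dots> = 2 ^ D * (x powr ((S - 1) + 1 / real (D + 1)) + (A + 1) ^ D * x powr ((S - 1) + S * real D))"
    by (simp only: powr_add) (simp add: algebra_simps)
  also have "\<dots> \<le> 2 ^ D * (x powr (- \<theta>) + (A + 1) ^ D * x powr (- \<theta>))"
    using A0 by (intro mult_left_mono add_mono mono e1 e2) auto
  also have "\<dots> = Cs * x powr (- \<theta>)" by (simp add: Cs algebra_simps)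
  finally have s1: "s \<le> Cs * x powr (- \<theta>)" .
  have "x powr (- \<theta>) \<le> x powr 0" using \<eta> by (intro mono) (simp add: \<theta>_def)
  then have "x powr (- \<theta>) \<le> 1" using x(2) by simp
  then have s2: "s \<le> Cs" using s1 Cs0 mult_left_le[of "x powr (- \<theta>)" Cs] by linarith
  define mm where "mm = (L div w + 1) ^ D"
  have "real (L div w + 1) \<le> 2 * real L / real w"
  proof -
    have "real (L div w) \<le> real L / real w" by (rule of_nat_div_le_of_nat) 
    moreover have "1 \<le> real L / real w" using w by simp
    ultimately show ?thesis by simp
  qed
  then have "real (L div w + 1) ^ D \<le> (2 * real L / real w) ^ D" by (intro power_mono) auto
  then have mm1: "real mm \<le> 2 ^ D * x / real w ^ D"
    by (simp add: mm_def xL power_divide power_mult_distrib)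
  also have "\<dots> \<le> 2 ^ D * x / 1" using wD1 wD0 w x(2) by (intro divide_left_mono) auto
  finally have mm2: "real mm \<le> 2 ^ D * x" by simp
  have mm0: "real mm > 0" by (simp add: mm_def)
  have "real mm * s \<le> 2 ^ D * x / real w ^ D * s" using mm1 s0 by (intro mult_right_mono) auto
  also have "\<dots> = 2 ^ D * (x * x powr (S - 1))" using w by (simp add: s_def)
  also have "x * x powr (S - 1) = x powr S" using x(2) by (simp add: powr_mult_base)
  finally have ms: "real mm * s \<le> 2 ^ D * x powr S" .
  have "ln (real mm) \<le> ln (2 ^ D * x)" using mm0 mm2 by simp
  also have "\<dots> = real D * ln 2 + ln x" using x(2) by (simp add: ln_mult ln_realpow)
  finally have lnm: "ln (real mm) \<le> x powr S" using c3 by linarith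
  have "(1 + s) ^ mm \<le> exp s ^ mm" using s0 by (intro power_mono exp_ge_add_one_self) auto
  also have "\<dots> = exp (real mm * s)" by (simp add: exp_of_nat_mult)
  finally have "real mm * (1 + s) ^ mm * exp (- real r / \<xi>) \<le> exp (ln (real mm)) * exp (real mm * s) * exp (- real r / \<xi>)"
    using mm0 s0 by (intro mult_right_mono mult_mono) auto
  also have "\<dots> = exp (ln (real mm) + real mm * s - real r / \<xi>)" by (simp add: exp_add exp_diff exp_minus field_simps)
  also have "\<dots> \<le> exp 0"
  proof -
    \<comment> \<open>The origin of \<open>A\<close>: after taking logarithms, the share 2^D pays
      for the factor (1 + s)^m and the share 1 for the number m of cubes.\<close>
    have "(2 ^ D + 1) * x powr S = A * x powr S / \<xi>" using \<xi> by (simp add: A)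
    also have "\<dots> \<le> real r / \<xi>" using r1 \<xi> by (intro divide_right_mono) auto
    finally have "2 ^ D * x powr S + x powr S \<le> real r / \<xi>" by (simp add: distrib_right)
    then have "ln (real mm) + real mm * s - real r / \<xi> \<le> 0" using ms lnm by linarith
    then show ?thesis by simp
  qed
  finally have small: "real mm * (1 + s) ^ mm * exp (- real r / \<xi>) \<le> 1" by simp
  define \<Lambda> where "\<Lambda> = \<bar>\<beta>\<bar> * \<delta> + ln 2"
  have \<Lambda>0: "\<Lambda> \<ge> 0" using \<delta> by (simp add: \<Lambda>_def)
  have bd: "local_dist d D L l (gibbs \<beta> H) (gibbs \<beta> (U * H * mat_adjoint U))
    \<le> 2 * (\<Lambda> / ln (1 + s) * (2 * real w / real L) ^ D + s)"
    using local_dist_bound[OF d H decay \<xi> U \<delta>(1) s0 l(1) lL r0 mm_def[unfolded w_def] small]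
    unfolding \<Lambda>_def w_def .
  have ls: "s / (1 + s) \<le> ln (1 + s)"
  proof -
    have "ln (1 / (1 + s)) \<le> 1 / (1 + s) - 1" using s0 by (intro ln_le_minus_one) simp
    moreover have "1 / (1 + s) - 1 = - (s / (1 + s))" using s0 by (simp add: field_simps)
    ultimately show ?thesis using s0 by (simp add: ln_div)
  qed
  \<comment> \<open>The tilt was defined so that the volume fraction is s times a power of x; this s
    cancels against the one in ln (1 + s) \<ge> s / (1 + s).\<close>
  have wL: "(2 * real w / real L) ^ D = 2 ^ D * (s * x powr (- S))"
  proof -
    have "s * x powr (- S) = x powr (S - 1) * x powr (- S) * real w ^ D" by (simp add: s_def)
    also have "x powr (S - 1) * x powr (- S) = x powr (- 1)" unfolding powr_add[symmetric] by simp
    also have "\<dots> = 1 / x" using x(2) by (simp add: powr_minus_divide)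
    finally show ?thesis by (simp add: xL power_divide power_mult_distrib)
  qed
  have E3: "\<Lambda> * x powr (- S) \<le> (\<bar>\<beta>\<bar> * b + 1) * x powr (- \<theta>)"
  proof -
    define e where "e = (1 - \<alpha>) / real (D + 1) - \<kappa>"
    have "ln 2 \<le> (1 :: real)" using ln_le_minus_one[of 2] by simp
    moreover have "\<bar>\<beta>\<bar> * \<delta> \<le> \<bar>\<beta>\<bar> * (b * x powr e)" using \<delta> unfolding e_def by (intro mult_left_mono) auto
    ultimately have "\<Lambda> * x powr (- S) \<le> (\<bar>\<beta>\<bar> * (b * x powr e) + 1) * x powr (- S)"
      unfolding \<Lambda>_def by (intro mult_right_mono) auto
    also have "\<dots> = \<bar>\<beta>\<bar> * b * x powr (e + - S) + x powr (- S)" by (simp only: powr_add) (simp add: algebra_simps)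
    also have "\<dots> \<le> \<bar>\<beta>\<bar> * b * x powr (- \<theta>) + x powr (- \<theta>)"
    proof -
      \<comment> \<open>Here \<eta> \<le> (\<alpha> + \<kappa>) / 2 is used: the gain of \<alpha>
        and \<kappa> in \<delta> has to cover both the loss \<eta> in \<open>S\<close> and the
        desired rate \<theta>.\<close>
      have "\<kappa> / real (D + 1) \<le> \<kappa>" using \<kappa> by (simp add: divide_le_eq mult_le_cancel_left1)
      moreover have "e + - S + \<theta> = (2 * \<eta> - \<alpha>) / real (D + 1) - \<kappa>"
        unfolding e_def S \<theta>_def diff_divide_distrib by simp
      moreover have "(2 * \<eta> - \<alpha>) / real (D + 1) \<le> \<kappa> / real (D + 1)" using \<eta> by (intro divide_right_mono) auto
      ultimately have "e + - S \<le> - \<theta>" by linarith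
      then have E1: "x powr (e + - S) \<le> x powr (- \<theta>)" by (rule mono)
      \<comment> \<open>The constant ln 2 in \<Lambda> has to decay as well; this requires \<eta>
        \<le> 1 - \<eta>, the reason for the cap 1 / 2.\<close>
      have "- S \<le> - \<theta>" using \<eta> by (simp add: S \<theta>_def divide_right_mono)
      then have "x powr (- S) \<le> x powr (- \<theta>)" by (rule mono)
      with E1 show ?thesis using b by (intro add_mono mult_left_mono) auto
    qed
    finally show ?thesis by (simp add: algebra_simps)
  qed
  have "\<Lambda> / ln (1 + s) * (2 * real w / real L) ^ D \<le> \<Lambda> / (s / (1 + s)) * (2 * real w / real L) ^ D"
    using ls s0 \<Lambda>0 by (intro mult_right_mono divide_left_mono) auto
  also have "\<dots> = \<Lambda> * x powr (- S) * ((1 + s) * 2 ^ D)" unfolding wL using s0 by simp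
  also have "\<dots> \<le> ((\<bar>\<beta>\<bar> * b + 1) * x powr (- \<theta>)) * ((1 + Cs) * 2 ^ D)"
    by (rule mult_mono[OF E3]) (use s2 s0 b Cs0 in auto)
  finally have "\<Lambda> / ln (1 + s) * (2 * real w / real L) ^ D + s \<le>
      ((\<bar>\<beta>\<bar> * b + 1) * x powr (- \<theta>)) * ((1 + Cs) * 2 ^ D) + Cs * x powr (- \<theta>)"
    using s1 by linarith
  also have "\<dots> = ((\<bar>\<beta>\<bar> * b + 1) * (1 + Cs) * 2 ^ D + Cs) * x powr (- \<theta>)" by (simp add: algebra_simps)
  finally have "2 * (\<Lambda> / ln (1 + s) * (2 * real w / real L) ^ D + s) \<le>
      2 * ((\<bar>\<beta>\<bar> * b + 1) * (1 + Cs) * 2 ^ D + Cs) * x powr (- \<theta>)"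
    by (simp only: mult.assoc[of 2] mult_le_cancel_left_pos zero_less_numeral)
  then show ?thesis using bd by (simp add: \<theta>_def)
qed

section \<open>Asymptotic conditions and choice of the exponents\<close>

lemma eventually_powr_ge:
  assumes "p > (0 :: real)"
  shows "eventually (\<lambda>x. c \<le> x powr p) at_top"
  using assms by real_asymp

lemma eventually_ln_le_powr:
  assumes "p > (0 :: real)"
  shows "eventually (\<lambda>x. c + ln x \<le> x powr p) at_top"
  using assms by real_asymp

theorem mainTheorem4:
  fixes D :: nat
  assumes "D \<ge> 1"
  shows "\<exists>\<gamma>\<^sub>1>0. \<forall>(d::nat) (k::nat) (\<beta>::real) (\<xi>::real) (\<kappa>::real) (\<alpha>::real)
            (c\<^sub>\<sigma>::real) (c\<^sub>\<zeta>::real) (r::real) (a\<^sub>\<delta>::real) (b\<^sub>\<delta>::real).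
    d \<ge> 1 \<and> \<xi> > 0 \<and> \<kappa> \<ge> 0 \<and> 0 \<le> \<alpha> \<and> \<alpha> < 1 \<and> c\<^sub>\<sigma> > 0 \<and> c\<^sub>\<zeta> > 0 \<and> a\<^sub>\<delta> > 0 \<and> b\<^sub>\<delta> > 0 \<longrightarrow>
    (\<exists>C\<^sub>1>0. \<exists>\<gamma>\<^sub>4>0. \<exists>\<gamma>\<^sub>5>0. \<exists>C>0.
      \<forall>(L :: nat \<Rightarrow> nat) (N :: nat \<Rightarrow> nat) (H :: nat \<Rightarrow> complex mat) (\<rho> :: nat \<Rightarrow> complex mat)
          (\<delta> :: nat \<Rightarrow> real).
        filterlim L at_top sequentially \<and>
        (\<forall>n. N n = L n ^ D) \<and>
        (\<forall>n. local_hamiltonian d D k (L n) (H n) \<and> nondegenerate (H n)) \<and>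
        (\<forall>n. product_state d (N n) (\<rho> n)) \<and>
        (\<forall>n. \<bar>expect (gibbs \<beta> (H n)) (H n) - expect (\<rho> n) (H n)\<bar> \<le> gibbs_std \<beta> (H n)) \<and>
        (\<forall>n. exp_decay_correlations d D (L n) \<xi> (gibbs \<beta> (H n))) \<and>
        (\<forall>\<^sub>F n in sequentially. gibbs_std \<beta> (H n) \<ge> c\<^sub>\<sigma> * sqrt (real (N n))) \<and>
        (\<forall>\<^sub>F n in sequentially. berry_esseen_error \<beta> (H n)
            \<le> c\<^sub>\<zeta> * ln (real (N n)) powr r * real (N n) powr (- 1 / 2 - \<kappa>)) \<and>
        (\<forall>\<^sub>F n in sequentially.
            a\<^sub>\<delta> * real (N n) powr ((1 - \<alpha>) / real (D + 1) - \<kappa>) \<le> \<delta> n \<and>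
            \<delta> n \<le> b\<^sub>\<delta> * real (N n) powr ((1 - \<alpha>) / real (D + 1) - \<kappa>)) \<longrightarrow>
        (\<forall>\<^sub>F n in sequentially. \<forall>l::nat. \<forall>U.
            l \<ge> 1 \<and> real (l ^ D) \<le> C\<^sub>1 * real (N n) powr (1 / real (D + 1) - \<gamma>\<^sub>1 * \<alpha>) \<and>
            U \<in> energy_ensemble (H n) (\<delta> n) \<longrightarrow>
            local_dist d D (L n) l (gibbs \<beta> (H n)) (gibbs \<beta> (U * H n * mat_adjoint U))
              \<le> C * real (N n) powr (- \<gamma>\<^sub>4 * \<alpha> - \<gamma>\<^sub>5 * \<kappa>)))"
proof (rule exI[of _ 1], intro conjI allI impI)
  show "(0 :: real) < 1" by simp
  fix d k :: nat and \<beta> \<xi> \<kappa> \<alpha> c\<^sub>\<sigma> c\<^sub>\<zeta> r a b :: real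
  assume as: "d \<ge> 1 \<and> \<xi> > 0 \<and> \<kappa> \<ge> 0 \<and> 0 \<le> \<alpha> \<and> \<alpha> < 1 \<and> c\<^sub>\<sigma> > 0 \<and> c\<^sub>\<zeta> > 0 \<and> a > 0 \<and> b > 0"
  then have d: "d > 0" and \<xi>: "\<xi> > 0" and \<kappa>: "\<kappa> \<ge> 0" and \<alpha>: "0 \<le> \<alpha>" and a: "a > 0" and b: "b > 0" by auto
  \<comment> \<open>Half of \<alpha> + \<kappa> leaves room for both error terms, the tilt and the
    domination; the cap also keeps \<open>S\<close> positive.\<close>
  define \<eta> where "\<eta> = min (1 / 2) ((\<alpha> + \<kappa>) / 2)"
  \<comment> \<open>One exponent serves as both \<open>\<gamma>\<^sub>4\<close> and
    \<open>\<gamma>\<^sub>5\<close>: it solves \<gamma> (\<alpha> + \<kappa>) = \<eta> / (D + 1). If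
    \<alpha> + \<kappa> = 0, both sides vanish for any \<gamma>, and 1 is a default.\<close>
  define \<gamma> where "\<gamma> = (if \<alpha> + \<kappa> = 0 then 1 else \<eta> / (real (D + 1) * (\<alpha> + \<kappa>)))"
  define S where "S = (1 - \<eta>) / real (D + 1)"
  define A where "A = \<xi> * (2 ^ D + 1)"
  define Cs where "Cs = 2 ^ D * (1 + (A + 1) ^ D)"
  define C where "C = 2 * ((\<bar>\<beta>\<bar> * b + 1) * (1 + Cs) * 2 ^ D + Cs)"
  have \<eta>: "0 \<le> \<eta>" "\<eta> \<le> 1 / 2" "\<eta> \<le> (\<alpha> + \<kappa>) / 2" using \<alpha> \<kappa> by (auto simp: \<eta>_def min_def)
  have \<gamma>: "\<gamma> > 0"
  proof (cases "\<alpha> + \<kappa> = 0")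
    case False
    then have "\<alpha> + \<kappa> > 0" using \<alpha> \<kappa> by simp
    then show ?thesis by (auto simp: \<gamma>_def \<eta>_def intro!: divide_pos_pos mult_pos_pos)
  qed (simp add: \<gamma>_def)
  have \<gamma>e: "- \<gamma> * \<alpha> - \<gamma> * \<kappa> = - \<eta> / real (D + 1)"
  proof -
    have "\<gamma> * (\<alpha> + \<kappa>) = \<eta> / real (D + 1)" using \<eta> by (cases "\<alpha> + \<kappa> = 0") (auto simp: \<gamma>_def)
    then show ?thesis by (simp add: algebra_simps)
  qed
  have S0: "S > 0" using \<eta> by (simp add: S_def)
  \<comment> \<open>The separation of order N^S must be small compared with the side N^(1 / D) of
    the lattice.\<close>
  have SD: "1 / real D - S > 0"
  proof -
    have "S \<le> 1 / real (D + 1)" using \<eta> by (simp add: S_def divide_right_mono)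
    also have "\<dots> < 1 / real D" using assms by (simp add: frac_less2)
    finally show ?thesis by simp
  qed
  have A0: "A > 0" using \<xi> by (simp add: A_def add_pos_pos)
  have "Cs > 0" using A0 by (auto simp: Cs_def intro!: mult_pos_pos add_pos_pos)
  moreover from this have "(\<bar>\<beta>\<bar> * b + 1) * (1 + Cs) * 2 ^ D \<ge> 0" using b by simp
  ultimately have C0: "C > 0" unfolding C_def by (intro mult_pos_pos add_nonneg_pos) auto
  have one: "(0 :: real) < 1" by simp
  show "\<exists>C\<^sub>1>0. \<exists>\<gamma>\<^sub>4>0. \<exists>\<gamma>\<^sub>5>0. \<exists>C>0.
      \<forall>(L :: nat \<Rightarrow> nat) (N :: nat \<Rightarrow> nat) (H :: nat \<Rightarrow> complex mat) (\<rho> :: nat \<Rightarrow> complex mat)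
          (\<delta> :: nat \<Rightarrow> real).
        filterlim L at_top sequentially \<and>
        (\<forall>n. N n = L n ^ D) \<and>
        (\<forall>n. local_hamiltonian d D k (L n) (H n) \<and> nondegenerate (H n)) \<and>
        (\<forall>n. product_state d (N n) (\<rho> n)) \<and>
        (\<forall>n. \<bar>expect (gibbs \<beta> (H n)) (H n) - expect (\<rho> n) (H n)\<bar> \<le> gibbs_std \<beta> (H n)) \<and>
        (\<forall>n. exp_decay_correlations d D (L n) \<xi> (gibbs \<beta> (H n))) \<and>
        (\<forall>\<^sub>F n in sequentially. gibbs_std \<beta> (H n) \<ge> c\<^sub>\<sigma> * sqrt (real (N n))) \<and>
        (\<forall>\<^sub>F n in sequentially. berry_esseen_error \<beta> (H n)
            \<le> c\<^sub>\<zeta> * ln (real (N n)) powr r * real (N n) powr (- 1 / 2 - \<kappa>)) \<and>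
        (\<forall>\<^sub>F n in sequentially.
            a * real (N n) powr ((1 - \<alpha>) / real (D + 1) - \<kappa>) \<le> \<delta> n \<and>
            \<delta> n \<le> b * real (N n) powr ((1 - \<alpha>) / real (D + 1) - \<kappa>)) \<longrightarrow>
        (\<forall>\<^sub>F n in sequentially. \<forall>l::nat. \<forall>U.
            l \<ge> 1 \<and> real (l ^ D) \<le> C\<^sub>1 * real (N n) powr (1 / real (D + 1) - 1 * \<alpha>) \<and>
            U \<in> energy_ensemble (H n) (\<delta> n) \<longrightarrow>
            local_dist d D (L n) l (gibbs \<beta> (H n)) (gibbs \<beta> (U * H n * mat_adjoint U))
              \<le> C * real (N n) powr (- \<gamma>\<^sub>4 * \<alpha> - \<gamma>\<^sub>5 * \<kappa>))"
  proof (rule exI[of _ 1], rule conjI[OF one], rule exI[of _ \<gamma>], rule conjI[OF \<gamma>],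
      rule exI[of _ \<gamma>], rule conjI[OF \<gamma>], rule exI[of _ C], rule conjI[OF C0], intro allI impI, elim conjE)
    fix L N :: "nat \<Rightarrow> nat" and H \<rho> :: "nat \<Rightarrow> complex mat" and \<delta> :: "nat \<Rightarrow> real"
    assume L: "filterlim L at_top sequentially" and N: "\<forall>n. N n = L n ^ D"
      and H: "\<forall>n. local_hamiltonian d D k (L n) (H n) \<and> nondegenerate (H n)"
      and decay: "\<forall>n. exp_decay_correlations d D (L n) \<xi> (gibbs \<beta> (H n))"
      and \<delta>: "\<forall>\<^sub>F n in sequentially.
            a * real (N n) powr ((1 - \<alpha>) / real (D + 1) - \<kappa>) \<le> \<delta> n \<and>
            \<delta> n \<le> b * real (N n) powr ((1 - \<alpha>) / real (D + 1) - \<kappa>)"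
    have Lr: "filterlim (\<lambda>n. real (L n)) at_top sequentially"
      using L filterlim_compose filterlim_real_sequentially by blast
    have Nr: "filterlim (\<lambda>n. real (N n)) at_top sequentially"
      using filterlim_pow_at_top[OF _ Lr, of D] assms N by simp
    have ev: "eventually (\<lambda>n. P (real (N n))) sequentially" if "eventually P at_top" for P
      using that Nr by (simp add: filterlim_iff)
    have "1 - 1 / real (D + 1) > 0" using assms by simp
    note e1 = ev[OF eventually_powr_ge[OF this, of "2 ^ D + 1"]]
    note e2 = ev[OF eventually_powr_ge[OF SD, of "2 * (A + 1)"]]
    note e3 = ev[OF eventually_ln_le_powr[OF S0, of "real D * ln 2"]]
    note e4 = ev[OF eventually_ge_at_top[of 1]]
    show "\<forall>\<^sub>F n in sequentially. \<forall>l::nat. \<forall>U.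
            l \<ge> 1 \<and> real (l ^ D) \<le> 1 * real (N n) powr (1 / real (D + 1) - 1 * \<alpha>) \<and>
            U \<in> energy_ensemble (H n) (\<delta> n) \<longrightarrow>
            local_dist d D (L n) l (gibbs \<beta> (H n)) (gibbs \<beta> (U * H n * mat_adjoint U))
              \<le> C * real (N n) powr (- \<gamma> * \<alpha> - \<gamma> * \<kappa>)"
      using e1 e2 e3 e4 \<delta>
    proof eventually_elim
      case (elim n)
      define x where "x = real (N n)"
      note elim = elim[folded x_def]
      have x: "x = real (L n ^ D)" "x \<ge> 1" using N elim by (auto simp: x_def)
      have xp: "x powr u * x powr v = x powr (u + v)" for u v by (simp add: powr_add)
      have \<delta>0: "\<delta> n > 0"
      proof -
        have "0 < a * x powr ((1 - \<alpha>) / real (D + 1) - \<kappa>)" using a x(2) by simp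
        then show ?thesis using elim by linarith
      qed
      have c1: "2 ^ D * x powr (1 / real (D + 1)) < x"
      proof -
        \<comment> \<open>The extra 1 makes the inequality strict, as is needed to exclude cubes
          with 2 l > L.\<close>
        have "2 ^ D * x powr (1 / real (D + 1)) < (2 ^ D + 1) * x powr (1 / real (D + 1))" using x(2) by simp
        also have "\<dots> \<le> x powr (1 - 1 / real (D + 1)) * x powr (1 / real (D + 1))"
          using elim by (intro mult_right_mono) auto
        also have "\<dots> = x" unfolding xp using x(2) by simp
        finally show ?thesis .
      qed
      have c2: "2 * (A + 1) * x powr S \<le> real (L n)"
      proof -
        have "2 * (A + 1) * x powr S \<le> x powr (1 / real D - S) * x powr S"
          using elim by (intro mult_right_mono) auto
        also have "\<dots> = x powr (1 / real D)" unfolding xp by simp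
        also have "\<dots> = real (L n)"
        proof -
          have "L n > 0" using x assms by (cases "L n") (auto simp: power_0_left)
          then have "x = real (L n) powr real D" by (simp add: x powr_realpow)
          then show ?thesis using assms by (simp add: powr_powr)
        qed
        finally show ?thesis .
      qed
      show ?case
      proof (intro allI impI, elim conjE)
        fix l :: nat and U
        assume l: "l \<ge> 1" "real (l ^ D) \<le> 1 * real (N n) powr (1 / real (D + 1) - 1 * \<alpha>)"
          and U: "U \<in> energy_ensemble (H n) (\<delta> n)"
        \<comment> \<open>The only place where the size limit on l enters: with
          \<open>C\<^sub>1\<close> and \<open>\<gamma>\<^sub>1\<close> equal to 1 and \<alpha> \<ge>
          0, it lies within the range that the scaling estimate covers.\<close>
        have "x powr (1 / real (D + 1) - 1 * \<alpha>) \<le> x powr (1 / real (D + 1))"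
          using \<alpha> x(2) by (intro powr_mono) auto
        then have lD: "real (l ^ D) \<le> x powr (1 / real (D + 1))" using l by (simp add: x_def)
        show "local_dist d D (L n) l (gibbs \<beta> (H n)) (gibbs \<beta> (U * H n * mat_adjoint U))
              \<le> C * real (N n) powr (- \<gamma> * \<alpha> - \<gamma> * \<kappa>)"
          unfolding \<gamma>e C_def x_def[symmetric]
          using H decay elim c1 c2 
          by (intro local_dist_scaling[OF assms d _ _ \<xi> U \<delta>0 _ b x \<kappa> \<eta> S_def A_def l(1) lD _ _ _ Cs_def])
             (auto intro: local_hamiltonian_hermitian)
      qed
    qed
  qed
qed

end
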